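(* Suppose that $0<p<2$. The following holds. (1) Let $x\in L_2(\mathbb{T}^n_\theta)$ and $g\in\ell_p(\mathbb{Z}^n)$. Then $\lambda(x)g(-i\nabla)\in\mathscr{L}_p$, and $$\|\lambda(x)g(-i\nabla)\|_{\mathscr{L}_p}\le\|x\|_{L_2}\|g\|_{\ell_p}.$$ (2) There is a constant $c_-(p)>0$ such that, if $x\in L_2(\mathbb{T}^n_\theta)$ and $g\in\ell_{p,\infty}(\mathbb{Z}^n)$, then $\lambda(x)g(-i\nabla)\in\mathscr{L}_{p,\infty}$, and $$\|\lambda(x)g(-i\nabla)\|_{\mathscr{L}_{p,\infty}}\le c_-(p)\|x\|_{L_2}\|g\|_{\ell_{p,\infty}}.$$ Moreover, the best (i.e., smallest) constant $c_-(p)$ in this inequality satisfies $$c_-(p)\le 2^{\frac1p}(2-p)^{-\frac1p}.$$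
   Context: Let $n\ge 2$ and let $\theta=(\theta_{jk})$ be a real antisymmetric $n\times n$ matrix with columns $\theta_1,\dots,\theta_n$. On $L_2(\mathbb{T}^n)$, $\mathbb{T}^n=\mathbb{R}^n/(2\pi\mathbb{Z})^n$ (normalized Haar measure), let $U_j$ be the unitary $(U_j\xi)(x)=e^{ix_j}\xi(x+\pi\theta_j)$, so that $U_kU_j=e^{2i\pi\theta_{jk}}U_jU_k$; put $U^k=U_1^{k_1}\cdots U_n^{k_n}$ for $k\in\mathbb{Z}^n$. $L_\infty(\mathbb{T}^n_\theta)$ is the von Neumann algebra generated by $U_1,\dots,U_n$, with faithful normal tracial state $\tau(T)=\langle T1|1\rangle$, so $\tau(1)=1$ and $\tau(U^k)=0$ for $k\neq0$. $L_2(\mathbb{T}^n_\theta)$ is the noncommutative $L_2$-space of $(L_\infty(\mathbb{T}^n_\theta),\tau)$, with norm $\|x\|_{L_2}=\tau(|x|^2)^{1/2}$, inner product $\langle u|v\rangle=\tau(uv^* )$ and orthonormal basis $(U^k)_{k\in\mathbb{Z}^n}$. For $x\in L_2(\mathbb{T}^n_\theta)$, $\lambda(x)$ is left multiplication $u\mapsto xu$, a bounded operator $L_\infty(\mathbb{T}^n_\theta)\to L_2(\mathbb{T}^n_\theta)$, regarded as an unbounded operator on $L_2(\mathbb{T}^n_\theta)$ with domain $L_\infty(\mathbb{T}^n_\theta)$. For $g\in\ell_\infty(\mathbb{Z}^n)$, $g(-i\nabla)$ is the bounded operator on $L_2(\mathbb{T}^n_\theta)$ with $g(-i\nabla)U^k=g(k)U^k$.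 If $g\in\ell_2(\mathbb{Z}^n)$ (in particular if $g\in\ell_p$ or $g\in\ell_{p,\infty}$ with $p<2$), then $g(-i\nabla)$ maps $L_2(\mathbb{T}^n_\theta)$ to $L_\infty(\mathbb{T}^n_\theta)$ and $\lambda(x)g(-i\nabla)$ is a bounded operator on $L_2(\mathbb{T}^n_\theta)$. For $0<p<\infty$: $\ell_p(\mathbb{Z}^n)$ has (quasi-)norm $\|a\|_{\ell_p}=(\sum_k|a_k|^p)^{1/p}$; $\ell_{p,\infty}(\mathbb{Z}^n)$ consists of bounded sequences $a$ whose non-increasing rearrangement $(\mu_j(a))_{j\ge0}$ of $(|a_k|)$ has $\|a\|_{\ell_{p,\infty}}=\sup_{j\ge0}(j+1)^{1/p}\mu_j(a)<\infty$. For a compact operator $T$ on $L_2(\mathbb{T}^n_\theta)$, $\mu_j(T)$ is its $(j+1)$-th singular value; $\mathscr{L}_p$ is the Schatten class, $\|T\|_{\mathscr{L}_p}=(\sum_j\mu_j(T)^p)^{1/p}$; $\mathscr{L}_{p,\infty}$ is the weak Schatten class, $\|T\|_{\mathscr{L}_{p,\infty}}=\sup_{j\ge0}(j+1)^{1/p}\mu_j(T)$. *)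

theory Defs
  imports "HOL-Analysis.Analysis"
begin

section \<open>Complex inner product spaces\<close>

text \<open>The inner product is linear in its first argument.\<close>

class complex_inner = real_inner +
  fixes scaleC :: "complex \<Rightarrow> 'a \<Rightarrow> 'a"  (infixr "*\<^sub>C" 75)
    and cinner :: "'a \<Rightarrow> 'a \<Rightarrow> complex"
  assumes scaleC_add_right: "c *\<^sub>C (x + y) = c *\<^sub>C x + c *\<^sub>C y"
    and scaleC_add_left: "(c + d) *\<^sub>C x = c *\<^sub>C x + d *\<^sub>C x"
    and scaleC_scaleC: "c *\<^sub>C (d *\<^sub>C x) = (c * d) *\<^sub>C x"
    and scaleR_scaleC: "r *\<^sub>R x = complex_of_real r *\<^sub>C x"
    and cinner_commute: "cinner x y = cnj (cinner y x)"
    and cinner_add_left: "cinner (x + y) z = cinner x z + cinner y z"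
    and cinner_scaleC_left: "cinner (c *\<^sub>C x) y = c * cinner x y"
    and inner_eq_Re_cinner: "inner x y = Re (cinner x y)"

class complex_hilbert = complex_inner + complete_space

lemma vector_space_scaleC: "vector_space (scaleC :: complex \<Rightarrow> 'a \<Rightarrow> 'a::complex_inner)"
proof
  fix x :: 'a
  show "1 *\<^sub>C x = x"
    using scaleR_scaleC[of 1 x] by simp
qed (simp_all add: scaleC_add_right scaleC_add_left scaleC_scaleC)


section \<open>Operators, singular values, Schatten classes\<close>

text \<open>Bounded complex linear operators are plain functions satisfying this predicate.\<close>

definition bounded_clinear :: "('a::complex_inner \<Rightarrow> 'b::complex_inner) \<Rightarrow> bool" where
  "bounded_clinear T \<longleftrightarrow> bounded_linear T \<and> (\<forall>c v. T (c *\<^sub>C v) = c *\<^sub>C T v)"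

definition cadjoint :: "('a::complex_inner \<Rightarrow> 'a) \<Rightarrow> ('a \<Rightarrow> 'a)" where
  "cadjoint T = (THE S. \<forall>v w. cinner (T v) w = cinner v (S w))"

definition compact_operator :: "('a::complex_inner \<Rightarrow> 'a) \<Rightarrow> bool" where
  "compact_operator T \<longleftrightarrow> bounded_clinear T \<and> compact (closure (T ` cball 0 1))"

text \<open>The multiplicity of \<open>s > 0\<close> as a singular value of \<open>T\<close>, that is, of \<open>s\<^sup>2\<close> as an eigenvalue
  of \<open>T\<^sup>*T\<close>.\<close>

definition singular_mult :: "('a::complex_inner \<Rightarrow> 'a) \<Rightarrow> real \<Rightarrow> nat" where
  "singular_mult T s =
     vector_space.dim scaleC {v. cadjoint T (T v) = complex_of_real (s\<^sup>2) *\<^sub>C v}"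

text \<open>For compact \<open>T\<close>: the non-increasing enumeration of the positive singular values, each
  repeated according to its multiplicity, followed by zeros if there are only finitely many.
  The limit condition makes every set \<open>{j. \<mu> j = s}\<close> with \<open>s > 0\<close> finite.\<close>

definition singular_value :: "('a::complex_inner \<Rightarrow> 'a) \<Rightarrow> nat \<Rightarrow> real" where
  "singular_value T = (THE \<mu>. decseq \<mu> \<and> \<mu> \<longlonglongrightarrow> 0 \<and>
     (\<forall>s>0. card {j. \<mu> j = s} = singular_mult T s))"

definition schatten :: "real \<Rightarrow> ('a::complex_inner \<Rightarrow> 'a) set" where
  "schatten p = {T. compact_operator T \<and> summable (\<lambda>j. singular_value T j powr p)}"

definition schatten_norm :: "real \<Rightarrow> ('a::complex_inner \<Rightarrow> 'a) \<Rightarrow> real" where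
  "schatten_norm p T = (\<Sum>j. singular_value T j powr p) powr (1 / p)"

definition weak_schatten :: "real \<Rightarrow> ('a::complex_inner \<Rightarrow> 'a) set" where
  "weak_schatten p = {T. compact_operator T \<and>
     bdd_above (range (\<lambda>j. real (j + 1) powr (1 / p) * singular_value T j))}"

definition weak_schatten_norm :: "real \<Rightarrow> ('a::complex_inner \<Rightarrow> 'a) \<Rightarrow> real" where
  "weak_schatten_norm p T = (SUP j. real (j + 1) powr (1 / p) * singular_value T j)"


section \<open>Sequence spaces\<close>

definition ell :: "real \<Rightarrow> ('k \<Rightarrow> complex) set" where
  "ell p = {a. (\<lambda>k. cmod (a k) powr p) summable_on UNIV}"

definition ell_norm :: "real \<Rightarrow> ('k \<Rightarrow> complex) \<Rightarrow> real" where
  "ell_norm p a = (\<Sum>\<^sub>\<infinity>k. cmod (a k) powr p) powr (1 / p)"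

definition rearrangement :: "('k \<Rightarrow> complex) \<Rightarrow> nat \<Rightarrow> real" where
  "rearrangement a j =
     Inf {t. 0 \<le> t \<and> finite {k. t < cmod (a k)} \<and> card {k. t < cmod (a k)} \<le> j}"

definition weak_ell :: "real \<Rightarrow> ('k \<Rightarrow> complex) set" where
  "weak_ell p = {a. bounded (range a) \<and>
     bdd_above (range (\<lambda>j. real (j + 1) powr (1 / p) * rearrangement a j))}"

definition weak_ell_norm :: "real \<Rightarrow> ('k \<Rightarrow> complex) \<Rightarrow> real" where
  "weak_ell_norm p a = (SUP j. real (j + 1) powr (1 / p) * rearrangement a j)"


section \<open>The Hilbert space of square-integrable functions on the torus\<close>

text \<open>Functions on the torus are \<open>2\<pi>\<close>-periodic functions on \<open>\<real>\<^sup>n\<close>; normalized Haar measure is the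
  normalized Lebesgue measure on the fundamental cube.\<close>

definition lattice_vec :: "int ^ 'n \<Rightarrow> real ^ 'n" where
  "lattice_vec m = (\<chi> j. 2 * pi * of_int (m $ j))"

definition torus_cube :: "(real ^ 'n::finite) set" where
  "torus_cube = {x. \<forall>j. 0 \<le> x $ j \<and> x $ j < 2 * pi}"

definition torus_measure :: "(real ^ 'n::finite) measure" where
  "torus_measure = uniform_measure lborel torus_cube"

definition torus_periodic :: "(real ^ 'n \<Rightarrow> 'b) \<Rightarrow> bool" where
  "torus_periodic f \<longleftrightarrow> (\<forall>x m. f (x + lattice_vec m) = f x)"

definition torus_sq_integrable :: "(real ^ 'n::finite \<Rightarrow> complex) \<Rightarrow> bool" where
  "torus_sq_integrable f \<longleftrightarrow> f \<in> borel_measurable borel \<and> torus_periodic f \<and>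
     integrable torus_measure (\<lambda>x. (cmod (f x))\<^sup>2)"

definition torus_L2_rel :: "(real ^ 'n::finite \<Rightarrow> complex) \<Rightarrow> (real ^ 'n \<Rightarrow> complex) \<Rightarrow> bool" where
  "torus_L2_rel f g \<longleftrightarrow> torus_sq_integrable f \<and> torus_sq_integrable g \<and>
     (AE x in torus_measure. f x = g x)"

lemma sets_torus_cube [measurable, simp]: "(torus_cube :: (real ^ 'n::finite) set) \<in> sets borel"
proof -
  have "(torus_cube :: (real ^ 'n) set) = (\<Inter>j. {x. 0 \<le> x $ j} \<inter> {x. x $ j < 2 * pi})"
    by (auto simp: torus_cube_def)
  also have "\<dots> \<in> sets borel"
    by (intro sets.countable_INT sets.Int borel_closed borel_open
          closed_Collect_le open_Collect_less continuous_intros) auto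
  finally show ?thesis .
qed

lemma emeasure_torus_cube:
  "emeasure lborel (torus_cube :: (real ^ 'n::finite) set) \<noteq> 0"
  "emeasure lborel (torus_cube :: (real ^ 'n::finite) set) \<noteq> \<infinity>"
proof -
  let ?b = "(\<chi> j. 2 * pi) :: real ^ 'n"
  have 1: "box 0 ?b \<subseteq> torus_cube" "torus_cube \<subseteq> cbox 0 ?b"
    by (auto simp: torus_cube_def mem_box_cart less_imp_le)
  have "0 < emeasure lborel (box 0 ?b)"
    by (subst emeasure_lborel_box)
       (auto simp: Basis_vec_def inner_axis intro!: prod_pos less_imp_le)
  also have "\<dots> \<le> emeasure lborel (torus_cube :: (real ^ 'n) set)"
    by (rule emeasure_mono) (use 1 in auto)
  finally show "emeasure lborel (torus_cube :: (real ^ 'n) set) \<noteq> 0" by simp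
  have "emeasure lborel (torus_cube :: (real ^ 'n) set) \<le> emeasure lborel (cbox 0 ?b)"
    by (rule emeasure_mono) (use 1 in auto)
  also have "\<dots> < \<infinity>" by (rule emeasure_lborel_cbox_finite)
  finally show "emeasure lborel (torus_cube :: (real ^ 'n) set) \<noteq> \<infinity>" by simp
qed


lemma sets_torus_measure [measurable_cong, simp]: "sets torus_measure = sets borel"
  by (simp add: torus_measure_def)

lemma nn_integral_torus:
  fixes h :: "real ^ 'n::finite \<Rightarrow> ennreal"
  assumes "h \<in> borel_measurable borel"
  shows "(\<integral>\<^sup>+x. h x \<partial>torus_measure) =
    (\<integral>\<^sup>+x. h x * indicator torus_cube x \<partial>lborel) / emeasure lborel (torus_cube :: (real ^ 'n) set)"
  unfolding torus_measure_def using assms by (subst nn_integral_uniform_measure) auto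

lemma nn_integral_lborel_shift:
  assumes "h \<in> borel_measurable borel"
  shows "(\<integral>\<^sup>+x. h (a + x) \<partial>lborel) = (\<integral>\<^sup>+x. h x \<partial>(lborel :: (real ^ 'n::finite) measure))"
proof -
  have "(\<integral>\<^sup>+x. h x \<partial>(lborel :: (real ^ 'n) measure)) = (\<integral>\<^sup>+x. h x \<partial>distr lborel borel ((+) a))"
    by (simp add: lborel_distr_plus)
  also have "\<dots> = (\<integral>\<^sup>+x. h (a + x) \<partial>lborel)"
    by (rule nn_integral_distr) (use assms in auto)
  finally show ?thesis by simp
qed

lemma torus_tiling:
  fixes y :: "real ^ 'n::finite"
  shows "(\<integral>\<^sup>+m. indicator torus_cube (y + lattice_vec m) \<partial>count_space UNIV) = (1 :: ennreal)"
proof -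
  define m0 :: "int ^ 'n" where "m0 = (\<chi> j. - \<lfloor>y $ j / (2 * pi)\<rfloor>)"
  have *: "(0 \<le> t + 2 * pi * of_int m \<and> t + 2 * pi * of_int m < 2 * pi) \<longleftrightarrow> m = - \<lfloor>t / (2 * pi)\<rfloor>" for t m
  proof -
    have "(m = - \<lfloor>t / (2 * pi)\<rfloor>) \<longleftrightarrow> \<lfloor>t / (2 * pi)\<rfloor> = - m" by auto
    also have "\<dots> \<longleftrightarrow> of_int (- m) \<le> t / (2 * pi) \<and> t / (2 * pi) < of_int (- m) + 1"
      by (rule floor_eq_iff)
    also have "\<dots> \<longleftrightarrow> (0 \<le> t + 2 * pi * of_int m \<and> t + 2 * pi * of_int m < 2 * pi)"
      by (auto simp: field_simps)
    finally show ?thesis by simp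
  qed
  have "y + lattice_vec m \<in> torus_cube \<longleftrightarrow> m = m0" for m
    by (auto simp: torus_cube_def lattice_vec_def m0_def vec_eq_iff *)
  hence "(\<lambda>m. indicator torus_cube (y + lattice_vec m) :: ennreal) = indicator {m0}"
    by (auto simp: indicator_def fun_eq_iff)
  thus ?thesis by simp
qed

lemma nn_integral_torus_shift:
  fixes h :: "real ^ 'n::finite \<Rightarrow> ennreal"
  assumes h [measurable]: "h \<in> borel_measurable borel" and per: "torus_periodic h"
  shows "(\<integral>\<^sup>+x. h (x + a) \<partial>torus_measure) = (\<integral>\<^sup>+x. h x \<partial>torus_measure)"
proof -
  let ?C = "torus_cube :: (real ^ 'n) set"
  have "(\<integral>\<^sup>+x. h (x + a) * indicator ?C x \<partial>lborel) =
      (\<integral>\<^sup>+x. h (a + x) * indicator ?C (- a + (a + x)) \<partial>lborel)"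
    by (simp add: add.commute)
  also have "\<dots> = (\<integral>\<^sup>+x. h x * indicator ?C (- a + x) \<partial>lborel)"
    by (rule nn_integral_lborel_shift[where h = "\<lambda>x. h x * indicator ?C (- a + x)"]) measurable
  also have "\<dots> = (\<integral>\<^sup>+x. h x * indicator ?C (- a + x) *
      (\<integral>\<^sup>+m. indicator ?C (x + lattice_vec m) \<partial>count_space UNIV) \<partial>lborel)"
    by (simp add: torus_tiling)
  also have "\<dots> = (\<integral>\<^sup>+x. (\<integral>\<^sup>+m. h x * indicator ?C (- a + x) *
      indicator ?C (x + lattice_vec m) \<partial>count_space UNIV) \<partial>lborel)"
    by (subst nn_integral_cmult) auto
  also have "\<dots> = (\<integral>\<^sup>+m. (\<integral>\<^sup>+x. h x * indicator ?C (- a + x) *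
      indicator ?C (x + lattice_vec m) \<partial>lborel) \<partial>count_space (UNIV :: (int ^ 'n) set))"
    by (rule nn_integral_count_space_nn_integral) auto
  also have "\<dots> = (\<integral>\<^sup>+m. (\<integral>\<^sup>+x. h x * indicator ?C x *
      indicator ?C ((x - a) + lattice_vec (- m)) \<partial>lborel) \<partial>count_space (UNIV :: (int ^ 'n) set))"
  proof (rule nn_integral_cong)
    fix m :: "int ^ 'n"
    have L: "lattice_vec (- m) = - lattice_vec m"
      by (auto simp: lattice_vec_def vec_eq_iff)
    have P: "h (- lattice_vec m + x) = h x" for x
      using per L unfolding torus_periodic_def by (metis add.commute)
    have "(\<integral>\<^sup>+x. h x * indicator ?C (- a + x) * indicator ?C (x + lattice_vec m) \<partial>lborel) =
      (\<integral>\<^sup>+x. h (- lattice_vec m + x) * indicator ?C (- a + (- lattice_vec m + x)) *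
         indicator ?C ((- lattice_vec m + x) + lattice_vec m) \<partial>lborel)"
      by (rule nn_integral_lborel_shift[symmetric]) measurable
    also have "\<dots> = (\<integral>\<^sup>+x. h x * indicator ?C x *
        indicator ?C ((x - a) + lattice_vec (- m)) \<partial>lborel)"
      unfolding P L by (intro nn_integral_cong) (simp add: algebra_simps)
    finally show "(\<integral>\<^sup>+x. h x * indicator ?C (- a + x) * indicator ?C (x + lattice_vec m) \<partial>lborel) =
       (\<integral>\<^sup>+x. h x * indicator ?C x * indicator ?C ((x - a) + lattice_vec (- m)) \<partial>lborel)" .
  qed
  also have "\<dots> = (\<integral>\<^sup>+x. (\<integral>\<^sup>+m. h x * indicator ?C x *
      indicator ?C ((x - a) + lattice_vec (- m)) \<partial>count_space (UNIV :: (int ^ 'n) set)) \<partial>lborel)"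
    by (rule nn_integral_count_space_nn_integral[symmetric]) auto
  also have "\<dots> = (\<integral>\<^sup>+x. h x * indicator ?C x * (\<integral>\<^sup>+m.
      indicator ?C ((x - a) + lattice_vec (- m)) \<partial>count_space (UNIV :: (int ^ 'n) set)) \<partial>lborel)"
    by (subst nn_integral_cmult) auto
  also have "\<dots> = (\<integral>\<^sup>+x. h x * indicator ?C x * (\<integral>\<^sup>+m.
      indicator ?C ((x - a) + lattice_vec m) \<partial>count_space (UNIV :: (int ^ 'n) set)) \<partial>lborel)"
  proof -
    have bij: "bij_betw (uminus :: int ^ 'n \<Rightarrow> _) UNIV UNIV"
      by (rule bij_betwI[where g = uminus]) auto
    have "(\<integral>\<^sup>+m. indicator ?C (z + lattice_vec (- m)) \<partial>count_space UNIV) =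
        (\<integral>\<^sup>+m. indicator ?C (z + lattice_vec m) \<partial>count_space (UNIV :: (int ^ 'n) set))" for z
      using nn_integral_bij_count_space[OF bij, of "\<lambda>m. indicator ?C (z + lattice_vec m)"] .
    thus ?thesis by simp
  qed
  also have "\<dots> = (\<integral>\<^sup>+x. h x * indicator ?C x \<partial>lborel)"
    by (simp add: torus_tiling)
  finally show ?thesis
    by (simp add: nn_integral_torus)
qed

lemma torus_periodic_comp: "torus_periodic f \<Longrightarrow> torus_periodic (\<lambda>x. F (f x))"
  by (simp add: torus_periodic_def)

lemma torus_periodic_shift: "torus_periodic f \<Longrightarrow> torus_periodic (\<lambda>x. f (x + a))"
  unfolding torus_periodic_def by (metis (no_types) add.commute add.left_commute)

lemma AE_torus_shift:
  fixes P :: "real ^ 'n::finite \<Rightarrow> bool"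
  assumes P [measurable]: "Measurable.pred borel P" and per: "torus_periodic P"
    and AE: "AE x in torus_measure. P x"
  shows "AE x in torus_measure. P (x + a)"
proof -
  let ?h = "\<lambda>x. indicator {x. \<not> P x} x :: ennreal"
  have ph: "torus_periodic ?h"
    using per by (auto simp: torus_periodic_def indicator_def)
  have "(\<integral>\<^sup>+x. ?h (x + a) \<partial>torus_measure) = (\<integral>\<^sup>+x. ?h x \<partial>torus_measure)"
    by (rule nn_integral_torus_shift) (use ph in auto)
  also have "\<dots> = 0"
    by (subst nn_integral_0_iff_AE) (use AE in \<open>auto simp: indicator_def\<close>)
  finally have "AE x in torus_measure. ?h (x + a) = 0"
    by (subst (asm) nn_integral_0_iff_AE) auto
  thus ?thesis by (auto simp: indicator_def)
qed

lemma torus_sq_integrable_shift_mult: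
  fixes f :: "real ^ 'n::finite \<Rightarrow> complex"
  assumes f: "torus_sq_integrable f"
  shows "torus_sq_integrable (\<lambda>x. cis (x $ j) * f (x + a))"
proof -
  have [measurable]: "f \<in> borel_measurable borel" and per: "torus_periodic f"
    and int: "integrable torus_measure (\<lambda>x. (cmod (f x))\<^sup>2)"
    using f by (auto simp: torus_sq_integrable_def)
  have [measurable]: "(\<lambda>x :: real ^ 'n. cis (x $ j)) \<in> borel_measurable borel"
    by (intro borel_measurable_continuous_onI continuous_intros)
  have fin: "(\<integral>\<^sup>+x. ennreal ((cmod (f x))\<^sup>2) \<partial>torus_measure) < \<infinity>"
    using int by (auto simp: integrable_iff_bounded)
  have "(\<integral>\<^sup>+x. ennreal ((cmod (f (x + a)))\<^sup>2) \<partial>torus_measure)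
      = (\<integral>\<^sup>+x. ennreal ((cmod (f x))\<^sup>2) \<partial>torus_measure)"
    by (rule nn_integral_torus_shift) (use torus_periodic_comp[OF per] in auto)
  with fin have "integrable torus_measure (\<lambda>x. (cmod (cis (x $ j) * f (x + a)))\<^sup>2)"
    by (auto simp: integrable_iff_bounded norm_mult)
  moreover have "cis ((x + lattice_vec m) $ j) = cis (x $ j)" for x and m :: "int ^ 'n"
  proof -
    have "cis ((x + lattice_vec m) $ j) = cis (x $ j) * cis (2 * pi * of_int (m $ j))"
      unfolding cis_mult by (simp add: lattice_vec_def)
    also have "cis (2 * pi * of_int (m $ j)) = 1"
      by (rule cis_multiple_2pi) simp
    finally show ?thesis by simp
  qed
  hence "torus_periodic (\<lambda>x. cis (x $ j) * f (x + a))"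
    using torus_periodic_shift[OF per, of a] by (simp add: torus_periodic_def)
  ultimately show ?thesis
    by (auto simp: torus_sq_integrable_def)
qed

lemma torus_sq_integrable_add:
  assumes "torus_sq_integrable f" "torus_sq_integrable g"
  shows "torus_sq_integrable (\<lambda>x. f x + g x)"
proof -
  have [measurable]: "f \<in> borel_measurable borel" "g \<in> borel_measurable borel"
    using assms by (auto simp: torus_sq_integrable_def)
  have "integrable torus_measure (\<lambda>x. (cmod (f x + g x))\<^sup>2)"
  proof (rule Bochner_Integration.integrable_bound)
    show "integrable torus_measure (\<lambda>x. 2 * (cmod (f x))\<^sup>2 + 2 * (cmod (g x))\<^sup>2)"
      using assms by (auto simp: torus_sq_integrable_def)
    have "(cmod (u + v))\<^sup>2 \<le> 2 * (cmod u)\<^sup>2 + 2 * (cmod v)\<^sup>2" for u v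
    proof -
      have "(cmod (u + v))\<^sup>2 \<le> (cmod u + cmod v)\<^sup>2"
        by (intro power_mono norm_triangle_ineq) auto
      also have "\<dots> \<le> 2 * (cmod u)\<^sup>2 + 2 * (cmod v)\<^sup>2"
        using sum_squares_bound[of "cmod u" "cmod v"] by (simp add: power2_sum)
      finally show ?thesis .
    qed
    thus "AE x in torus_measure. norm ((cmod (f x + g x))\<^sup>2)
        \<le> norm (2 * (cmod (f x))\<^sup>2 + 2 * (cmod (g x))\<^sup>2)" by auto
  qed measurable
  thus ?thesis using assms by (auto simp: torus_sq_integrable_def torus_periodic_def)
qed

lemma torus_sq_integrable_cmult:
  "torus_sq_integrable f \<Longrightarrow> torus_sq_integrable (\<lambda>x. c * f x)"
  by (auto simp: torus_sq_integrable_def torus_periodic_def norm_mult power_mult_distrib)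

lemma torus_sq_integrable_const: "torus_sq_integrable (\<lambda>_ :: real ^ 'n::finite. c)"
proof -
  have "emeasure torus_measure (space (torus_measure :: (real ^ 'n) measure)) < \<infinity>"
    using emeasure_torus_cube unfolding torus_measure_def
    by (subst emeasure_uniform_measure) (auto simp: divide_ennreal_def ennreal_mult_eq_top_iff less_top[symmetric])
  hence "finite_measure (torus_measure :: (real ^ 'n) measure)"
    by (intro finite_measureI) auto
  then interpret finite_measure "torus_measure :: (real ^ 'n) measure" .
  show ?thesis by (simp add: torus_sq_integrable_def torus_periodic_def)
qed


lemma torus_integrable_product:
  assumes "torus_sq_integrable f" "torus_sq_integrable g"
  shows "integrable torus_measure (\<lambda>x. f x * cnj (g x))"
proof (rule Bochner_Integration.integrable_bound)
  have [measurable]: "f \<in> borel_measurable borel" "g \<in> borel_measurable borel"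
    using assms by (auto simp: torus_sq_integrable_def)
  show "integrable torus_measure (\<lambda>x. (cmod (f x))\<^sup>2 + (cmod (g x))\<^sup>2)"
    using assms by (auto simp: torus_sq_integrable_def)
  have [measurable]: "cnj \<in> borel_measurable borel"
    by (intro borel_measurable_continuous_onI continuous_intros)
  show "(\<lambda>x. f x * cnj (g x)) \<in> borel_measurable torus_measure"
    by measurable
  have "cmod u * cmod v \<le> (cmod u)\<^sup>2 + (cmod v)\<^sup>2" for u v
  proof -
    have "0 \<le> cmod u * cmod v" by simp
    with sum_squares_bound[of "cmod u" "cmod v"] show ?thesis by linarith
  qed
  thus "AE x in torus_measure. norm (f x * cnj (g x)) \<le> norm ((cmod (f x))\<^sup>2 + (cmod (g x))\<^sup>2)"
    by (auto simp: norm_mult)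
qed

lemma torus_inner_cong:
  assumes "torus_L2_rel f f'" "torus_L2_rel g g'"
  shows "(LINT x|torus_measure. f x * cnj (g x)) = (LINT x|torus_measure. f' x * cnj (g' x))"
proof -
  have "torus_sq_integrable f" "torus_sq_integrable g" "torus_sq_integrable f'"
    "torus_sq_integrable g'" and *: "AE x in torus_measure. f x = f' x" "AE x in torus_measure. g x = g' x"
    using assms by (auto simp: torus_L2_rel_def)
  hence "integrable torus_measure (\<lambda>x. f x * cnj (g x))" "integrable torus_measure (\<lambda>x. f' x * cnj (g' x))"
    by (auto intro: torus_integrable_product)
  thus ?thesis
    by (intro integral_cong_AE borel_measurable_integrable) (use * in auto)
qed

lemma torus_inner_commute:
  "(LINT x|torus_measure. f x * cnj (g x)) = cnj (LINT x|torus_measure. g x * cnj (f x))"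
proof -
  have "cnj (LINT x|torus_measure. g x * cnj (f x)) = (LINT x|torus_measure. cnj (g x * cnj (f x)))"
    by (rule Bochner_Integration.integral_cnj[symmetric])
  thus ?thesis by (simp add: mult.commute)
qed

text \<open>The space \<open>L\<^sub>2\<close> of the torus: square-integrable functions modulo equality almost everywhere.\<close>

quotient_type (overloaded) 'n torus_L2 = "real ^ 'n::finite \<Rightarrow> complex" / partial: torus_L2_rel
  morphisms rep_torus_L2 abs_torus_L2
proof (rule part_equivpI)
  show "\<exists>x. torus_L2_rel x x"
    using torus_sq_integrable_const[of 0] by (auto simp: torus_L2_rel_def)
  show "symp torus_L2_rel" by (auto simp: symp_def torus_L2_rel_def)
  show "transp torus_L2_rel" by (auto simp: transp_def torus_L2_rel_def)
qed

instantiation torus_L2 :: (finite) ab_group_add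
begin

lift_definition zero_torus_L2 :: "'a torus_L2" is "\<lambda>_. 0"
  using torus_sq_integrable_const by (auto simp: torus_L2_rel_def)

lift_definition plus_torus_L2 :: "'a torus_L2 \<Rightarrow> 'a torus_L2 \<Rightarrow> 'a torus_L2" is "\<lambda>f g x. f x + g x"
  by (auto simp: torus_L2_rel_def torus_sq_integrable_add)

lift_definition uminus_torus_L2 :: "'a torus_L2 \<Rightarrow> 'a torus_L2" is "\<lambda>f x. - f x"
  by (use torus_sq_integrable_cmult[of _ "-1"] in \<open>auto simp: torus_L2_rel_def\<close>)

definition minus_torus_L2 :: "'a torus_L2 \<Rightarrow> 'a torus_L2 \<Rightarrow> 'a torus_L2" where
  "minus_torus_L2 \<xi> \<eta> = \<xi> + (- \<eta>)"

instance
proof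
  fix \<xi> \<eta> \<zeta> :: "'a torus_L2"
  show "\<xi> + \<eta> + \<zeta> = \<xi> + (\<eta> + \<zeta>)"
    by transfer (auto simp: torus_L2_rel_def add.assoc torus_sq_integrable_add)
  show "\<xi> + \<eta> = \<eta> + \<xi>"
    by transfer (auto simp: torus_L2_rel_def add.commute torus_sq_integrable_add)
  show "0 + \<xi> = \<xi>"
    by transfer (auto simp: torus_L2_rel_def)
  show "- \<xi> + \<xi> = 0"
    by transfer (auto simp: torus_L2_rel_def torus_sq_integrable_const)
  show "\<xi> - \<eta> = \<xi> + - \<eta>" by (rule minus_torus_L2_def)
qed

end

instantiation torus_L2 :: (finite) real_vector
begin

lift_definition scaleR_torus_L2 :: "real \<Rightarrow> 'a torus_L2 \<Rightarrow> 'a torus_L2" is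
  "\<lambda>r f x. complex_of_real r * f x"
  by (auto simp: torus_L2_rel_def torus_sq_integrable_cmult)

instance
proof
  fix \<xi> \<eta> :: "'a torus_L2" and r s :: real
  show "r *\<^sub>R (\<xi> + \<eta>) = r *\<^sub>R \<xi> + r *\<^sub>R \<eta>"
    by transfer
      (auto simp: torus_L2_rel_def ring_distribs torus_sq_integrable_add torus_sq_integrable_cmult)
  show "(r + s) *\<^sub>R \<xi> = r *\<^sub>R \<xi> + s *\<^sub>R \<xi>"
    by transfer
      (use torus_sq_integrable_cmult[of _ "complex_of_real (_ + _)"] in
        \<open>auto simp: torus_L2_rel_def ring_distribs torus_sq_integrable_add torus_sq_integrable_cmult\<close>)
  show "r *\<^sub>R s *\<^sub>R \<xi> = (r * s) *\<^sub>R \<xi>"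
    by transfer (auto simp: torus_L2_rel_def mult.assoc torus_sq_integrable_cmult)
  show "1 *\<^sub>R \<xi> = \<xi>"
    by transfer (auto simp: torus_L2_rel_def)
qed

end

instantiation torus_L2 :: (finite) real_inner
begin

lift_definition inner_torus_L2 :: "'a torus_L2 \<Rightarrow> 'a torus_L2 \<Rightarrow> real" is
  "\<lambda>f g. Re (LINT x|torus_measure. f x * cnj (g x))"
  by (simp add: torus_inner_cong)

definition norm_torus_L2 :: "'a torus_L2 \<Rightarrow> real" where
  "norm_torus_L2 \<xi> = sqrt (\<xi> \<bullet> \<xi>)"

definition dist_torus_L2 :: "'a torus_L2 \<Rightarrow> 'a torus_L2 \<Rightarrow> real" where
  "dist_torus_L2 \<xi> \<eta> = norm (\<xi> - \<eta>)"

definition sgn_torus_L2 :: "'a torus_L2 \<Rightarrow> 'a torus_L2" where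
  "sgn_torus_L2 \<xi> = \<xi> /\<^sub>R norm \<xi>"

definition uniformity_torus_L2 :: "('a torus_L2 \<times> 'a torus_L2) filter" where
  "uniformity_torus_L2 = (INF e\<in>{0<..}. principal {(\<xi>, \<eta>). dist \<xi> \<eta> < e})"

definition open_torus_L2 :: "'a torus_L2 set \<Rightarrow> bool" where
  "open_torus_L2 S \<longleftrightarrow> (\<forall>\<xi>\<in>S. \<forall>\<^sub>F (\<xi>', \<eta>) in uniformity. \<xi>' = \<xi> \<longrightarrow> \<eta> \<in> S)"

instance
proof
  fix \<xi> \<eta> \<zeta> :: "'a torus_L2" and r :: real
  show "dist \<xi> \<eta> = norm (\<xi> - \<eta>)" by (rule dist_torus_L2_def)
  show "sgn \<xi> = \<xi> /\<^sub>R norm \<xi>" by (rule sgn_torus_L2_def)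
  show "(uniformity :: ('a torus_L2 \<times> 'a torus_L2) filter) =
      (INF e\<in>{0<..}. principal {(\<xi>, \<eta>). dist \<xi> \<eta> < e})"
    by (rule uniformity_torus_L2_def)
  show "open S = (\<forall>\<xi>\<in>S. \<forall>\<^sub>F (\<xi>', \<eta>) in uniformity. \<xi>' = \<xi> \<longrightarrow> \<eta> \<in> S)" for S :: "'a torus_L2 set"
    by (rule open_torus_L2_def)
  have sq: "torus_sq_integrable f \<Longrightarrow> Re (LINT x|torus_measure. f x * cnj (f x)) =
      (LINT x|torus_measure. (cmod (f x))\<^sup>2)" for f :: "real ^ 'a \<Rightarrow> complex"
    using integral_Re[OF torus_integrable_product[of f f]]
    by (simp add: complex_mult_cnj cmod_power2)
  show "inner \<xi> \<eta> = inner \<eta> \<xi>"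
  proof transfer
    fix f g :: "real ^ 'a \<Rightarrow> complex"
    show "Re (LINT x|torus_measure. f x * cnj (g x)) = Re (LINT x|torus_measure. g x * cnj (f x))"
      by (subst torus_inner_commute) simp
  qed
  show "inner (\<xi> + \<eta>) \<zeta> = inner \<xi> \<zeta> + inner \<eta> \<zeta>"
    by transfer (auto simp: torus_L2_rel_def ring_distribs torus_integrable_product)
  show "inner (r *\<^sub>R \<xi>) \<eta> = r * inner \<xi> \<eta>"
    by transfer (auto simp: mult.assoc)
  show "0 \<le> inner \<xi> \<xi>"
    by transfer (auto simp: torus_L2_rel_def sq)
  show "inner \<xi> \<xi> = 0 \<longleftrightarrow> \<xi> = 0"
  proof transfer
    fix f :: "real ^ 'a \<Rightarrow> complex"
    assume "torus_L2_rel f f"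
    hence f: "torus_sq_integrable f" by (simp add: torus_L2_rel_def)
    hence "(LINT x|torus_measure. (cmod (f x))\<^sup>2) = 0 \<longleftrightarrow> (AE x in torus_measure. (cmod (f x))\<^sup>2 = 0)"
      by (intro integral_nonneg_eq_0_iff_AE) (auto simp: torus_sq_integrable_def)
    thus "(Re (LINT x|torus_measure. f x * cnj (f x)) = 0) = torus_L2_rel f (\<lambda>_. 0)"
      using f by (simp add: sq torus_L2_rel_def torus_sq_integrable_const)
  qed
  show "norm \<xi> = sqrt (inner \<xi> \<xi>)" by (rule norm_torus_L2_def)
qed

end

instantiation torus_L2 :: (finite) complex_inner
begin

lift_definition scaleC_torus_L2 :: "complex \<Rightarrow> 'a torus_L2 \<Rightarrow> 'a torus_L2" is "\<lambda>c f x. c * f x"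
  by (auto simp: torus_L2_rel_def torus_sq_integrable_cmult)

lift_definition cinner_torus_L2 :: "'a torus_L2 \<Rightarrow> 'a torus_L2 \<Rightarrow> complex" is
  "\<lambda>f g. LINT x|torus_measure. f x * cnj (g x)"
  by (rule torus_inner_cong)

instance
proof
  fix \<xi> \<eta> \<zeta> :: "'a torus_L2" and c d :: complex and r :: real
  show "c *\<^sub>C (\<xi> + \<eta>) = c *\<^sub>C \<xi> + c *\<^sub>C \<eta>"
    by transfer
      (auto simp: torus_L2_rel_def ring_distribs torus_sq_integrable_add torus_sq_integrable_cmult)
  show "(c + d) *\<^sub>C \<xi> = c *\<^sub>C \<xi> + d *\<^sub>C \<xi>"
    by transfer
      (auto simp: torus_L2_rel_def ring_distribs torus_sq_integrable_add torus_sq_integrable_cmult)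
  show "c *\<^sub>C d *\<^sub>C \<xi> = (c * d) *\<^sub>C \<xi>"
    by transfer (auto simp: torus_L2_rel_def mult.assoc torus_sq_integrable_cmult)
  show "r *\<^sub>R \<xi> = complex_of_real r *\<^sub>C \<xi>"
    by transfer (auto simp: torus_L2_rel_def torus_sq_integrable_cmult)
  show "cinner \<xi> \<eta> = cnj (cinner \<eta> \<xi>)"
    by transfer (rule torus_inner_commute)
  show "cinner (\<xi> + \<eta>) \<zeta> = cinner \<xi> \<zeta> + cinner \<eta> \<zeta>"
    by transfer (auto simp: torus_L2_rel_def ring_distribs torus_integrable_product)
  show "cinner (c *\<^sub>C \<xi>) \<eta> = c * cinner \<xi> \<eta>"
    by transfer (auto simp: mult.assoc)
  show "inner \<xi> \<eta> = Re (cinner \<xi> \<eta>)"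
    by transfer simp
qed

end

lemma torus_L2_cases:
  obtains f where "torus_sq_integrable f" "\<xi> = abs_torus_L2 f"
  using that[of "rep_torus_L2 \<xi>"] Quotient3_abs_rep[OF Quotient3_torus_L2, of \<xi>]
    Quotient3_rep_reflp[OF Quotient3_torus_L2, of \<xi>] by (simp add: torus_L2_rel_def)

lemma norm_abs_torus_L2:
  assumes "torus_sq_integrable f"
  shows "(norm (abs_torus_L2 f))\<^sup>2 = (LINT x|torus_measure. (cmod (f x))\<^sup>2)"
proof -
  have "(norm (abs_torus_L2 f))\<^sup>2 = abs_torus_L2 f \<bullet> abs_torus_L2 f"
    by (rule power2_norm_eq_inner)
  also have "\<dots> = Re (LINT x|torus_measure. f x * cnj (f x))"
    using assms by (intro inner_torus_L2.abs_eq) (auto simp: torus_L2_rel_def)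
  also have "\<dots> = (LINT x|torus_measure. (cmod (f x))\<^sup>2)"
    using integral_Re[OF torus_integrable_product[of f f]] assms
    by (simp add: complex_mult_cnj cmod_power2)
  finally show ?thesis .
qed

lemma diff_abs_torus_L2:
  assumes "torus_sq_integrable f" "torus_sq_integrable g"
  shows "abs_torus_L2 f - abs_torus_L2 g = abs_torus_L2 (\<lambda>x. f x - g x)"
proof -
  have g: "torus_sq_integrable (\<lambda>x. - g x)"
    using torus_sq_integrable_cmult[OF assms(2), of "-1"] by simp
  have "abs_torus_L2 f - abs_torus_L2 g = abs_torus_L2 f + abs_torus_L2 (\<lambda>x. - g x)"
    unfolding minus_torus_L2_def
    using assms by (subst uminus_torus_L2.abs_eq) (auto simp: torus_L2_rel_def)
  also have "\<dots> = abs_torus_L2 (\<lambda>x. f x - g x)"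
    using assms g by (subst plus_torus_L2.abs_eq) (auto simp: torus_L2_rel_def)
  finally show ?thesis .
qed

lemma torus_sq_integrable_diff:
  assumes "torus_sq_integrable f" "torus_sq_integrable g"
  shows "torus_sq_integrable (\<lambda>x. f x - g x)"
  using torus_sq_integrable_add[OF assms(1) torus_sq_integrable_cmult[OF assms(2), of "-1"]] by simp

instance torus_L2 :: (finite) complex_hilbert
proof
  fix X :: "nat \<Rightarrow> 'a torus_L2"
  assume X: "Cauchy X"
  have "\<forall>n. \<exists>N. \<forall>i\<ge>N. \<forall>j\<ge>N. dist (X i) (X j) < (1/2)^n"
    using X by (auto simp: Cauchy_def)
  then obtain N where N: "\<And>n i j. i \<ge> N n \<Longrightarrow> j \<ge> N n \<Longrightarrow> dist (X i) (X j) < (1/2)^n"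
    by metis
  define R where "R n = (\<Sum>k\<le>n. N k)" for n
  have RN: "N n \<le> R n" for n unfolding R_def by (rule member_le_sum) auto
  have Rmono: "R m \<le> R n" if "m \<le> n" for m n
    unfolding R_def using that by (intro sum_mono2) auto
  have close: "dist (X (R n)) (X i) < (1/2)^n" if "i \<ge> R n" for i n
    using N[of n "R n" i] RN[of n] that by auto
  have "\<forall>n. \<exists>f. torus_sq_integrable f \<and> X (R n) = abs_torus_L2 f"
    by (metis torus_L2_cases)
  then obtain f where f: "\<And>n. torus_sq_integrable (f n)" and Xf: "\<And>n. X (R n) = abs_torus_L2 (f n)"
    by metis
  have meas [measurable]: "f n \<in> borel_measurable borel" for n
    using f[of n] by (simp add: torus_sq_integrable_def)
  have L2: "(\<integral>\<^sup>+x. ennreal ((cmod (f m x - f n x))\<^sup>2) \<partial>torus_measure) \<le> ennreal ((1/4)^m)"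
    if "m \<le> n" for m n
  proof -
    have *: "torus_sq_integrable (\<lambda>x. f m x - f n x)"
      by (intro torus_sq_integrable_diff f)
    have "(LINT x|torus_measure. (cmod (f m x - f n x))\<^sup>2) = (dist (X (R m)) (X (R n)))\<^sup>2"
      by (simp add: dist_norm Xf diff_abs_torus_L2 f norm_abs_torus_L2[OF *])
    also have "\<dots> \<le> ((1/2)^m)\<^sup>2"
      using close[OF Rmono[OF that]] by (intro power_mono) (auto intro: less_imp_le)
    also have "\<dots> = (1/4)^m"
      by (simp add: power_mult[symmetric] mult.commute power2_eq_square flip: power_mult_distrib)
    finally have "ennreal (LINT x|torus_measure. (cmod (f m x - f n x))\<^sup>2) \<le> ennreal ((1/4)^m)"
      by (rule ennreal_leI)
    moreover have "(\<integral>\<^sup>+x. ennreal ((cmod (f m x - f n x))\<^sup>2) \<partial>torus_measure)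
        = ennreal (LINT x|torus_measure. (cmod (f m x - f n x))\<^sup>2)"
      using * by (intro nn_integral_eq_integral) (auto simp: torus_sq_integrable_def)
    ultimately show ?thesis by simp
  qed
  have tot: "emeasure (torus_measure :: (real ^ 'a) measure) (space torus_measure) = 1"
    using emeasure_torus_cube[where 'n = 'a] unfolding torus_measure_def
    by (subst emeasure_uniform_measure) (auto simp: less_top[symmetric] intro!: ennreal_divide_self)
  have L1: "(\<integral>\<^sup>+x. ennreal (cmod (f n x - f (Suc n) x)) \<partial>torus_measure) \<le> ennreal (2 * (1/2)^n)" for n
  proof -
    have b: "t \<le> 2^n * t\<^sup>2 + (1/2)^n" if "0 \<le> t" for t :: real
    proof -
      have "0 \<le> (2^n * t - 1)\<^sup>2 + 2^n * t" using that by simp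
      hence "2^n * t \<le> 2^n * (2^n * t\<^sup>2 + (1/2)^n)"
        by (simp add: power2_eq_square algebra_simps power_divide)
      thus ?thesis by (simp only: mult_le_cancel_left_pos zero_less_power zero_less_numeral)
    qed
    have "(\<integral>\<^sup>+x. ennreal (cmod (f n x - f (Suc n) x)) \<partial>torus_measure)
       \<le> (\<integral>\<^sup>+x. ennreal (2^n) * ennreal ((cmod (f n x - f (Suc n) x))\<^sup>2) + ennreal ((1/2)^n) \<partial>torus_measure)"
      by (intro nn_integral_mono)
         (use b in \<open>auto simp flip: ennreal_mult ennreal_plus intro!: ennreal_leI\<close>)
    also have "\<dots> = ennreal (2^n) * (\<integral>\<^sup>+x. ennreal ((cmod (f n x - f (Suc n) x))\<^sup>2) \<partial>torus_measure)
        + ennreal ((1/2)^n)"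
      by (subst nn_integral_add) (auto simp: nn_integral_cmult tot)
    also have "\<dots> \<le> ennreal (2^n) * ennreal ((1/4)^n) + ennreal ((1/2)^n)"
      by (intro add_mono mult_left_mono L2) auto
    also have "\<dots> = ennreal (2^n * (1/4)^n + (1/2)^n)"
      by (simp flip: ennreal_mult ennreal_plus)
    also have "2^n * (1/4)^n = ((1/2)^n :: real)"
      by (simp flip: power_mult_distrib)
    finally show ?thesis by simp
  qed
  have "(\<integral>\<^sup>+x. (\<Sum>n. ennreal (cmod (f n x - f (Suc n) x))) \<partial>torus_measure)
      = (\<Sum>n. \<integral>\<^sup>+x. ennreal (cmod (f n x - f (Suc n) x)) \<partial>torus_measure)"
    by (rule nn_integral_suminf) measurable
  also have "\<dots> \<le> (\<Sum>n. ennreal (2 * (1/2)^n))"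
    by (intro suminf_le L1) auto
  also have "\<dots> = ennreal (\<Sum>n. 2 * (1/2)^n)"
    by (intro suminf_ennreal2 summable_mult summable_geometric) auto
  also have "\<dots> < \<infinity>" by simp
  finally have "(\<integral>\<^sup>+x. (\<Sum>n. ennreal (cmod (f n x - f (Suc n) x))) \<partial>torus_measure) \<noteq> \<infinity>" by simp
  hence "AE x in torus_measure. (\<Sum>n. ennreal (cmod (f n x - f (Suc n) x))) \<noteq> \<infinity>"
    by (intro nn_integral_PInf_AE) auto
  hence AE: "AE x in torus_measure. (\<lambda>n. f n x) \<longlonglongrightarrow> lim (\<lambda>n. f n x)"
  proof eventually_elim
    case (elim x)
    hence "summable (\<lambda>n. cmod (f n x - f (Suc n) x))"
      by (intro summable_suminf_not_top) auto
    hence "summable (\<lambda>n. f n x - f (Suc n) x)" by (rule summable_norm_cancel)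
    hence "summable (\<lambda>n. f (Suc n) x - f n x)"
      using summable_minus[of "\<lambda>n. f n x - f (Suc n) x"] by simp
    hence "convergent (\<lambda>n. \<Sum>k<n. f (Suc k) x - f k x)"
      by (simp add: summable_iff_convergent)
    hence "convergent (\<lambda>n. f n x - f 0 x)" by (simp only: sum_lessThan_telescope[of "\<lambda>n. f n x"])
    hence "convergent (\<lambda>n. f n x)" by (simp add: convergent_diff_const_right_iff)
    thus ?case by (simp add: convergent_LIMSEQ_iff)
  qed
  define F where "F x = lim (\<lambda>n. f n x)" for x
  have [measurable]: "F \<in> borel_measurable borel"
    unfolding F_def by (rule borel_measurable_lim_metric) measurable
  have perF: "torus_periodic F"
    using f by (simp add: torus_sq_integrable_def torus_periodic_def F_def)
  have Fat: "(\<integral>\<^sup>+x. ennreal ((cmod (f m x - F x))\<^sup>2) \<partial>torus_measure) \<le> ennreal ((1/4)^m)" for m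
  proof -
    have "(\<integral>\<^sup>+x. ennreal ((cmod (f m x - F x))\<^sup>2) \<partial>torus_measure)
       = (\<integral>\<^sup>+x. liminf (\<lambda>n. ennreal ((cmod (f m x - f n x))\<^sup>2)) \<partial>torus_measure)"
    proof (rule nn_integral_cong_AE)
      show "AE x in torus_measure. ennreal ((cmod (f m x - F x))\<^sup>2)
          = liminf (\<lambda>n. ennreal ((cmod (f m x - f n x))\<^sup>2))"
        using AE
      proof eventually_elim
        case (elim x)
        hence "(\<lambda>n. f n x) \<longlonglongrightarrow> F x" by (simp add: F_def)
        hence "(\<lambda>n. ennreal ((cmod (f m x - f n x))\<^sup>2)) \<longlonglongrightarrow> ennreal ((cmod (f m x - F x))\<^sup>2)"
          by (intro tendsto_intros tendsto_ennrealI)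
        thus ?case by (intro lim_imp_Liminf[symmetric]) auto
      qed
    qed
    also have "\<dots> \<le> liminf (\<lambda>n. \<integral>\<^sup>+x. ennreal ((cmod (f m x - f n x))\<^sup>2) \<partial>torus_measure)"
      by (rule nn_integral_liminf) measurable
    also have "\<dots> \<le> liminf (\<lambda>n :: nat. ennreal ((1/4)^m))"
      by (rule Liminf_mono) (use L2 in \<open>auto simp: eventually_sequentially intro!: exI[of _ m]\<close>)
    also have "\<dots> = ennreal ((1/4)^m)" by (simp add: Liminf_const)
    finally show ?thesis .
  qed
  have dF: "torus_sq_integrable (\<lambda>x. f m x - F x)" for m
  proof -
    have "integrable torus_measure (\<lambda>x. (cmod (f m x - F x))\<^sup>2)"
      using le_less_trans[OF Fat[of m], of top] by (auto simp: integrable_iff_bounded)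
    moreover have "torus_periodic (\<lambda>x. f m x - F x)"
      using f[of m] perF by (simp add: torus_sq_integrable_def torus_periodic_def)
    ultimately show ?thesis by (simp add: torus_sq_integrable_def)
  qed
  have F: "torus_sq_integrable F"
    using torus_sq_integrable_diff[OF f[of 0] dF[of 0]] by simp
  have conv: "dist (X (R m)) (abs_torus_L2 F) \<le> (1/2)^m" for m
  proof -
    have "ennreal (LINT x|torus_measure. (cmod (f m x - F x))\<^sup>2) \<le> ennreal ((1/4)^m)"
      using Fat[of m] dF[of m]
      by (subst nn_integral_eq_integral[symmetric]) (auto simp: torus_sq_integrable_def)
    hence "(LINT x|torus_measure. (cmod (f m x - F x))\<^sup>2) \<le> (1/4)^m"
      by (subst (asm) ennreal_le_iff) auto
    hence "(dist (X (R m)) (abs_torus_L2 F))\<^sup>2 \<le> (1/4)^m"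
      by (simp add: dist_norm Xf diff_abs_torus_L2 f F norm_abs_torus_L2[OF dF])
    also have "(1/4 :: real)^m = ((1/2)^m)\<^sup>2"
      by (simp add: power_mult[symmetric] mult.commute power2_eq_square flip: power_mult_distrib)
    finally show ?thesis by (rule power2_le_imp_le) simp
  qed
  have "X \<longlonglongrightarrow> abs_torus_L2 F"
  proof (rule metric_LIMSEQ_I)
    fix e :: real assume "0 < e"
    then obtain n where n: "(1/2)^n < e / 2"
      using real_arch_pow_inv[of "e / 2" "1 / 2"] by auto
    have "dist (X i) (abs_torus_L2 F) < e" if "i \<ge> R n" for i
      using close[OF that] conv[of n] n dist_triangle[of "X i" "abs_torus_L2 F" "X (R n)"]
      by (simp add: dist_commute)
    thus "\<exists>no. \<forall>i\<ge>no. dist (X i) (abs_torus_L2 F) < e" by blast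
  qed
  thus "convergent X" by (auto simp: convergent_def)
qed

lift_definition torus_one :: "'n::finite torus_L2" is "\<lambda>_. 1"
  using torus_sq_integrable_const by (auto simp: torus_L2_rel_def)


section \<open>The noncommutative torus\<close>

type_synonym 'n square_matrix = "real ^ 'n ^ 'n"

type_synonym 'n torus_operator = "'n torus_L2 \<Rightarrow> 'n torus_L2"

lift_definition nc_U :: "'n square_matrix \<Rightarrow> 'n \<Rightarrow> 'n::finite torus_operator" is
  "\<lambda>\<theta> j \<xi> x. cis (x $ j) * \<xi> (x + pi *\<^sub>R column j \<theta>)"
proof -
  fix \<theta> :: "real ^ 'n ^ 'n" and j and f g :: "real ^ 'n \<Rightarrow> complex"
  assume fg: "torus_L2_rel f g"
  have [measurable]: "f \<in> borel_measurable borel" "g \<in> borel_measurable borel"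
    using fg by (auto simp: torus_L2_rel_def torus_sq_integrable_def)
  have "AE x in torus_measure. f (x + pi *\<^sub>R column j \<theta>) = g (x + pi *\<^sub>R column j \<theta>)"
    by (rule AE_torus_shift[where P = "\<lambda>x. f x = g x"])
       (use fg in \<open>auto simp: torus_L2_rel_def torus_sq_integrable_def torus_periodic_def\<close>)
  thus "torus_L2_rel (\<lambda>x. cis (x $ j) * f (x + pi *\<^sub>R column j \<theta>))
      (\<lambda>x. cis (x $ j) * g (x + pi *\<^sub>R column j \<theta>))"
    using fg by (auto simp: torus_L2_rel_def torus_sq_integrable_shift_mult)
qed

definition op_zpower :: "('a \<Rightarrow> 'a) \<Rightarrow> int \<Rightarrow> ('a \<Rightarrow> 'a)" where
  "op_zpower T m = (if 0 \<le> m then T ^^ nat m else inv T ^^ nat (- m))"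

text \<open>\<open>U\<^sup>k = U\<^sub>1\<^bsup>k\<^sub>1\<^esup> \<cdots> U\<^sub>n\<^bsup>k\<^sub>n\<^esup>\<close>, the factors taken in increasing order of the index.\<close>

definition nc_Upow :: "'n square_matrix \<Rightarrow> (int, 'n) vec \<Rightarrow>
    'n::{finite, linorder} torus_operator" where
  "nc_Upow \<theta> k =
     foldr (\<lambda>j T. op_zpower (nc_U \<theta> j) (k $ j) \<circ> T) (sorted_list_of_set UNIV) id"

definition commutant :: "('a::complex_inner \<Rightarrow> 'a) set \<Rightarrow> ('a \<Rightarrow> 'a) set" where
  "commutant S = {T. bounded_clinear T \<and> (\<forall>A\<in>S. T \<circ> A = A \<circ> T)}"

text \<open>A von Neumann algebra is a self-adjoint set of bounded operators equal to its bicommutant.\<close>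

definition von_neumann_algebra :: "('a::complex_inner \<Rightarrow> 'a) set \<Rightarrow> bool" where
  "von_neumann_algebra M \<longleftrightarrow> (\<forall>T\<in>M. bounded_clinear T \<and> cadjoint T \<in> M) \<and>
     commutant (commutant M) = M"

definition nc_Linf :: "'n square_matrix \<Rightarrow> 'n::finite torus_operator set" where
  "nc_Linf \<theta> = \<Inter>{M. von_neumann_algebra M \<and> range (nc_U \<theta>) \<subseteq> M}"

definition nc_trace :: "'n::finite torus_operator \<Rightarrow> complex" where
  "nc_trace T = cinner (T torus_one) torus_one"

text \<open>The noncommutative \<open>L\<^sub>2\<close>-space is the Hilbert space completion of \<open>nc_Linf \<theta>\<close> for the inner
  product \<open>\<tau>(uv\<^sup>*)\<close>. The completion depends on the term \<open>\<theta>\<close>, so it is not introduced as a type: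
  instead \<open>nc_L2_completion \<theta> \<iota>\<close> says that the Hilbert space \<open>'h\<close>, with the embedding \<open>\<iota>\<close> of
  \<open>nc_Linf \<theta>\<close>, is such a completion. This determines \<open>('h, \<iota>)\<close> up to a unique unitary. The values
  of \<open>\<iota>\<close> outside \<open>nc_Linf \<theta>\<close> are irrelevant.\<close>

definition nc_L2_completion :: "'n square_matrix \<Rightarrow>
    ('n::finite torus_operator \<Rightarrow> 'h::complex_hilbert) \<Rightarrow> bool" where
  "nc_L2_completion \<theta> \<iota> \<longleftrightarrow>
     (\<forall>u\<in>nc_Linf \<theta>. \<forall>v\<in>nc_Linf \<theta>. \<iota> (\<lambda>\<xi>. u \<xi> + v \<xi>) = \<iota> u + \<iota> v) \<and>
     (\<forall>c. \<forall>u\<in>nc_Linf \<theta>. \<iota> (\<lambda>\<xi>. c *\<^sub>C u \<xi>) = c *\<^sub>C \<iota> u) \<and>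
     (\<forall>u\<in>nc_Linf \<theta>. \<forall>v\<in>nc_Linf \<theta>. cinner (\<iota> u) (\<iota> v) = nc_trace (u \<circ> cadjoint v)) \<and>
     closure (\<iota> ` nc_Linf \<theta>) = UNIV"

text \<open>The product \<open>xu\<close> of \<open>x \<in> L\<^sub>2\<close> and \<open>u \<in> L\<^sub>\<infinity>\<close>: the continuous extension to \<open>L\<^sub>2\<close> of
  \<open>a \<mapsto> au\<close> on \<open>L\<^sub>\<infinity>\<close>.\<close>

definition nc_prod :: "'n square_matrix \<Rightarrow> ('n::finite torus_operator \<Rightarrow> 'h::complex_hilbert) \<Rightarrow>
    'h \<Rightarrow> 'n torus_operator \<Rightarrow> 'h" where
  "nc_prod \<theta> \<iota> x u =
     (THE R. bounded_clinear R \<and> (\<forall>a\<in>nc_Linf \<theta>. R (\<iota> a) = \<iota> (a \<circ> u))) x"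

text \<open>Left multiplication \<open>\<lambda>(x)\<close> as an unbounded operator: a partial function with domain the
  subspace \<open>L\<^sub>\<infinity>\<close> of \<open>L\<^sub>2\<close>.\<close>

definition nc_lmult :: "'n square_matrix \<Rightarrow> ('n::finite torus_operator \<Rightarrow> 'h::complex_hilbert) \<Rightarrow>
    'h \<Rightarrow> ('h \<rightharpoonup> 'h)" where
  "nc_lmult \<theta> \<iota> x v =
     (if v \<in> \<iota> ` nc_Linf \<theta> then Some (nc_prod \<theta> \<iota> x (inv_into (nc_Linf \<theta>) \<iota> v)) else None)"

definition nc_fourier_mult :: "'n square_matrix \<Rightarrow>
    ('n::{finite, linorder} torus_operator \<Rightarrow> 'h::complex_hilbert) \<Rightarrow>
    ((int, 'n) vec \<Rightarrow> complex) \<Rightarrow> 'h \<Rightarrow> 'h" where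
  "nc_fourier_mult \<theta> \<iota> g =
     (THE G. bounded_clinear G \<and> (\<forall>k. G (\<iota> (nc_Upow \<theta> k)) = g k *\<^sub>C \<iota> (nc_Upow \<theta> k)))"

text \<open>The operator \<open>\<lambda>(x)g(-i\<nabla>)\<close>. Its natural domain is \<open>{v. g(-i\<nabla>)v \<in> dom \<lambda>(x)}\<close>; values at
  other arguments are irrelevant.\<close>

definition nc_cwikel :: "'n square_matrix \<Rightarrow>
    ('n::{finite, linorder} torus_operator \<Rightarrow> 'h::complex_hilbert) \<Rightarrow>
    'h \<Rightarrow> ((int, 'n) vec \<Rightarrow> complex) \<Rightarrow> 'h \<Rightarrow> 'h" where
  "nc_cwikel \<theta> \<iota> x g v = the (nc_lmult \<theta> \<iota> x (nc_fourier_mult \<theta> \<iota> g v))"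

definition nc_cwikel_total :: "'n square_matrix \<Rightarrow>
    ('n::{finite, linorder} torus_operator \<Rightarrow> 'h::complex_hilbert) \<Rightarrow>
    'h \<Rightarrow> ((int, 'n) vec \<Rightarrow> complex) \<Rightarrow> bool" where
  "nc_cwikel_total \<theta> \<iota> x g \<longleftrightarrow> range (nc_fourier_mult \<theta> \<iota> g) \<subseteq> dom (nc_lmult \<theta> \<iota> x)"

end

theory Submission
  imports Defs
begin

text \<open>
  Write \<open>e\<^sub>k = \<iota> (U\<^sup>k)\<close> for the Fourier basis of the noncommutative \<open>L\<^sub>2\<close>. For \<open>g\<close> in \<open>\<ell>\<^sub>2\<close> the operator
  \<open>T = \<lambda>(x)g(-i\<nabla>)\<close> sends \<open>e\<^sub>k\<close> to \<open>g(k) x U\<^sup>k\<close>, and right multiplication by the unitary \<open>U\<^sup>k\<close> preserves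
  the \<open>L\<^sub>2\<close>-norm, so \<open>\<parallel>T e\<^sub>k\<parallel> = |g(k)| \<parallel>x\<parallel>\<close> (\<open>nc_cwikel_eq\<close>, \<open>norm_nc_cwikel_basis\<close>). In particular \<open>T\<close> is a
  Hilbert--Schmidt operator, and the theorem becomes a statement about such operators: their
  singular values are controlled by the norms of the images of one orthonormal basis.

  Let \<open>\<phi>\<^sub>j\<close> be orthonormal eigenvectors of \<open>T\<^sup>*T\<close> for the eigenvalues \<open>\<mu>\<^sub>j\<^sup>2 > 0\<close>, and put
  \<open>w\<^sub>j\<^sub>k = |\<langle>e\<^sub>k, \<phi>\<^sub>j\<rangle>|\<^sup>2\<close>. Then \<open>\<Sum>\<^sub>k w\<^sub>j\<^sub>k = 1\<close>, \<open>\<Sum>\<^sub>j w\<^sub>j\<^sub>k \<le> 1\<close> and \<open>\<Sum>\<^sub>j \<mu>\<^sub>j\<^sup>2 w\<^sub>j\<^sub>k \<le> \<parallel>T e\<^sub>k\<parallel>\<^sup>2\<close>. For an increasing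
  concave function \<open>f\<close> with \<open>f 0 = 0\<close> Jensen's inequality gives \<open>\<Sum>\<^sub>j f (\<mu>\<^sub>j\<^sup>2) w\<^sub>j\<^sub>k \<le> f (\<parallel>T e\<^sub>k\<parallel>\<^sup>2)\<close>, and summation
  over \<open>k\<close> gives \<open>\<Sum>\<^sub>j f (\<mu>\<^sub>j\<^sup>2) \<le> \<Sum>\<^sub>k f (\<parallel>T e\<^sub>k\<parallel>\<^sup>2)\<close>. The choice \<open>f t = t powr (p / 2)\<close> is the Schatten
  estimate (\<open>sum_singular_values_powr_le\<close>). The choice \<open>f t = min t m\<close> with \<open>m = \<mu>\<^sub>N\<^sup>2\<close> gives
  \<open>(N + 1) m \<le> \<Sum>\<^sub>k min (\<parallel>T e\<^sub>k\<parallel>\<^sup>2) m\<close>; if the distribution function of \<open>k \<mapsto> \<parallel>T e\<^sub>k\<parallel>\<close> at \<open>s\<close> is at most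
  \<open>D s powr (-p)\<close>, the right-hand side is at most \<open>D m powr (1 - p / 2) / (1 - p / 2)\<close> by the
  layer-cake formula, whence \<open>(N + 1) \<mu>\<^sub>N powr p \<le> 2 / (2 - p) * D\<close>
  (\<open>singular_value_le_of_distribution\<close>). This is the weak estimate with the stated constant.

  Singular values are defined by multiplicities of eigenvalues, so only upper bounds for these
  multiplicities matter for their existence; the inequality \<open>\<Sum>\<^sub>j \<mu>\<^sub>j\<^sup>2 \<le> \<Sum>\<^sub>k \<parallel>T e\<^sub>k\<parallel>\<^sup>2\<close> for finite
  families of eigenvectors provides them, and eigenvectors \<open>\<phi>\<^sub>j\<close> are then obtained by matching
  multiplicities (\<open>enumerates_singular_value\<close>, \<open>singular_vectors_exist\<close>).

  The structure of the noncommutative torus enters through the identity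
  \<open>\<langle>\<iota> u, \<iota> v\<rangle> = \<langle>v\<^sup>* 1, u\<^sup>* 1\<rangle>\<close>. The orthogonal projection onto the closed span of the characters and the
  operators \<open>V\<^sub>k\<close>, obtained from \<open>U\<^sup>k\<close> by reversing the translation, commute with all \<open>U\<^sub>j\<close> and
  therefore with the algebra they generate. The first fact shows that the \<open>e\<^sub>k\<close> span a dense subspace
  (\<open>orthonormal_basis_fourier_basis\<close>), the second that right multiplication by \<open>u\<close> is determined by
  \<open>\<iota> u\<close> (\<open>\<iota>_compose_cong\<close>).
\<close>

section \<open>Complex Hilbert spaces\<close>

instance complex_hilbert \<subseteq> banach ..

interpretation complex_vs: vector_space "scaleC :: complex \<Rightarrow> 'a \<Rightarrow> 'a::complex_inner"
  by (rule vector_space_scaleC)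

lemma cinner_add_right: "cinner x (y + z) = cinner x y + cinner x (z :: 'a::complex_inner)"
  by (subst (1 2 3) cinner_commute) (simp add: cinner_add_left)

lemma cinner_scaleC_right: "cinner x (c *\<^sub>C y) = cnj c * cinner x (y :: 'a::complex_inner)"
  by (subst (1 2) cinner_commute) (simp add: cinner_scaleC_left)

lemma cinner_zero_left [simp]: "cinner 0 (x :: 'a::complex_inner) = 0"
  using cinner_scaleC_left[of 0 0 x] by simp

lemma cinner_zero_right [simp]: "cinner (x :: 'a::complex_inner) 0 = 0"
  using cinner_scaleC_right[of x 0 0] by simp

lemma cinner_minus_left: "cinner (- x) y = - cinner x (y :: 'a::complex_inner)"
  using cinner_add_left[of x "- x" y] by (simp add: eq_neg_iff_add_eq_0 add.commute)

lemma cinner_minus_right: "cinner x (- y) = - cinner x (y :: 'a::complex_inner)"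
  using cinner_add_right[of x y "- y"] by (simp add: eq_neg_iff_add_eq_0 add.commute)

lemma cinner_diff_left: "cinner (x - y) z = cinner x z - cinner y (z :: 'a::complex_inner)"
  using cinner_add_left[of x "- y" z] by (simp add: cinner_minus_left)

lemma cinner_diff_right: "cinner x (y - z) = cinner x y - cinner x (z :: 'a::complex_inner)"
  using cinner_add_right[of x y "- z"] by (simp add: cinner_minus_right)

lemma cinner_sum_left: "cinner (\<Sum>i\<in>I. f i) y = (\<Sum>i\<in>I. cinner (f i) (y :: 'a::complex_inner))"
  by (induction I rule: infinite_finite_induct) (auto simp: cinner_add_left)

lemma cinner_sum_right: "cinner y (\<Sum>i\<in>I. f i) = (\<Sum>i\<in>I. cinner (y :: 'a::complex_inner) (f i))"
  by (induction I rule: infinite_finite_induct) (auto simp: cinner_add_right)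

lemma cinner_self: "cinner x (x :: 'a::complex_inner) = of_real ((norm x)\<^sup>2)"
proof -
  have "Im (cinner x x) = 0"
    using arg_cong[OF cinner_commute[of x x], of Im] by simp
  thus ?thesis
    by (simp add: complex_eq_iff power2_norm_eq_inner inner_eq_Re_cinner)
qed

lemma cinner_eq_0_iff [simp]: "cinner x x = 0 \<longleftrightarrow> x = (0 :: 'a::complex_inner)"
  by (simp add: cinner_self)

lemma norm_scaleC: "norm (c *\<^sub>C x) = cmod c * norm (x :: 'a::complex_inner)"
proof -
  have "complex_of_real ((norm (c *\<^sub>C x))\<^sup>2) = c * cnj c * of_real ((norm x)\<^sup>2)"
    unfolding cinner_self[symmetric] by (simp add: cinner_scaleC_left cinner_scaleC_right)
  also have "\<dots> = of_real ((cmod c * norm x)\<^sup>2)"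
    by (simp add: power_mult_distrib flip: complex_norm_square)
  finally have "(norm (c *\<^sub>C x))\<^sup>2 = (cmod c * norm x)\<^sup>2"
    by (simp only: of_real_eq_iff)
  thus ?thesis by (simp add: power2_eq_iff_nonneg)
qed

lemma cmod_cinner_le: "cmod (cinner x y) \<le> norm x * norm (y :: 'a::complex_inner)"
proof -
  \<comment> \<open>The phase that makes the inner product real, so that the real inequality applies.\<close>
  define c where "c = (if cinner x y = 0 then 1 else of_real (cmod (cinner x y)) / cinner x y)"
  have c: "cmod c = 1" "c * cinner x y = of_real (cmod (cinner x y))"
    by (auto simp: c_def norm_divide)
  have "cmod (cinner x y) = inner (c *\<^sub>C x) y"
    by (simp add: inner_eq_Re_cinner cinner_scaleC_left c)
  also have "\<dots> \<le> norm (c *\<^sub>C x) * norm y" by (rule norm_cauchy_schwarz)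
  finally show ?thesis by (simp add: norm_scaleC c)
qed

lemma bounded_linear_cinner_left: "bounded_linear (\<lambda>x. cinner x (y :: 'a::complex_inner))"
  by (rule bounded_linear_intro[where K = "norm y"])
     (auto simp: cinner_add_left cmod_cinner_le cinner_scaleC_left scaleR_scaleC scaleR_conv_of_real)

lemma bounded_linear_cinner_right: "bounded_linear (\<lambda>y. cinner (x :: 'a::complex_inner) y)"
  by (rule bounded_linear_intro[where K = "norm x"])
     (use cmod_cinner_le[of x] in \<open>auto simp: cinner_add_right mult.commute cinner_scaleC_right scaleR_scaleC scaleR_conv_of_real\<close>)

lemma bounded_linear_scaleC: "bounded_linear (\<lambda>x :: 'a::complex_inner. c *\<^sub>C x)"
  by (rule bounded_linear_intro[where K = "cmod c"])
     (auto simp: scaleC_add_right norm_scaleC scaleR_scaleC scaleC_scaleC mult.commute)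

lemma bounded_linear_scaleC_left: "bounded_linear (\<lambda>c. c *\<^sub>C (x :: 'a::complex_inner))"
  by (rule bounded_linear_intro[where K = "norm x"])
     (auto simp: scaleC_add_left norm_scaleC scaleR_scaleC scaleC_scaleC scaleR_conv_of_real)

lemma cinner_eqI: "(\<And>z. cinner z x = cinner z y) \<Longrightarrow> x = (y :: 'a::complex_inner)"
  using cinner_eq_0_iff[of "x - y"] by (simp add: cinner_diff_right del: cinner_eq_0_iff)

lemma Im_cinner_eq: "Im (cinner x y) = inner x (\<i> *\<^sub>C (y :: 'a::complex_inner))"
  by (simp add: inner_eq_Re_cinner cinner_scaleC_right)

lemma bounded_clinearI:
  assumes "bounded_linear T" "\<And>c v. T (c *\<^sub>C v) = c *\<^sub>C T v"
  shows "bounded_clinear T"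
  using assms by (simp add: bounded_clinear_def)

lemma bounded_clinearD:
  assumes "bounded_clinear T"
  shows "bounded_linear T" "\<And>v w. T (v + w) = T v + T w" "\<And>v w. T (v - w) = T v - T w"
    "\<And>c v. T (c *\<^sub>C v) = c *\<^sub>C T v" "T 0 = 0" "\<And>I f. T (\<Sum>i\<in>I. f i) = (\<Sum>i\<in>I. T (f i))"
  using assms
  by (auto simp: bounded_clinear_def linear_simps bounded_linear.linear linear_sum)

lemma bounded_clinear_compose:
  "bounded_clinear S \<Longrightarrow> bounded_clinear T \<Longrightarrow> bounded_clinear (S \<circ> T)"
  by (auto simp: bounded_clinear_def o_def intro: bounded_linear_compose)

lemma bounded_clinear_id: "bounded_clinear id"
  by (auto simp: bounded_clinear_def id_def)

lemma bounded_clinear_add: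
  "bounded_clinear S \<Longrightarrow> bounded_clinear T \<Longrightarrow> bounded_clinear (\<lambda>v. S v + T v)"
  by (auto simp: bounded_clinear_def scaleC_add_right intro: bounded_linear_add)

lemma bounded_clinear_scaleC:
  assumes "bounded_clinear T"
  shows "bounded_clinear (\<lambda>v. c *\<^sub>C T v)"
  using assms bounded_linear_compose[OF bounded_linear_scaleC, of T c]
  by (auto simp: bounded_clinear_def scaleC_scaleC mult.commute)

text \<open>The minimizer of \<open>\<parallel>v\<parallel>\<^sup>2 - 2 f v\<close> over the closed subspace \<open>K\<close> represents \<open>f\<close> on \<open>K\<close>; by the
  parallelogram law every minimizing sequence is Cauchy. For \<open>K = UNIV\<close> this is the Riesz
  representation theorem, for \<open>f = inner x\<close> it gives the orthogonal projection of \<open>x\<close> to \<open>K\<close>.\<close>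

lemma riesz_on_closed_subspace:
  fixes f :: "'a::{real_inner, complete_space} \<Rightarrow> real"
  assumes f: "bounded_linear f" and K: "closed K" "subspace K"
  obtains w where "w \<in> K" "\<And>v. v \<in> K \<Longrightarrow> f v = inner w v"
proof -
  interpret f: bounded_linear f by fact
  define J where "J v = (norm v)\<^sup>2 - 2 * f v" for v
  obtain B where B: "\<And>v. \<bar>f v\<bar> \<le> norm v * B"
    using f.bounded by auto
  have "- B\<^sup>2 \<le> J v" for v
  proof -
    have "0 \<le> (norm v - B)\<^sup>2" by simp
    thus ?thesis using B[of v] by (simp add: J_def power2_diff)
  qed
  hence bdd: "bdd_below (J ` K)" by (auto intro!: bdd_belowI)
  have ne: "J ` K \<noteq> {}" using subspace_0[OF K(2)] by auto
  define d where "d = Inf (J ` K)"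
  have d_le: "d \<le> J v" if "v \<in> K" for v
    unfolding d_def using bdd that by (auto intro: cInf_lower)
  have "\<exists>v\<in>K. J v < d + 1 / real (Suc n)" for n
    using cInf_lessD[OF ne, of "d + 1 / real (Suc n)"] by (auto simp: d_def)
  then obtain V where V: "\<And>n. V n \<in> K" "\<And>n. J (V n) < d + 1 / real (Suc n)"
    by metis
  have par: "(norm (u - v))\<^sup>2 \<le> 2 * (J u - d) + 2 * (J v - d)" if "u \<in> K" "v \<in> K" for u v
  proof -
    define z where "z = (1/2) *\<^sub>R (u + v)"
    have z: "z \<in> K" unfolding z_def by (intro subspace_scale subspace_add K that)
    have "(norm (u - v))\<^sup>2 = 2 * J u + 2 * J v - 4 * J z"
      unfolding J_def z_def
      by (simp add: f.add f.scaleR power2_norm_eq_inner inner_add inner_diff inner_commute algebra_simps)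
    also have "\<dots> \<le> 2 * (J u - d) + 2 * (J v - d)" using d_le[OF z] by simp
    finally show ?thesis .
  qed
  have "Cauchy V"
  proof (rule metric_CauchyI)
    fix e :: real assume e: "0 < e"
    obtain N where N: "1 / real (Suc N) < e\<^sup>2 / 4"
      using nat_approx_posE[of "e\<^sup>2 / 4"] e by auto
    have "dist (V m) (V n) < e" if "m \<ge> N" "n \<ge> N" for m n
    proof -
      have "1 / real (Suc m) \<le> 1 / real (Suc N)" "1 / real (Suc n) \<le> 1 / real (Suc N)"
        using that by (auto simp: field_simps)
      moreover have "J (V k) - d < 1 / real (Suc k)" for k
        using V(2)[of k] by simp
      ultimately have "J (V m) - d < e\<^sup>2 / 4" "J (V n) - d < e\<^sup>2 / 4"
        using N by (meson less_le_trans less_trans)+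
      hence "(norm (V m - V n))\<^sup>2 < e\<^sup>2"
        using par[OF V(1) V(1), of m n] by argo
      thus ?thesis using e by (simp add: dist_norm power2_less_imp_less)
    qed
    thus "\<exists>M. \<forall>m\<ge>M. \<forall>n\<ge>M. dist (V m) (V n) < e" by blast
  qed
  then obtain w where w: "V \<longlonglongrightarrow> w" by (auto simp: Cauchy_convergent_iff convergent_def)
  have wK: "w \<in> K" using closed_sequentially[OF K(1) _ w] V(1) by blast
  have "(\<lambda>n. J (V n)) \<longlonglongrightarrow> J w"
    unfolding J_def by (intro tendsto_intros w f.tendsto)
  moreover have "(\<lambda>n. d + 1 / real (Suc n)) \<longlonglongrightarrow> d + 0"
    by (intro tendsto_intros) (rule LIMSEQ_Suc[OF lim_1_over_n])
  ultimately have Jw: "J w \<le> d"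
    using V(2) by (intro LIMSEQ_le[of "\<lambda>n. J (V n)" _ "\<lambda>n. d + 1 / real (Suc n)"]) (auto intro: less_imp_le)
  have "f v = inner w v" if v: "v \<in> K" for v
  proof -
    define a where "a = inner w v - f v"
    have q: "0 \<le> t\<^sup>2 * (norm v)\<^sup>2 + 2 * t * a" for t
    proof -
      have "w + t *\<^sub>R v \<in> K" by (intro subspace_scale subspace_add K v wK)
      from d_le[OF this] Jw have "J w \<le> J (w + t *\<^sub>R v)" by simp
      moreover have "J (w + t *\<^sub>R v) = J w + (t\<^sup>2 * (norm v)\<^sup>2 + 2 * t * a)"
        unfolding J_def a_def power2_norm_eq_inner
        by (simp add: f.add f.scaleR inner_add inner_commute power2_eq_square algebra_simps)
      ultimately show ?thesis by simp
    qed
    \<comment> \<open>The quadratic \<open>q\<close> is negative at \<open>t = - a / c\<close> unless \<open>a = 0\<close>.\<close>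
    define c where "c = (norm v)\<^sup>2 + 1"
    have c: "c > 0" "(norm v)\<^sup>2 < 2 * c"
      by (auto simp: c_def add_nonneg_pos intro: order.strict_trans2[of _ "2 * (norm v)\<^sup>2 + 2"])
    have "0 \<le> (a\<^sup>2 / c\<^sup>2) * ((norm v)\<^sup>2 - 2 * c)"
      using q[of "- a / c"] c by (simp add: field_simps power2_eq_square)
    hence "a\<^sup>2 / c\<^sup>2 \<le> 0"
      using c(2) mult_pos_neg[of "a\<^sup>2 / c\<^sup>2" "(norm v)\<^sup>2 - 2 * c"] by linarith
    hence "a = 0" using c by (simp add: divide_le_0_iff)
    thus ?thesis by (simp add: a_def)
  qed
  with wK that show ?thesis by blast
qed

lemma cadjoint_eqI:
  assumes "\<And>v w. cinner (T v) w = cinner v (S w)"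
  shows "cadjoint T = S"
  unfolding cadjoint_def
proof (rule the_equality)
  fix S' assume S': "\<forall>v w. cinner (T v) w = cinner v (S' w)"
  show "S' = S"
  proof (intro ext cinner_eqI)
    fix v w
    show "cinner v (S' w) = cinner v (S w)"
      using S'[rule_format, of v w] assms[of v w] by (rule subst)
  qed
qed (use assms in auto)

lemma cinner_cadjoint:
  fixes T :: "'a::complex_hilbert \<Rightarrow> 'a"
  assumes T: "bounded_clinear T"
  shows "cinner (T v) w = cinner v (cadjoint T w)"
proof -
  have "\<exists>s. \<forall>v. inner (T v) w = inner v s" for w
  proof -
    have "bounded_linear (\<lambda>v. inner (T v) w)"
      by (rule bounded_linear_compose[OF bounded_linear_inner_left bounded_clinearD(1)[OF T]])
    then obtain s where s: "\<And>v. v \<in> UNIV \<Longrightarrow> inner (T v) w = inner s v"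
      by (rule riesz_on_closed_subspace[OF _ closed_UNIV subspace_UNIV]) iprover
    have "inner (T v) w = inner v s" for v
      unfolding s[OF UNIV_I] by (rule inner_commute)
    thus ?thesis by iprover
  qed
  then obtain S where S: "\<And>v w. inner (T v) w = inner v (S w)" by metis
  have *: "cinner (T v) w = cinner v (S w)" for v w
  proof (rule complex_eqI)
    show "Re (cinner (T v) w) = Re (cinner v (S w))"
      using S by (simp add: inner_eq_Re_cinner)
    have "Im (cinner x y) = - inner (\<i> *\<^sub>C x) y" for x y :: 'a
      by (simp add: inner_eq_Re_cinner cinner_scaleC_left)
    thus "Im (cinner (T v) w) = Im (cinner v (S w))"
      using S[of "\<i> *\<^sub>C v" w] by (simp add: bounded_clinearD[OF T])
  qed
  have "cadjoint T = S" by (rule cadjoint_eqI) (rule *)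
  show ?thesis unfolding \<open>cadjoint T = S\<close> by (rule *)
qed

lemma cinner_cadjoint_left:
  fixes T :: "'a::complex_hilbert \<Rightarrow> 'a"
  assumes T: "bounded_clinear T"
  shows "cinner (cadjoint T v) w = cinner v (T w)"
proof -
  have "cinner (cadjoint T v) w = cnj (cinner w (cadjoint T v))" by (rule cinner_commute)
  also have "\<dots> = cnj (cinner (T w) v)" by (simp only: cinner_cadjoint[OF T])
  also have "\<dots> = cinner v (T w)" by (rule cinner_commute[symmetric])
  finally show ?thesis .
qed

lemma bounded_clinear_cadjoint:
  fixes T :: "'a::complex_hilbert \<Rightarrow> 'a"
  assumes T: "bounded_clinear T"
  shows "bounded_clinear (cadjoint T)"
proof (rule bounded_clinearI)
  note adj = cinner_cadjoint[OF T]
  show hom: "cadjoint T (c *\<^sub>C v) = c *\<^sub>C cadjoint T v" for c v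
    by (rule cinner_eqI) (simp flip: adj add: cinner_scaleC_right)
  obtain B where B: "\<And>v. norm (T v) \<le> norm v * B" "0 \<le> B"
    using bounded_linear.nonneg_bounded[OF bounded_clinearD(1)[OF T]] by auto
  show "bounded_linear (cadjoint T)"
  proof (rule bounded_linear_intro[where K = B])
    show "cadjoint T (v + w) = cadjoint T v + cadjoint T w" for v w
      by (rule cinner_eqI) (simp flip: adj add: cinner_add_right)
    show "cadjoint T (r *\<^sub>R v) = r *\<^sub>R cadjoint T v" for r v
      by (simp add: scaleR_scaleC hom)
    show "norm (cadjoint T v) \<le> norm v * B" for v
    proof (cases "cadjoint T v = 0")
      case False
      have "(norm (cadjoint T v))\<^sup>2 = cmod (cinner (cadjoint T v) (cadjoint T v))"
        by (simp add: cinner_self norm_power)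
      also have "\<dots> = cmod (cinner (T (cadjoint T v)) v)" by (simp add: adj)
      also have "\<dots> \<le> norm (T (cadjoint T v)) * norm v" by (rule cmod_cinner_le)
      also have "\<dots> \<le> norm (cadjoint T v) * B * norm v" by (intro mult_right_mono B) auto
      finally show ?thesis using False by (simp add: power2_eq_square mult.commute)
    qed (use B(2) in auto)
  qed
qed

lemma cadjoint_compose:
  fixes S T :: "'a::complex_hilbert \<Rightarrow> 'a"
  assumes "bounded_clinear S" "bounded_clinear T"
  shows "cadjoint (S \<circ> T) = cadjoint T \<circ> cadjoint S"
  by (rule cadjoint_eqI) (simp add: cinner_cadjoint assms)

section \<open>Orthonormal families\<close>

lemma has_sum_finite_sum:
  fixes f :: "'j \<Rightarrow> 'k \<Rightarrow> 'a::topological_comm_monoid_add"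
  assumes "finite J" "\<And>j. j \<in> J \<Longrightarrow> (f j has_sum s j) A"
  shows "((\<lambda>k. \<Sum>j\<in>J. f j k) has_sum (\<Sum>j\<in>J. s j)) A"
  using assms by (induction J rule: finite_induct) (auto intro!: has_sum_add)

definition orthonormal_on :: "'k set \<Rightarrow> ('k \<Rightarrow> 'a::complex_inner) \<Rightarrow> bool" where
  "orthonormal_on I e \<longleftrightarrow> (\<forall>i\<in>I. \<forall>j\<in>I. cinner (e i) (e j) = (if i = j then 1 else 0))"

definition orthonormal_basis :: "('k \<Rightarrow> 'a::complex_inner) \<Rightarrow> bool" where
  "orthonormal_basis e \<longleftrightarrow> orthonormal_on UNIV e \<and> closure (complex_vs.span (range e)) = UNIV"

definition expansion :: "('k \<Rightarrow> 'a::complex_inner) \<Rightarrow> 'k set \<Rightarrow> 'a \<Rightarrow> 'a" where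
  "expansion e F v = (\<Sum>k\<in>F. cinner v (e k) *\<^sub>C e k)"

lemma orthonormal_on_subset: "orthonormal_on I e \<Longrightarrow> J \<subseteq> I \<Longrightarrow> orthonormal_on J e"
  unfolding orthonormal_on_def by blast

lemma norm_orthonormal:
  assumes "orthonormal_on I e" "k \<in> I"
  shows "norm (e k) = 1"
proof -
  have "complex_of_real ((norm (e k))\<^sup>2) = of_real 1"
    using assms unfolding cinner_self[symmetric] by (simp add: orthonormal_on_def)
  hence "(norm (e k))\<^sup>2 = 1\<^sup>2" by (simp only: of_real_eq_iff one_power2)
  thus ?thesis by (simp only: power2_eq_iff_nonneg norm_ge_zero zero_le_one)
qed

lemma cmod_cinner_commute: "cmod (cinner x y) = cmod (cinner y (x :: 'a::complex_inner))"
  by (subst cinner_commute) simp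

lemma cinner_expansion:
  assumes "finite F" "orthonormal_on F e" "j \<in> F"
  shows "cinner (expansion e F v) (e j) = cinner v (e j)"
proof -
  have "cinner (expansion e F v) (e j) = (\<Sum>k\<in>F. cinner v (e k) * cinner (e k) (e j))"
    by (simp add: expansion_def cinner_sum_left cinner_scaleC_left)
  also have "\<dots> = (\<Sum>k\<in>F. if k = j then cinner v (e j) else 0)"
    using assms by (intro sum.cong) (auto simp: orthonormal_on_def)
  finally show ?thesis using assms by simp
qed

lemma norm_residual:
  assumes "finite F" "orthonormal_on F e"
  shows "(norm (v - expansion e F v))\<^sup>2 = (norm v)\<^sup>2 - (\<Sum>k\<in>F. (cmod (cinner v (e k)))\<^sup>2)"
proof -
  define p where "p = expansion e F v"
  have 1: "cinner x p = (\<Sum>k\<in>F. cnj (cinner v (e k)) * cinner x (e k))" for x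
    by (simp add: p_def expansion_def cinner_sum_right cinner_scaleC_right)
  have 2: "cinner (v - p) p = 0"
    unfolding 1 using assms
    by (intro sum.neutral) (auto simp: cinner_diff_left p_def cinner_expansion)
  have 3: "cinner v p = of_real (\<Sum>k\<in>F. (cmod (cinner v (e k)))\<^sup>2)"
    unfolding 1 by (simp add: complex_norm_square mult.commute del: of_real_power)
  have "cinner (v - p) (v - p) = cinner (v - p) v"
    using 2 by (simp add: cinner_diff_right)
  also have "\<dots> = cinner v v - cnj (cinner v p)"
    by (simp add: cinner_diff_left flip: cinner_commute)
  finally have "complex_of_real ((norm (v - p))\<^sup>2)
      = of_real ((norm v)\<^sup>2 - (\<Sum>k\<in>F. (cmod (cinner v (e k)))\<^sup>2))"
    unfolding cinner_self 3 by (simp del: of_real_power of_real_sum)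
  thus ?thesis unfolding p_def of_real_eq_iff .
qed

lemma bessel:
  assumes "finite F" "orthonormal_on F e"
  shows "(\<Sum>k\<in>F. (cmod (cinner v (e k)))\<^sup>2) \<le> (norm v)\<^sup>2"
  using norm_residual[OF assms, of v] by (metis diff_ge_0_iff_ge zero_le_power2)

lemma norm_residual_le:
  assumes "finite F" "orthonormal_on F e"
  shows "norm (v - expansion e F v) \<le> norm v"
  by (rule power2_le_imp_le) (simp_all add: norm_residual[OF assms] sum_nonneg)

lemma expansion_add: "expansion e F (v + w) = expansion e F v + expansion e F w"
  by (simp add: expansion_def cinner_add_left scaleC_add_left sum.distrib)

lemma expansion_diff: "expansion e F (v - w) = expansion e F v - expansion e F w"
  using expansion_add[of e F "v - w" w] by simp

lemma expansion_scaleC: "expansion e F (c *\<^sub>C v) = c *\<^sub>C expansion e F v"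
  by (simp add: expansion_def cinner_scaleC_left scaleC_scaleC complex_vs.scale_sum_right)

lemma expansion_eq_on_span:
  assumes e: "orthonormal_on UNIV e" and w: "w \<in> complex_vs.span (range e)"
  shows "\<exists>F. finite F \<and> (\<forall>F'. finite F' \<longrightarrow> F \<subseteq> F' \<longrightarrow> expansion e F' w = w)"
    (is "?P w")
proof -
  have "complex_vs.span (range e) \<subseteq> {w. ?P w}"
  proof (rule complex_vs.span_minimal)
    show "complex_vs.subspace {w. ?P w}"
    proof (rule complex_vs.subspaceI)
      show "0 \<in> {w. ?P w}" by (auto simp: expansion_def)
      show "c *\<^sub>C x \<in> {w. ?P w}" if "x \<in> {w. ?P w}" for c x
        using that by (auto simp: expansion_scaleC)
      show "x + y \<in> {w. ?P w}" if xy: "x \<in> {w. ?P w}" "y \<in> {w. ?P w}" for x y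
      proof -
        from xy(1) obtain F where
          F: "finite F \<and> (\<forall>F'. finite F' \<longrightarrow> F \<subseteq> F' \<longrightarrow> expansion e F' x = x)"
          unfolding mem_Collect_eq ..
        from xy(2) obtain G where
          G: "finite G \<and> (\<forall>F'. finite F' \<longrightarrow> G \<subseteq> F' \<longrightarrow> expansion e F' y = y)"
          unfolding mem_Collect_eq ..
        have "expansion e F' (x + y) = x + y" if "finite F'" "F \<union> G \<subseteq> F'" for F'
          using F G that by (simp add: expansion_add)
        with F G show ?thesis by (intro CollectI exI[of _ "F \<union> G"]) simp
      qed
    qed
    have "expansion e F' (e k) = e k" if "finite F'" "k \<in> F'" for k F'
    proof -
      have "expansion e F' (e k) = (\<Sum>l\<in>F'. if l = k then e k else 0)"
        unfolding expansion_def using e by (intro sum.cong) (auto simp: orthonormal_on_def)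
      thus ?thesis using that by simp
    qed
    hence "?P (e k)" for k by (intro exI[of _ "{k}"]) simp
    thus "range e \<subseteq> {w. ?P w}" by blast
  qed
  with w show ?thesis by (rule subsetD[THEN CollectD, rotated])
qed

text \<open>Vectors of the span are eventually reproduced by their partial expansions, and \<open>v \<mapsto> v - expansion e F v\<close>
  is a contraction, so density of the span makes the residuals of every vector arbitrarily small.\<close>

lemma parseval:
  assumes e: "orthonormal_basis e"
  shows "((\<lambda>k. (cmod (cinner v (e k)))\<^sup>2) has_sum (norm v)\<^sup>2) UNIV"
proof -
  have on: "orthonormal_on F e" for F
    using e by (auto simp: orthonormal_basis_def orthonormal_on_def)
  let ?f = "\<lambda>k. (cmod (cinner v (e k)))\<^sup>2"
  have sm: "?f summable_on UNIV"
    by (rule nonneg_bdd_above_summable_on) (auto intro!: bdd_aboveI bessel on)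
  have le: "infsum ?f UNIV \<le> (norm v)\<^sup>2"
    by (rule infsum_le_finite_sums[OF sm]) (intro bessel on)
  have "(norm v)\<^sup>2 - infsum ?f UNIV \<le> d" if d: "d > 0" for d
  proof -
    have "v \<in> closure (complex_vs.span (range e))"
      using e by (simp add: orthonormal_basis_def)
    then obtain w where w: "w \<in> complex_vs.span (range e)" "dist w v < sqrt d"
      unfolding closure_approachable using d by (meson real_sqrt_gt_zero)
    obtain F where F: "finite F" "expansion e F w = w"
      using expansion_eq_on_span[OF on w(1)] by blast
    have "v - expansion e F v = (v - w) - expansion e F (v - w)"
      by (simp add: expansion_diff F)
    hence "norm (v - expansion e F v) \<le> norm (v - w)"
      using norm_residual_le[OF F(1) on, of "v - w"] by metis
    also have "\<dots> \<le> sqrt d" using w by (simp add: dist_norm norm_minus_commute)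
    finally have "(norm (v - expansion e F v))\<^sup>2 \<le> (sqrt d)\<^sup>2"
      by (intro power_mono) auto
    hence "(norm v)\<^sup>2 - sum ?f F \<le> d" using d by (simp add: norm_residual[OF F(1) on])
    moreover have "sum ?f F \<le> infsum ?f UNIV"
      by (rule finite_sum_le_infsum[OF sm F(1)]) auto
    ultimately show ?thesis by simp
  qed
  hence "(norm v)\<^sup>2 \<le> infsum ?f UNIV" by (metis diff_le_eq field_le_epsilon add.commute)
  with le have "infsum ?f UNIV = (norm v)\<^sup>2" by simp
  with sm show ?thesis by (metis has_sum_infsum)
qed

text \<open>Summing a Bessel-type inequality for the finite orthonormal family \<open>\<phi>\<close> over the basis
  \<open>e\<close> removes the weights \<open>|\<langle>e k, \<phi> j\<rangle>|\<^sup>2\<close>, because these sum to \<open>1\<close> over \<open>k\<close>. This is how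
  information on the single vectors \<open>T (e k)\<close> becomes information on singular values.\<close>

lemma sum_le_infsum_over_basis:
  assumes e: "orthonormal_basis e" and J: "finite J" "\<And>j. j \<in> J \<Longrightarrow> norm (\<phi> j) = 1"
    and b: "b summable_on UNIV"
    and le: "\<And>k. (\<Sum>j\<in>J. c j * (cmod (cinner (e k) (\<phi> j)))\<^sup>2) \<le> b k"
  shows "(\<Sum>j\<in>J. c j) \<le> infsum b UNIV"
proof -
  have "((\<lambda>k. \<Sum>j\<in>J. c j * (cmod (cinner (e k) (\<phi> j)))\<^sup>2) has_sum (\<Sum>j\<in>J. c j * 1)) UNIV"
  proof (intro has_sum_finite_sum J has_sum_cmult_right)
    fix j assume "j \<in> J"
    with parseval[OF e, of "\<phi> j"] J show "((\<lambda>k. (cmod (cinner (e k) (\<phi> j)))\<^sup>2) has_sum 1) UNIV"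
      by (simp add: cmod_cinner_commute[of "\<phi> j"])
  qed
  from has_sum_mono[OF this has_sum_infsum[OF b]] le show ?thesis by simp
qed


section \<open>Hilbert--Schmidt operators\<close>

text \<open>The operator that sends the orthonormal basis \<open>e\<close> to the square-summable family \<open>f\<close>. Fourier
  multipliers with symbol in \<open>\<ell>\<^sub>2\<close> and the operators \<open>\<lambda>(x)g(-i\<nabla>)\<close> both have this form.\<close>

definition synthesis :: "('k \<Rightarrow> 'a::complex_inner) \<Rightarrow> ('k \<Rightarrow> 'a) \<Rightarrow> 'a \<Rightarrow> 'a" where
  "synthesis e f v = (\<Sum>\<^sub>\<infinity>k. cinner v (e k) *\<^sub>C f k)"

text \<open>Cauchy--Schwarz, with Bessel's inequality for the coefficients of \<open>v\<close>. The index set \<open>A\<close> is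
  arbitrary so that the bound applies to tails as well.\<close>

lemma synthesis_tail:
  fixes f :: "'k \<Rightarrow> 'a::complex_inner"
  assumes e: "orthonormal_on UNIV e" and f: "(\<lambda>k. (norm (f k))\<^sup>2) summable_on A"
  shows "(\<lambda>k. norm (cinner v (e k) *\<^sub>C f k)) summable_on A" (is ?sum)
    and "infsum (\<lambda>k. norm (cinner v (e k) *\<^sub>C f k)) A
      \<le> norm v * sqrt (infsum (\<lambda>k. (norm (f k))\<^sup>2) A)" (is ?le)
proof -
  have *: "sum (\<lambda>k. norm (cinner v (e k) *\<^sub>C f k)) F
      \<le> norm v * sqrt (infsum (\<lambda>k. (norm (f k))\<^sup>2) A)" if F: "finite F" "F \<subseteq> A" for F
  proof -
    have "sum (\<lambda>k. norm (cinner v (e k) *\<^sub>C f k)) F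
        = (\<Sum>k\<in>F. \<bar>cmod (cinner v (e k))\<bar> * \<bar>norm (f k)\<bar>)"
      by (simp add: norm_scaleC)
    also have "\<dots> \<le> L2_set (\<lambda>k. cmod (cinner v (e k))) F * L2_set (\<lambda>k. norm (f k)) F"
      by (rule L2_set_mult_ineq)
    also have "\<dots> \<le> norm v * sqrt (infsum (\<lambda>k. (norm (f k))\<^sup>2) A)"
    proof (rule mult_mono)
      show "L2_set (\<lambda>k. cmod (cinner v (e k))) F \<le> norm v"
        unfolding L2_set_def using bessel[OF F(1) orthonormal_on_subset[OF e subset_UNIV], of v]
        by (simp add: real_le_lsqrt)
      show "L2_set (\<lambda>k. norm (f k)) F \<le> sqrt (infsum (\<lambda>k. (norm (f k))\<^sup>2) A)"
        unfolding L2_set_def by (intro real_sqrt_le_mono finite_sum_le_infsum f F) auto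
    qed (auto simp: L2_set_def intro!: sum_nonneg)
    finally show ?thesis .
  qed
  show ?sum by (rule nonneg_bdd_above_summable_on) (auto intro!: bdd_aboveI *)
  thus ?le by (rule infsum_le_finite_sums) (use * in auto)
qed

lemma synthesis_summable:
  fixes f :: "'k \<Rightarrow> 'a::complex_hilbert"
  assumes "orthonormal_on UNIV e" "(\<lambda>k. (norm (f k))\<^sup>2) summable_on UNIV"
  shows "(\<lambda>k. cinner v (e k) *\<^sub>C f k) summable_on UNIV"
  by (rule abs_summable_summable) (rule synthesis_tail[OF assms])

lemma synthesis_basis:
  assumes "orthonormal_on UNIV e"
  shows "synthesis e f (e k) = f k"
proof -
  have "synthesis e f (e k) = (\<Sum>\<^sub>\<infinity>l\<in>{k}. cinner (e k) (e l) *\<^sub>C f l)"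
    unfolding synthesis_def using assms
    by (intro infsum_cong_neutral) (auto simp: orthonormal_on_def)
  thus ?thesis using assms by (simp add: orthonormal_on_def)
qed

lemma bounded_clinear_synthesis:
  fixes f :: "'k \<Rightarrow> 'a::complex_hilbert"
  assumes e: "orthonormal_on UNIV e" and f: "(\<lambda>k. (norm (f k))\<^sup>2) summable_on UNIV"
  shows "bounded_clinear (synthesis e f)"
proof (rule bounded_clinearI)
  note sm = synthesis_summable[OF assms]
  show scale: "synthesis e f (c *\<^sub>C v) = c *\<^sub>C synthesis e f v" for c v
    using infsumI[OF has_sum_bounded_linear[OF bounded_linear_scaleC has_sum_infsum[OF sm]], of c v]
    by (simp add: synthesis_def cinner_scaleC_left scaleC_scaleC)
  show "bounded_linear (synthesis e f)"
  proof (rule bounded_linear_intro)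
    show "synthesis e f (v + w) = synthesis e f v + synthesis e f w" for v w
      using infsum_add[OF sm sm, of v w]
      by (simp add: synthesis_def cinner_add_left scaleC_add_left)
    show "synthesis e f (r *\<^sub>R v) = r *\<^sub>R synthesis e f v" for r v
      by (simp add: scaleR_scaleC scale)
    show "norm (synthesis e f v) \<le> norm v * sqrt (infsum (\<lambda>k. (norm (f k))\<^sup>2) UNIV)" for v
      unfolding synthesis_def
      using norm_infsum_bound[OF synthesis_tail(1)[OF assms]] synthesis_tail(2)[OF assms]
      by (rule order_trans)
  qed
qed

lemma bounded_clinear_eq_on_basis:
  assumes e: "orthonormal_basis e" and S: "bounded_clinear S" and T: "bounded_clinear T"
    and eq: "\<And>k. S (e k) = T (e k)"
  shows "S = T"
proof
  fix v
  have "complex_vs.span (range e) \<subseteq> {v. S v = T v}"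
  proof
    fix x assume "x \<in> complex_vs.span (range e)"
    thus "x \<in> {v. S v = T v}"
      by (rule complex_vs.span_induct)
         (auto intro!: complex_vs.subspaceI simp: eq bounded_clinearD[OF S] bounded_clinearD[OF T])
  qed
  moreover have "closed {v. S v = T v}"
    by (intro closed_Collect_eq linear_continuous_on bounded_clinearD S T)
  ultimately have "closure (complex_vs.span (range e)) \<subseteq> {v. S v = T v}"
    by (rule closure_minimal)
  thus "S v = T v" using e by (auto simp: orthonormal_basis_def)
qed

lemma compact_combinations:
  fixes f :: "'k \<Rightarrow> 'a::complex_inner"
  assumes "finite F"
  shows "compact {\<Sum>k\<in>F. c k *\<^sub>C f k |c. \<forall>k\<in>F. cmod (c k) \<le> 1}"
  using assms
proof induction
  case (insert a F)
  let ?C = "{\<Sum>k\<in>F. c k *\<^sub>C f k |c. \<forall>k\<in>F. cmod (c k) \<le> 1}"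
  have "{\<Sum>k\<in>insert a F. c k *\<^sub>C f k |c. \<forall>k\<in>insert a F. cmod (c k) \<le> 1}
      = {x + y |x y. x \<in> (\<lambda>z. z *\<^sub>C f a) ` cball 0 1 \<and> y \<in> ?C}" (is "?A = ?B")
  proof
    show "?A \<subseteq> ?B" using insert by fastforce
    show "?B \<subseteq> ?A"
    proof
      fix v assume "v \<in> ?B"
      then obtain z c where z: "cmod z \<le> 1" "\<forall>k\<in>F. cmod (c k) \<le> 1"
        "v = z *\<^sub>C f a + (\<Sum>k\<in>F. c k *\<^sub>C f k)" by auto
      have "v = (\<Sum>k\<in>insert a F. (c(a := z)) k *\<^sub>C f k)"
        using insert(1,2) z(3) by (auto intro!: sum.cong)
      with z show "v \<in> ?A" by (auto intro!: exI[of _ "c(a := z)"])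
    qed
  qed
  moreover have "compact ((\<lambda>z. z *\<^sub>C f a) ` cball 0 1)"
    by (intro compact_continuous_image linear_continuous_on bounded_linear_scaleC_left compact_cball)
  ultimately show ?case using compact_sums[OF _ insert.IH] by simp
qed auto

text \<open>By the tail estimate the image of the unit ball is within any given distance of a compact set
  of finite combinations of the \<open>f k\<close>, hence totally bounded.\<close>

lemma compact_operator_synthesis:
  fixes f :: "'k \<Rightarrow> 'a::complex_hilbert"
  assumes e: "orthonormal_on UNIV e" and f: "(\<lambda>k. (norm (f k))\<^sup>2) summable_on UNIV"
  shows "compact_operator (synthesis e f)"
  unfolding compact_operator_def
proof (intro conjI bounded_clinear_synthesis assms)
  define S where "S = synthesis e f ` cball 0 1"
  have "\<exists>K. finite K \<and> closure S \<subseteq> (\<Union>x\<in>K. ball x d)" if d: "0 < d" for d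
  proof -
    define r where "r = d / 3"
    have r: "r > 0" using d by (simp add: r_def)
    let ?n = "\<lambda>k. (norm (f k))\<^sup>2"
    obtain F where F: "finite F" "dist (sum ?n F) (infsum ?n UNIV) \<le> r\<^sup>2"
      using infsum_finite_approximation[OF f, of "r\<^sup>2"] r by auto
    have f': "?n summable_on (- F)" using f by (rule summable_on_subset) auto
    have split: "infsum ?n UNIV = sum ?n F + infsum ?n (- F)"
      using infsum_Un_disjoint[OF _ f', of F] F(1) by simp
    have tail: "infsum ?n (- F) \<le> r\<^sup>2"
      using F(2) by (simp add: split dist_real_def infsum_nonneg)
    define C where "C = {\<Sum>k\<in>F. c k *\<^sub>C f k |c. \<forall>k\<in>F. cmod (c k) \<le> 1}"
    have "compact C" unfolding C_def by (rule compact_combinations) fact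
    hence "\<exists>K. finite K \<and> C \<subseteq> (\<Union>x\<in>K. ball x r)"
      using r unfolding compact_eq_totally_bounded by simp
    then obtain K where K: "finite K" "C \<subseteq> (\<Union>x\<in>K. ball x r)"
      by (elim exE conjE)
    have "S \<subseteq> (\<Union>x\<in>K. cball x (2 * r))"
    proof
      fix y assume "y \<in> S"
      then obtain v where v: "norm v \<le> 1" "y = synthesis e f v" by (auto simp: S_def)
      let ?t = "\<lambda>k. cinner v (e k) *\<^sub>C f k"
      have sm: "?t summable_on (- F)"
        by (rule abs_summable_summable) (rule synthesis_tail[OF e f'])
      have y: "y = sum ?t F + infsum ?t (- F)"
        using infsum_Un_disjoint[OF _ sm, of F] F(1) by (simp add: v synthesis_def)
      have "cmod (cinner v (e k)) \<le> 1" for k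
      proof -
        have "norm (e k) = 1" by (rule norm_orthonormal[OF e]) simp
        thus ?thesis using cmod_cinner_le[of v "e k"] v by simp
      qed
      hence "sum ?t F \<in> C" by (auto simp: C_def)
      then obtain x where x: "x \<in> K" "dist x (sum ?t F) < r" using K by auto
      have "norm (infsum ?t (- F)) \<le> norm v * sqrt (infsum ?n (- F))"
        using norm_infsum_bound[OF synthesis_tail(1)[OF e f']] synthesis_tail(2)[OF e f']
        by (rule order_trans)
      also have "\<dots> \<le> 1 * r"
        using v tail r by (intro mult_mono) (auto simp: real_le_lsqrt infsum_nonneg)
      finally have "dist x y \<le> 2 * r"
        using x(2) dist_triangle[of x y "sum ?t F"] by (simp add: y dist_norm)
      with x show "y \<in> (\<Union>x\<in>K. cball x (2 * r))" by auto
    qed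
    hence "closure S \<subseteq> (\<Union>x\<in>K. cball x (2 * r))"
      by (rule closure_minimal) (auto intro: K)
    also have "\<dots> \<subseteq> (\<Union>x\<in>K. ball x d)" using d by (auto simp: r_def)
    finally show ?thesis using K by blast
  qed
  thus "compact (closure S)"
    unfolding compact_eq_totally_bounded by (auto simp: complete_eq_closed)
qed

section \<open>Non-increasing sequences with prescribed multiplicities\<close>

text \<open>The condition that characterizes \<open>singular_value T\<close>, for an arbitrary multiplicity function.\<close>

definition enumerates :: "(nat \<Rightarrow> real) \<Rightarrow> (real \<Rightarrow> nat) \<Rightarrow> bool" where
  "enumerates \<mu> m \<longleftrightarrow> decseq \<mu> \<and> \<mu> \<longlonglongrightarrow> 0 \<and> (\<forall>s>0. card {j. \<mu> j = s} = m s)"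

lemma enumerates_nonneg: "enumerates \<mu> m \<Longrightarrow> 0 \<le> \<mu> j"
  unfolding enumerates_def by (blast intro: decseq_ge)

lemma enumerates_finite:
  assumes "enumerates \<mu> m" "0 < s"
  shows "finite {j. s \<le> \<mu> j}"
proof -
  have "\<forall>\<^sub>F j in sequentially. \<mu> j < s"
    using assms by (intro order_tendstoD(2)[where y = 0]) (auto simp: enumerates_def)
  then obtain N where "\<And>j. j \<ge> N \<Longrightarrow> \<mu> j < s" by (auto simp: eventually_sequentially)
  hence "{j. s \<le> \<mu> j} \<subseteq> {..<N}" by (auto simp: not_less[symmetric])
  thus ?thesis by (rule finite_subset) simp
qed

lemma enumerates_ge_iff:
  assumes "enumerates \<mu> m" "0 < s"
  shows "s \<le> \<mu> j \<longleftrightarrow> j < card {i. s \<le> \<mu> i}"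
proof
  have dec: "\<mu> j \<le> \<mu> i" if "i \<le> j" for i j
    using assms(1) that by (auto simp: enumerates_def decseq_def)
  show "j < card {i. s \<le> \<mu> i}" if "s \<le> \<mu> j"
  proof -
    have "{..j} \<subseteq> {i. s \<le> \<mu> i}"
    proof
      fix i assume "i \<in> {..j}"
      thus "i \<in> {i. s \<le> \<mu> i}" using order_trans[OF that dec[of i]] by simp
    qed
    from card_mono[OF enumerates_finite[OF assms] this] show ?thesis by simp
  qed
  show "s \<le> \<mu> j" if "j < card {i. s \<le> \<mu> i}"
  proof (rule ccontr)
    assume "\<not> s \<le> \<mu> j"
    have "{i. s \<le> \<mu> i} \<subseteq> {..<j}"
    proof
      fix i assume "i \<in> {i. s \<le> \<mu> i}"
      thus "i \<in> {..<j}" using \<open>\<not> s \<le> \<mu> j\<close> dec[of j i] by (cases "i < j") auto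
    qed
    from card_mono[OF _ this] that show False by simp
  qed
qed

lemma enumerates_unique:
  assumes \<mu>: "enumerates \<mu> m" and \<nu>: "enumerates \<nu> m"
  shows "\<mu> = \<nu>"
proof -
  have card: "card {j. s \<le> \<mu> j} = card {j. s \<le> \<nu> j}" if s: "0 < s" for s
  proof -
    define T where "T = \<mu> ` {j. s \<le> \<mu> j} \<union> \<nu> ` {j. s \<le> \<nu> j}"
    have T: "finite T" "\<And>t. t \<in> T \<Longrightarrow> s \<le> t"
      using enumerates_finite[OF \<mu> s] enumerates_finite[OF \<nu> s] by (auto simp: T_def)
    have *: "card {j. s \<le> \<rho> j} = (\<Sum>t\<in>T. m t)"
      if \<rho>: "enumerates \<rho> m" "\<rho> ` {j. s \<le> \<rho> j} \<subseteq> T" for \<rho>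
    proof -
      have "{j. s \<le> \<rho> j} = (\<Union>t\<in>T. {j. \<rho> j = t})"
        using \<rho>(2) by (auto dest: T(2))
      also have "card \<dots> = (\<Sum>t\<in>T. card {j. \<rho> j = t})"
      proof (rule card_UN_disjoint[OF T(1)])
        show "\<forall>t\<in>T. finite {j. \<rho> j = t}"
          by (intro ballI finite_subset[OF _ enumerates_finite[OF \<rho>(1) s]]) (auto dest: T(2))
      qed auto
      also have "\<dots> = (\<Sum>t\<in>T. m t)"
      proof (rule sum.cong)
        fix t assume "t \<in> T"
        hence "0 < t" using T(2) s by (meson less_le_trans)
        thus "card {j. \<rho> j = t} = m t" using \<rho>(1) by (simp add: enumerates_def)
      qed simp
      finally show ?thesis .
    qed
    show ?thesis
      using *[OF \<mu>, unfolded T_def, OF Un_upper1] *[OF \<nu>, unfolded T_def, OF Un_upper2] by (rule trans[OF _ sym])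
  qed
  have iff: "s \<le> \<mu> j \<longleftrightarrow> s \<le> \<nu> j" if "0 < s" for s j
    unfolding enumerates_ge_iff[OF \<mu> that, of j] enumerates_ge_iff[OF \<nu> that, of j] card[OF that] ..
  show ?thesis
  proof
    fix j
    show "\<mu> j = \<nu> j"
    proof (rule antisym)
      show "\<mu> j \<le> \<nu> j"
        using iff[of "\<mu> j" j] enumerates_nonneg[OF \<nu>, of j] by (cases "0 < \<mu> j") simp_all
      show "\<nu> j \<le> \<mu> j"
        using iff[of "\<nu> j" j] enumerates_nonneg[OF \<mu>, of j] by (cases "0 < \<nu> j") simp_all
    qed
  qed
qed

text \<open>With \<open>N s\<close> the total multiplicity of \<open>[s, \<infinity>)\<close>, the sequence must satisfy
  \<open>s \<le> \<mu> j \<longleftrightarrow> j < N s\<close>, which dictates its definition as a supremum.\<close>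

lemma enumerates_exists:
  assumes fin: "\<And>s. 0 < s \<Longrightarrow> finite {t. s \<le> t \<and> m t \<noteq> 0}"
  shows "\<exists>\<mu>. enumerates \<mu> m"
proof -
  define A where "A s = {t. s \<le> t \<and> m t \<noteq> 0}" for s
  define N where "N s = sum m (A s)" for s
  have A: "finite (A s)" if "0 < s" for s using fin[OF that] by (simp add: A_def)
  have anti: "N t \<le> N s" if "0 < s" "s \<le> t" for s t
    unfolding N_def using that A[OF that(1)] by (intro sum_mono2) (auto simp: A_def)
  define S where "S j = insert 0 {s. 0 < s \<and> j < N s}" for j
  define \<mu> where "\<mu> j = Sup (S j)" for j
  obtain B where B: "0 < B" "N B = 0"
  proof
    define B where "B = Max (insert 0 (A 1)) + 1"
    have B1: "t < B" if "t \<in> insert 0 (A 1)" for t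
      unfolding B_def using Max_ge[OF _ that] A[of 1] by fastforce
    show "0 < B" using B1 by simp
    have "Max (insert 0 (A 1)) \<ge> 0" using A[of 1] by (intro Max_ge) auto
    hence "1 \<le> B" by (simp add: B_def)
    have "t \<notin> A B" for t
    proof
      assume t: "t \<in> A B"
      hence "t \<in> A 1" using \<open>1 \<le> B\<close> by (simp add: A_def)
      hence "t < B" by (intro B1) simp
      thus False using t by (simp add: A_def)
    qed
    hence "A B = {}" by blast
    thus "N B = 0" by (simp add: N_def)
  qed
  have S_le: "s \<le> B" if "s \<in> S j" for s j
    using that B anti[of B s] by (cases "s \<le> B") (auto simp: S_def)
  hence bdd: "bdd_above (S j)" for j by (rule bdd_aboveI)
  have key: "s \<le> \<mu> j \<longleftrightarrow> j < N s" if s: "0 < s" for s j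
  proof
    show "s \<le> \<mu> j" if "j < N s"
      unfolding \<mu>_def using that s by (intro cSup_upper bdd) (auto simp: S_def)
    show "j < N s" if "s \<le> \<mu> j"
    proof (rule ccontr)
      assume j: "\<not> j < N s"
      define M where "M = Max (insert (s/2) {t \<in> A (s/2). t < s})"
      have fM: "finite (insert (s/2) {t \<in> A (s/2). t < s})" using A[of "s/2"] s by simp
      have M: "s/2 \<le> M" "\<And>t. t \<in> A (s/2) \<Longrightarrow> t < s \<Longrightarrow> t \<le> M"
        unfolding M_def by (rule Max_ge[OF fM], simp)+
      have "M < s" unfolding M_def Max_less_iff[OF fM insert_not_empty] using s by auto
      \<comment> \<open>No value with positive multiplicity lies in \<open>[r, s)\<close>, so \<open>N\<close> is constant on \<open>[r, s]\<close>.\<close>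
      define r where "r = (M + s) / 2"
      have r: "s/2 \<le> r" "M < r" "r < s" using M(1) \<open>M < s\<close> s by (auto simp: r_def)
      have "t \<in> A r \<longleftrightarrow> t \<in> A s" for t
        using M(2)[of t] r by (cases "t < s"; cases "m t = 0") (auto simp: A_def)
      hence "A r = A s" by blast
      hence N: "N r = N s" by (simp add: N_def)
      have "s' \<le> r" if "s' \<in> S j" for s'
        using that anti[of r s'] r s N j by (cases "s' \<le> r") (auto simp: S_def)
      hence "\<mu> j \<le> r" unfolding \<mu>_def by (intro cSup_least) (auto simp: S_def)
      thus False using r \<open>s \<le> \<mu> j\<close> by simp
    qed
  qed
  have nonneg: "0 \<le> \<mu> j" for j
    unfolding \<mu>_def by (intro cSup_upper bdd) (auto simp: S_def)
  have "enumerates \<mu> m"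
    unfolding enumerates_def
  proof (intro conjI allI impI)
    show "decseq \<mu>"
      unfolding decseq_Suc_iff \<mu>_def by (intro allI cSup_subset_mono bdd) (auto simp: S_def)
    show "\<mu> \<longlonglongrightarrow> 0"
    proof (rule LIMSEQ_I)
      fix r :: real assume "0 < r"
      hence "\<forall>j\<ge>N r. norm (\<mu> j - 0) < r" using key[of r] nonneg by (auto simp: not_le[symmetric])
      thus "\<exists>n. \<forall>j\<ge>n. norm (\<mu> j - 0) < r" by blast
    qed
    fix s :: real assume s: "0 < s"
    define A' where "A' = {t. s < t \<and> m t \<noteq> 0}"
    have A': "finite A'" by (rule finite_subset[OF _ A[OF s]]) (auto simp: A'_def A_def)
    define r where "r = Min (insert (s + 1) A')"
    have r: "s < r" "\<And>t. t \<in> A' \<Longrightarrow> r \<le> t"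
      unfolding r_def using A' by (auto simp: A'_def)
    have A'_eq: "A t = A'" if t: "s < t" "t \<le> r" for t
    proof -
      have "u \<in> A t \<longleftrightarrow> u \<in> A'" for u
        using t r(2)[of u] by (cases "s < u"; cases "m u = 0") (auto simp: A_def A'_def)
      thus ?thesis by blast
    qed
    have gt: "s < \<mu> j \<longleftrightarrow> j < N r" for j
    proof
      assume j: "s < \<mu> j"
      show "j < N r"
      proof (cases "r \<le> \<mu> j")
        case False
        hence "N (\<mu> j) = N r" using A'_eq[of "\<mu> j"] A'_eq[of r] j r by (simp add: N_def)
        thus ?thesis using key[of "\<mu> j" j] j s by simp
      qed (use key[of r j] r s in auto)
    qed (use key[of r j] r s in auto)
    have "t \<in> A s \<longleftrightarrow> t \<in> (if m s = 0 then A' else insert s A')" for t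
      by (cases "t = s") (auto simp: A_def A'_def)
    hence "A s = (if m s = 0 then A' else insert s A')" by blast
    hence Ns: "N s = m s + N r"
      using A'_eq[of r] r A' by (auto simp: N_def A'_def)
    have "\<mu> j = s \<longleftrightarrow> j < N s \<and> \<not> j < N r" for j
      unfolding key[OF s, symmetric] gt[symmetric] by auto
    hence "{j. \<mu> j = s} = {..<N s} - {..<N r}"
      by (intro set_eqI) (simp only: mem_Collect_eq Diff_iff lessThan_iff)
    thus "card {j. \<mu> j = s} = m s" by (simp add: card_Diff_subset Ns)
  qed
  thus ?thesis by (rule exI[of _ \<mu>])
qed


section \<open>Singular values of Hilbert--Schmidt operators\<close>

definition singular_eigenspace :: "('a::complex_inner \<Rightarrow> 'a) \<Rightarrow> real \<Rightarrow> 'a set" where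
  "singular_eigenspace T s = {v. cadjoint T (T v) = complex_of_real (s\<^sup>2) *\<^sub>C v}"

lemma subspace_singular_eigenspace:
  fixes T :: "'a::complex_hilbert \<Rightarrow> 'a"
  assumes T: "bounded_clinear T"
  shows "complex_vs.subspace (singular_eigenspace T s)"
  by (rule complex_vs.subspaceI)
     (auto simp: singular_eigenspace_def bounded_clinearD[OF T]
       bounded_clinearD[OF bounded_clinear_cadjoint[OF T]] scaleC_add_right scaleC_scaleC mult.commute)

lemma cinner_singular_eigenspace:
  fixes T :: "'a::complex_hilbert \<Rightarrow> 'a"
  assumes T: "bounded_clinear T" and w: "w \<in> singular_eigenspace T s"
  shows "cinner (T v) (T w) = of_real (s\<^sup>2) * cinner v w"
  using w by (simp add: cinner_cadjoint[OF T] singular_eigenspace_def cinner_scaleC_right)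

lemma singular_eigenspaces_orthogonal:
  fixes T :: "'a::complex_hilbert \<Rightarrow> 'a"
  assumes T: "bounded_clinear T" and v: "v \<in> singular_eigenspace T s"
    and w: "w \<in> singular_eigenspace T t" and st: "0 < s" "0 < t" "s \<noteq> t"
  shows "cinner v w = 0"
proof -
  have "of_real (t\<^sup>2) * cinner v w = cnj (cinner (T w) (T v))"
    using cinner_singular_eigenspace[OF T w, of v] by (simp flip: cinner_commute)
  also have "\<dots> = of_real (s\<^sup>2) * cnj (cinner w v)"
    by (simp add: cinner_singular_eigenspace[OF T v])
  also have "cnj (cinner w v) = cinner v w" by (rule cinner_commute[symmetric])
  finally have "complex_of_real (t\<^sup>2 - s\<^sup>2) * cinner v w = 0"
    by (simp add: algebra_simps)
  moreover have "t\<^sup>2 - s\<^sup>2 \<noteq> 0" using st by (simp add: power2_eq_iff)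
  ultimately show ?thesis by (simp del: of_real_diff of_real_power)
qed

text \<open>The vectors \<open>T (\<phi> j) / \<sigma> j\<close> are again orthonormal, so this is Bessel's inequality for \<open>T v\<close>.\<close>

lemma bessel_singular:
  fixes T :: "'a::complex_hilbert \<Rightarrow> 'a"
  assumes T: "bounded_clinear T" and J: "finite J" "orthonormal_on J \<phi>"
    and \<phi>: "\<And>j. j \<in> J \<Longrightarrow> 0 < \<sigma> j" "\<And>j. j \<in> J \<Longrightarrow> \<phi> j \<in> singular_eigenspace T (\<sigma> j)"
  shows "(\<Sum>j\<in>J. (\<sigma> j)\<^sup>2 * (cmod (cinner v (\<phi> j)))\<^sup>2) \<le> (norm (T v))\<^sup>2"
proof -
  define \<psi> where "\<psi> j = complex_of_real (1 / \<sigma> j) *\<^sub>C T (\<phi> j)" for j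
  have *: "cinner (T u) (\<psi> j) = of_real (\<sigma> j) * cinner u (\<phi> j)" if "j \<in> J" for u j
    using \<phi>[OF that] that
    by (simp add: \<psi>_def cinner_scaleC_right cinner_singular_eigenspace[OF T] power2_eq_square)
  have "orthonormal_on J \<psi>"
    unfolding orthonormal_on_def
  proof (intro ballI)
    fix i j assume ij: "i \<in> J" "j \<in> J"
    have "cinner (\<psi> i) (\<psi> j) = of_real (1 / \<sigma> i) * (of_real (\<sigma> j) * cinner (\<phi> i) (\<phi> j))"
      using *[OF ij(2)] by (simp add: \<psi>_def[of i] cinner_scaleC_left)
    thus "cinner (\<psi> i) (\<psi> j) = (if i = j then 1 else 0)"
      using J(2) ij \<phi>(1)[OF ij(1)] by (cases "i = j") (simp_all add: orthonormal_on_def)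
  qed
  from bessel[OF J(1) this, of "T v"] show ?thesis
    using \<phi>(1) by (simp add: * norm_mult power_mult_distrib cong: sum.cong)
qed

lemma orthonormal_independent:
  assumes "finite B" "orthonormal_on B (\<lambda>b. b)"
  shows "complex_vs.independent B"
proof (rule complex_vs.independent_if_scalars_zero[OF assms(1)])
  fix c x assume 0: "(\<Sum>b\<in>B. c b *\<^sub>C b) = 0" and x: "x \<in> B"
  have "0 = cinner (\<Sum>b\<in>B. c b *\<^sub>C b) x" by (simp add: 0)
  also have "\<dots> = (\<Sum>b\<in>B. if b = x then c x else 0)"
    unfolding cinner_sum_left using assms(2) x
    by (intro sum.cong) (auto simp: orthonormal_on_def cinner_scaleC_left)
  finally show "c x = 0" using assms(1) x by simp
qed

locale hilbert_schmidt =
  fixes T :: "'a::complex_hilbert \<Rightarrow> 'a" and e :: "'k \<Rightarrow> 'a"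
  assumes T: "bounded_clinear T" and e: "orthonormal_basis e"
    and HS: "(\<lambda>k. (norm (T (e k)))\<^sup>2) summable_on UNIV"
begin

definition HS_norm2 :: real where
  "HS_norm2 = infsum (\<lambda>k. (norm (T (e k)))\<^sup>2) UNIV"

text \<open>Every eigenvector of the family contributes at least \<open>s\<^sup>2\<close> to the squared Hilbert--Schmidt norm.\<close>

lemma card_orthonormal_le:
  assumes J: "finite J" "orthonormal_on J \<phi>" and s: "0 < s"
    and \<phi>: "\<And>j. j \<in> J \<Longrightarrow> s \<le> \<sigma> j" "\<And>j. j \<in> J \<Longrightarrow> \<phi> j \<in> singular_eigenspace T (\<sigma> j)"
  shows "real (card J) \<le> HS_norm2 / s\<^sup>2"
proof -
  have "real (card J) * s\<^sup>2 = (\<Sum>j\<in>J. s\<^sup>2)" by simp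
  also have "\<dots> \<le> (\<Sum>j\<in>J. (\<sigma> j)\<^sup>2)"
    using \<phi>(1) s by (intro sum_mono power_mono) auto
  also have "\<dots> \<le> HS_norm2"
    unfolding HS_norm2_def
  proof (rule sum_le_infsum_over_basis[OF e J(1) _ HS])
    show "norm (\<phi> j) = 1" if "j \<in> J" for j using norm_orthonormal[OF J(2) that] .
    show "(\<Sum>j\<in>J. (\<sigma> j)\<^sup>2 * (cmod (cinner (e k) (\<phi> j)))\<^sup>2) \<le> (norm (T (e k)))\<^sup>2" for k
      using \<phi> s by (intro bessel_singular[OF T J]) force+
  qed
  finally show ?thesis using s by (simp add: field_simps)
qed

text \<open>An orthonormal set of maximal cardinality in an eigenspace spans it, since otherwise a normalized
  residual could be added. The cardinalities are bounded by \<open>card_orthonormal_le\<close>.\<close>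

lemma eigenspace_orthonormal_basis:
  assumes s: "0 < s"
  shows "\<exists>B. finite B \<and> B \<subseteq> singular_eigenspace T s \<and> orthonormal_on B (\<lambda>b. b) \<and>
    card B = singular_mult T s \<and> singular_eigenspace T s \<subseteq> complex_vs.span B"
proof -
  let ?E = "singular_eigenspace T s"
  note sub = subspace_singular_eigenspace[OF T]
  define P where "P n \<longleftrightarrow> (\<exists>B. finite B \<and> B \<subseteq> ?E \<and> orthonormal_on B (\<lambda>b. b) \<and> card B = n)" for n
  have P0: "P 0" unfolding P_def by (intro exI[of _ "{}"]) (auto simp: orthonormal_on_def)
  have P_le: "n \<le> nat \<lfloor>HS_norm2 / s\<^sup>2\<rfloor>" if "P n" for n
  proof -
    from that obtain B where "finite B" "B \<subseteq> ?E" "orthonormal_on B (\<lambda>b. b)" "card B = n"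
      by (auto simp: P_def)
    with card_orthonormal_le[of B "\<lambda>b. b" s "\<lambda>_. s"] s have "real n \<le> HS_norm2 / s\<^sup>2" by auto
    thus ?thesis by (simp add: le_nat_floor)
  qed
  define n where "n = (GREATEST k. P k)"
  have n: "P n" "\<And>k. P k \<Longrightarrow> k \<le> n"
    unfolding n_def by (rule GreatestI_nat[of P, OF P0], erule P_le) (rule Greatest_le_nat[of P], assumption, erule P_le)
  from n(1) obtain B where B: "finite B" "B \<subseteq> ?E" "orthonormal_on B (\<lambda>b. b)" "card B = n"
    by (auto simp: P_def)
  have "?E \<subseteq> complex_vs.span B"
  proof
    fix v assume v: "v \<in> ?E"
    define p where "p = expansion (\<lambda>b. b) B v"
    have p_span: "p \<in> complex_vs.span B"
      unfolding p_def expansion_def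
      by (intro complex_vs.span_sum complex_vs.span_scale complex_vs.span_base)
    also have "\<dots> \<subseteq> ?E" using B(2) sub by (rule complex_vs.span_minimal)
    finally have r: "v - p \<in> ?E" using v sub by (blast intro: complex_vs.subspace_diff)
    have "v - p = 0"
    proof (rule ccontr)
      assume ne: "v - p \<noteq> 0"
      define u where "u = complex_of_real (1 / norm (v - p)) *\<^sub>C (v - p)"
      have u1: "cinner u u = 1"
        using ne by (simp add: u_def cinner_self norm_scaleC norm_divide)
      have uB: "cinner u b = 0" "cinner b u = 0" if "b \<in> B" for b
      proof -
        show *: "cinner u b = 0"
          using cinner_expansion[OF B(1,3) that, of v] by (simp add: u_def cinner_scaleC_left cinner_diff_left p_def)
        show "cinner b u = 0" by (subst cinner_commute) (simp add: *)
      qed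
      have uE: "u \<in> ?E" unfolding u_def using r sub by (blast intro: complex_vs.subspace_scale)
      have uB': "u \<notin> B" using u1 uB by force
      have "orthonormal_on (insert u B) (\<lambda>b. b)"
        using B(3) u1 uB uB' by (auto simp: orthonormal_on_def)
      hence "P (Suc n)" unfolding P_def
        using B uE uB' by (intro exI[of _ "insert u B"]) auto
      from n(2)[OF this] show False by simp
    qed
    thus "v \<in> complex_vs.span B" using p_span by simp
  qed
  moreover from this have "complex_vs.dim ?E = card B"
    using B orthonormal_independent[OF B(1,3)] by (intro complex_vs.dim_unique) auto
  ultimately show ?thesis using B by (auto simp: singular_mult_def singular_eigenspace_def)
qed

text \<open>Unit eigenvectors for distinct singular values at least \<open>s\<close> are orthonormal, and there are at
  most \<open>HS_norm2 / s\<^sup>2\<close> of them. This finiteness is what makes the sequence of singular values exist.\<close>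

lemma finite_singular_mult:
  assumes s: "0 < s"
  shows "finite {t. s \<le> t \<and> singular_mult T t \<noteq> 0}"
proof -
  have "\<exists>b. b \<in> singular_eigenspace T t \<and> cinner b b = 1"
    if t: "s \<le> t" "singular_mult T t \<noteq> 0" for t
  proof -
    obtain B where B: "finite B" "B \<subseteq> singular_eigenspace T t" "orthonormal_on B (\<lambda>b. b)"
      "card B = singular_mult T t" using eigenspace_orthonormal_basis[of t] s t by auto
    with t obtain b where "b \<in> B" by fastforce
    with B show ?thesis by (auto simp: orthonormal_on_def)
  qed
  then obtain \<phi> where \<phi>: "\<And>t. s \<le> t \<Longrightarrow> singular_mult T t \<noteq> 0 \<Longrightarrow>
      \<phi> t \<in> singular_eigenspace T t \<and> cinner (\<phi> t) (\<phi> t) = 1" by metis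
  have "card F \<le> nat \<lfloor>HS_norm2 / s\<^sup>2\<rfloor>"
    if F: "F \<subseteq> {t. s \<le> t \<and> singular_mult T t \<noteq> 0}" "finite F" for F
  proof -
    have "orthonormal_on F \<phi>"
      unfolding orthonormal_on_def
    proof (intro ballI)
      fix t u assume tu: "t \<in> F" "u \<in> F"
      hence *: "s \<le> t" "s \<le> u" "singular_mult T t \<noteq> 0" "singular_mult T u \<noteq> 0" using F(1) by auto
      hence pos: "0 < t" "0 < u" using s by auto
      show "cinner (\<phi> t) (\<phi> u) = (if t = u then 1 else 0)"
        using \<phi>[of t] \<phi>[of u] * singular_eigenspaces_orthogonal[OF T _ _ pos, of "\<phi> t" "\<phi> u"] by auto
    qed
    from card_orthonormal_le[OF F(2) this s, of "\<lambda>t. t"] \<phi> F(1)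
    have "real (card F) \<le> HS_norm2 / s\<^sup>2" by blast
    thus ?thesis by (simp add: le_nat_floor)
  qed
  thus ?thesis by (intro finite_if_finite_subsets_card_bdd[THEN conjunct1])
qed

lemma enumerates_singular_value: "enumerates (singular_value T) (singular_mult T)"
proof -
  from enumerates_exists[OF finite_singular_mult] obtain \<mu> where
    \<mu>: "enumerates \<mu> (singular_mult T)" by (rule exE)
  have "singular_value T = (THE \<nu>. enumerates \<nu> (singular_mult T))"
    by (simp only: singular_value_def enumerates_def)
  also have "\<dots> = \<mu>"
    by (rule the_equality[of "\<lambda>\<nu>. enumerates \<nu> (singular_mult T)", OF \<mu>])
       (rule enumerates_unique[OF _ \<mu>])
  finally show ?thesis using \<mu> by simp
qed

text \<open>Matching each level set of the sequence of singular values with an orthonormal basis of the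
  eigenspace gives an orthonormal family of eigenvectors indexed like that sequence.\<close>

lemma singular_vectors_exist:
  "\<exists>\<phi>. orthonormal_on {j. 0 < singular_value T j} \<phi> \<and>
    (\<forall>j. 0 < singular_value T j \<longrightarrow> \<phi> j \<in> singular_eigenspace T (singular_value T j))"
proof -
  let ?\<mu> = "singular_value T"
  note en = enumerates_singular_value
  have "\<exists>b. inj_on b {j. ?\<mu> j = s} \<and> b ` {j. ?\<mu> j = s} \<subseteq> singular_eigenspace T s \<and>
      orthonormal_on (b ` {j. ?\<mu> j = s}) (\<lambda>v. v)" if s: "0 < s" for s
  proof -
    obtain B where B: "finite B" "B \<subseteq> singular_eigenspace T s" "orthonormal_on B (\<lambda>b. b)"
      "card B = singular_mult T s" using eigenspace_orthonormal_basis[OF s] by blast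
    have "finite {j. ?\<mu> j = s}"
      by (rule finite_subset[OF _ enumerates_finite[OF en s]]) auto
    moreover have "card {j. ?\<mu> j = s} = card B" using en s B by (simp add: enumerates_def)
    ultimately obtain b where "bij_betw b {j. ?\<mu> j = s} B"
      using finite_same_card_bij[OF _ B(1)] by blast
    with B show ?thesis by (auto simp: bij_betw_def)
  qed
  then obtain b where b: "\<And>s. 0 < s \<Longrightarrow> inj_on (b s) {j. ?\<mu> j = s}"
    "\<And>s. 0 < s \<Longrightarrow> b s ` {j. ?\<mu> j = s} \<subseteq> singular_eigenspace T s"
    "\<And>s. 0 < s \<Longrightarrow> orthonormal_on (b s ` {j. ?\<mu> j = s}) (\<lambda>v. v)" by metis
  define \<phi> where "\<phi> j = b (?\<mu> j) j" for j
  have \<phi>: "\<phi> j \<in> singular_eigenspace T (?\<mu> j)" if "0 < ?\<mu> j" for j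
    using b(2)[OF that] by (auto simp: \<phi>_def)
  have "orthonormal_on {j. 0 < ?\<mu> j} \<phi>"
    unfolding orthonormal_on_def
  proof (intro ballI)
    fix i j assume "i \<in> {j. 0 < ?\<mu> j}" "j \<in> {j. 0 < ?\<mu> j}"
    hence ij: "0 < ?\<mu> i" "0 < ?\<mu> j" by auto
    show "cinner (\<phi> i) (\<phi> j) = (if i = j then 1 else 0)"
    proof (cases "?\<mu> i = ?\<mu> j")
      case True
      have "\<phi> i = \<phi> j \<longleftrightarrow> i = j"
        using inj_on_eq_iff[OF b(1)[OF ij(2)], of i j] True by (simp add: \<phi>_def)
      thus ?thesis using b(3)[OF ij(2)] True by (auto simp: \<phi>_def orthonormal_on_def)
    next
      case False
      with singular_eigenspaces_orthogonal[OF T \<phi>[OF ij(1)] \<phi>[OF ij(2)] ij] show ?thesis by auto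
    qed
  qed
  with \<phi> show ?thesis by blast
qed

end

section \<open>Singular values and the images of a basis\<close>

text \<open>Jensen's inequality for the concave function \<open>x powr q\<close> and weights of total mass at most
  \<open>1\<close>. Each term is bounded by the tangent of this function at \<open>s = \<Sum>j\<in>J. a j * w j\<close>.\<close>

lemma sum_powr_weighted_le:
  fixes a w :: "'j \<Rightarrow> real"
  assumes J: "finite J" and w: "\<And>j. j \<in> J \<Longrightarrow> 0 \<le> w j" "(\<Sum>j\<in>J. w j) \<le> 1"
    and a: "\<And>j. j \<in> J \<Longrightarrow> 0 < a j" and q: "0 < q" "q \<le> 1" and t: "(\<Sum>j\<in>J. a j * w j) \<le> t"
  shows "(\<Sum>j\<in>J. a j powr q * w j) \<le> t powr q"
proof -
  define s where "s = (\<Sum>j\<in>J. a j * w j)"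
  have aw: "0 \<le> a j * w j" if "j \<in> J" for j using w(1)[OF that] a[OF that] by simp
  show ?thesis
  proof (cases "s = 0")
    case True
    have "\<forall>j\<in>J. a j * w j = 0"
      using sum_nonneg_eq_0_iff[OF J, of "\<lambda>j. a j * w j"] aw True by (auto simp: s_def)
    hence "(\<Sum>j\<in>J. a j powr q * w j) = 0"
      using a by (intro sum.neutral) force
    thus ?thesis by simp
  next
    case False
    hence s: "0 < s" using sum_nonneg[of J "\<lambda>j. a j * w j"] aw by (auto simp: s_def less_le)
    have tangent: "a j powr q \<le> s powr q * (q * (a j / s) + (1 - q))" if "j \<in> J" for j
    proof -
      have "(a j / s) powr q * 1 powr (1 - q) \<le> q * (a j / s) + (1 - q) * 1"
        using q a[OF that] s by (intro Youngs_inequality_0) auto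
      thus ?thesis using s a[OF that] by (simp add: powr_divide field_simps)
    qed
    have "(\<Sum>j\<in>J. a j powr q * w j) \<le> (\<Sum>j\<in>J. s powr q * (q * (a j / s) + (1 - q)) * w j)"
      by (intro sum_mono mult_right_mono tangent w)
    also have "\<dots> = s powr q * (q / s * (\<Sum>j\<in>J. a j * w j) + (1 - q) * (\<Sum>j\<in>J. w j))"
      by (simp add: sum_distrib_left sum.distrib[symmetric] algebra_simps)
    also have "\<dots> = s powr q * (q + (1 - q) * (\<Sum>j\<in>J. w j))"
      using s by (simp flip: s_def)
    also have "\<dots> \<le> s powr q * (q + (1 - q) * 1)"
      using w(2) q by (intro mult_left_mono add_left_mono) auto
    also have "\<dots> = s powr q" by simp
    also have "\<dots> \<le> t powr q" using s t q by (intro powr_mono2) (auto simp: s_def)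
    finally show ?thesis .
  qed
qed

text \<open>The layer-cake formula writes \<open>min (b k) m\<close> as the integral of the indicator of \<open>s < b k\<close>
  over \<open>0 < s < m\<close>; summing over \<open>k\<close> produces the distribution function.\<close>

lemma sum_min_le_of_distribution:
  fixes b :: "'k \<Rightarrow> real"
  assumes F: "finite F" and b: "\<And>k. k \<in> F \<Longrightarrow> 0 \<le> b k" and q: "q < 1" and m: "0 \<le> m"
    and card: "\<And>s. 0 < s \<Longrightarrow> real (card {k\<in>F. s < b k}) \<le> D * s powr (- q)"
  shows "(\<Sum>k\<in>F. min (b k) m) \<le> D * m powr (1 - q) / (1 - q)"
proof -
  \<comment> \<open>As \<open>0 powr (- q) = 0\<close>, the indicators have to vanish at \<open>s = 0\<close>.\<close>
  define h where "h k s = (if s \<in> {0<..<min (b k) m} then 1 else 0 :: real)" for k s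
  have "(h k has_integral min (b k) m) {0..m}" if "k \<in> F" for k
  proof -
    have "((\<lambda>_. 1 :: real) has_integral min (b k) m) {0<..<min (b k) m}"
      using has_integral_const_real[of "1::real" 0 "min (b k) m"] b[OF that] m
      by (simp add: has_integral_Icc_iff_Ioo)
    thus ?thesis unfolding h_def by (subst has_integral_restrict) (auto simp del: has_integral_restrict)
  qed
  hence "((\<lambda>s. \<Sum>k\<in>F. h k s) has_integral (\<Sum>k\<in>F. min (b k) m)) {0..m}"
    by (intro has_integral_sum F)
  moreover have "((\<lambda>s. D * s powr (- q)) has_integral D * (m powr (- q + 1) / (- q + 1))) {0..m}"
    using q m by (intro has_integral_mult_right has_integral_powr_from_0) auto
  moreover have "(\<Sum>k\<in>F. h k s) \<le> D * s powr (- q)" if "s \<in> {0..m}" for s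
  proof (cases "s = 0")
    case False
    hence s: "0 < s" using that by simp
    have "(\<Sum>k\<in>F. h k s) \<le> (\<Sum>k\<in>F. if s < b k then 1 else 0)"
      by (intro sum_mono) (auto simp: h_def)
    also have "\<dots> = real (card {k\<in>F. s < b k})"
      using F by (simp add: sum.If_cases Int_def)
    finally show ?thesis using card[OF s] by simp
  qed (simp add: h_def)
  ultimately have "(\<Sum>k\<in>F. min (b k) m) \<le> D * (m powr (- q + 1) / (- q + 1))"
    by (rule has_integral_le)
  thus ?thesis by simp
qed

lemma sum_min_square_le_of_distribution:
  fixes h :: "'k \<Rightarrow> real"
  assumes F: "finite F" and h: "\<And>k. 0 \<le> h k" and p: "p < 2" and m: "0 \<le> m"
    and fin: "\<And>s. 0 < s \<Longrightarrow> finite {k. s < h k}"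
    and card: "\<And>s. 0 < s \<Longrightarrow> real (card {k. s < h k}) \<le> D * s powr (- p)"
  shows "(\<Sum>k\<in>F. min ((h k)\<^sup>2) m) \<le> D * m powr (1 - p / 2) / (1 - p / 2)"
proof (rule sum_min_le_of_distribution[OF F])
  fix s :: real assume s: "0 < s"
  have iff: "s < (h k)\<^sup>2 \<longleftrightarrow> sqrt s < h k" for k
    using real_sqrt_less_iff[of s "(h k)\<^sup>2"] h by simp
  have "real (card {k\<in>F. s < (h k)\<^sup>2}) \<le> real (card {k. sqrt s < h k})"
    unfolding iff using fin[of "sqrt s"] s by (intro of_nat_mono card_mono) auto
  also have "\<dots> \<le> D * sqrt s powr (- p)" using card[of "sqrt s"] s by simp
  also have "sqrt s powr (- p) = s powr (- (p / 2))"
    using s by (simp add: powr_half_sqrt[symmetric] powr_powr)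
  finally show "real (card {k\<in>F. s < (h k)\<^sup>2}) \<le> D * s powr (- (p / 2))" .
qed (use p m in auto)

context hilbert_schmidt
begin

text \<open>With \<open>w j = |\<langle>e k, \<phi> j\<rangle>|\<^sup>2\<close> the weights have total mass at most \<open>1\<close> and
  \<open>\<Sum>j. \<mu>\<^sub>j\<^sup>2 w j \<le> \<parallel>T (e k)\<parallel>\<^sup>2\<close>, so Jensen's inequality bounds \<open>\<Sum>j. \<mu>\<^sub>j\<^sup>p w j\<close> by
  \<open>\<parallel>T (e k)\<parallel>\<^sup>p\<close>; then sum over \<open>k\<close>.\<close>

lemma sum_singular_values_powr_le:
  assumes p: "0 < p" "p \<le> 2" and sm: "(\<lambda>k. norm (T (e k)) powr p) summable_on UNIV"
  shows "(\<Sum>j<n. singular_value T j powr p) \<le> (\<Sum>\<^sub>\<infinity>k. norm (T (e k)) powr p)"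
proof -
  let ?\<mu> = "singular_value T"
  obtain \<phi> where \<phi>: "orthonormal_on {j. 0 < ?\<mu> j} \<phi>"
    "\<And>j. 0 < ?\<mu> j \<Longrightarrow> \<phi> j \<in> singular_eigenspace T (?\<mu> j)" using singular_vectors_exist by blast
  define J where "J = {j\<in>{..<n}. 0 < ?\<mu> j}"
  have J: "finite J" by (simp add: J_def)
  have on: "orthonormal_on J \<phi>" using \<phi>(1) by (rule orthonormal_on_subset) (auto simp: J_def)
  have "(\<Sum>j<n. ?\<mu> j powr p) = (\<Sum>j\<in>J. ?\<mu> j powr p)"
    using enumerates_nonneg[OF enumerates_singular_value] unfolding J_def
    by (intro sum.mono_neutral_right) (auto simp: less_le)
  also have "\<dots> \<le> (\<Sum>\<^sub>\<infinity>k. norm (T (e k)) powr p)"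
  proof (rule sum_le_infsum_over_basis[OF e J _ sm])
    show "norm (\<phi> j) = 1" if "j \<in> J" for j by (rule norm_orthonormal[OF on that])
    fix k
    define w where "w j = (cmod (cinner (e k) (\<phi> j)))\<^sup>2" for j
    have pw: "x powr p = (x\<^sup>2) powr (p / 2)" if "0 \<le> x" for x :: real
      using that by (cases "x = 0") (auto simp: powr_powr simp flip: powr_numeral)
    have "(\<Sum>j\<in>J. ?\<mu> j powr p * w j) = (\<Sum>j\<in>J. (?\<mu> j)\<^sup>2 powr (p / 2) * w j)"
      by (intro sum.cong) (auto simp: J_def pw)
    also have "\<dots> \<le> ((norm (T (e k)))\<^sup>2) powr (p / 2)"
    proof (rule sum_powr_weighted_le[OF J])
      have "norm (e k) = 1" using e by (auto simp: orthonormal_basis_def intro: norm_orthonormal)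
      thus "(\<Sum>j\<in>J. w j) \<le> 1" using bessel[OF J on, of "e k"] by (simp add: w_def)
      show "(\<Sum>j\<in>J. (?\<mu> j)\<^sup>2 * w j) \<le> (norm (T (e k)))\<^sup>2"
        unfolding w_def using \<phi>(2) by (intro bessel_singular[OF T J on]) (auto simp: J_def)
    qed (use p in \<open>auto simp: w_def J_def\<close>)
    also have "\<dots> = norm (T (e k)) powr p" by (simp add: pw)
    finally show "(\<Sum>j\<in>J. ?\<mu> j powr p * (cmod (cinner (e k) (\<phi> j)))\<^sup>2) \<le> norm (T (e k)) powr p"
      by (simp add: w_def)
  qed
  finally show ?thesis .
qed

lemma schatten_norm_le:
  assumes p: "0 < p" "p \<le> 2" and sm: "(\<lambda>k. norm (T (e k)) powr p) summable_on UNIV"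
  shows "summable (\<lambda>j. singular_value T j powr p)"
    and "schatten_norm p T \<le> (\<Sum>\<^sub>\<infinity>k. norm (T (e k)) powr p) powr (1 / p)"
proof -
  note le = sum_singular_values_powr_le[OF assms]
  show *: "summable (\<lambda>j. singular_value T j powr p)"
    by (rule bounded_imp_summable[OF _ le[of "Suc _", unfolded lessThan_Suc_atMost]]) simp
  have "(\<Sum>j. singular_value T j powr p) \<le> (\<Sum>\<^sub>\<infinity>k. norm (T (e k)) powr p)"
    using * le by (intro suminf_le_const)
  thus "schatten_norm p T \<le> (\<Sum>\<^sub>\<infinity>k. norm (T (e k)) powr p) powr (1 / p)"
    unfolding schatten_norm_def using p by (intro powr_mono2 suminf_nonneg *) auto
qed

text \<open>Here Jensen's inequality is replaced by the concave function \<open>min x m\<close> with \<open>m = \<mu>\<^sub>N\<^sup>2\<close>: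
  each of \<open>\<mu>\<^sub>0, \<dots>, \<mu>\<^sub>N\<close> contributes \<open>m\<close>, whence \<open>(N + 1) m \<le> \<Sum>k. min (\<parallel>T (e k)\<parallel>\<^sup>2) m\<close>. The
  layer-cake bound for the right-hand side gives exactly the constant \<open>2 / (2 - p)\<close>.\<close>

lemma singular_value_le_of_distribution:
  assumes p: "0 < p" "p < 2" and D: "0 \<le> D"
    and fin: "\<And>s. 0 < s \<Longrightarrow> finite {k. s < norm (T (e k))}"
    and card: "\<And>s. 0 < s \<Longrightarrow> real (card {k. s < norm (T (e k))}) \<le> D * s powr (- p)"
  shows "real (N + 1) * singular_value T N powr p \<le> 2 / (2 - p) * D"
proof (cases "singular_value T N = 0")
  case True
  thus ?thesis using p D by simp
next
  case False
  let ?\<mu> = "singular_value T" and ?b = "\<lambda>k. (norm (T (e k)))\<^sup>2"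
  have \<mu>N: "0 < ?\<mu> N"
    using False enumerates_nonneg[OF enumerates_singular_value, of N] by simp
  have \<mu>: "?\<mu> N \<le> ?\<mu> j" if "j \<le> N" for j
    using enumerates_singular_value that by (auto simp: enumerates_def decseq_def)
  define m where "m = (?\<mu> N)\<^sup>2"
  have m: "0 < m" using \<mu>N by (simp add: m_def)
  obtain \<phi> where \<phi>: "orthonormal_on {j. 0 < ?\<mu> j} \<phi>"
    "\<And>j. 0 < ?\<mu> j \<Longrightarrow> \<phi> j \<in> singular_eigenspace T (?\<mu> j)" using singular_vectors_exist by blast
  define J where "J = {..N}"
  have pos: "0 < ?\<mu> j" if "j \<in> J" for j using \<mu>[of j] \<mu>N that by (auto simp: J_def)
  have J: "finite J" by (simp add: J_def)
  have on: "orthonormal_on J \<phi>" using \<phi>(1) by (rule orthonormal_on_subset) (use pos in auto)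
  have sm: "(\<lambda>k. min (?b k) m) summable_on UNIV"
    using HS by (rule summable_on_comparison_test) (use m in auto)
  have "real (N + 1) * m = (\<Sum>j\<in>J. m)" by (simp add: J_def)
  also have "\<dots> \<le> (\<Sum>\<^sub>\<infinity>k. min (?b k) m)"
  proof (rule sum_le_infsum_over_basis[OF e J _ sm])
    show "norm (\<phi> j) = 1" if "j \<in> J" for j by (rule norm_orthonormal[OF on that])
    fix k
    let ?w = "\<lambda>j. (cmod (cinner (e k) (\<phi> j)))\<^sup>2"
    have "(\<Sum>j\<in>J. m * ?w j) \<le> (\<Sum>j\<in>J. (?\<mu> j)\<^sup>2 * ?w j)"
      unfolding m_def using \<mu> \<mu>N by (intro sum_mono mult_right_mono power_mono) (auto simp: J_def)
    also have "\<dots> \<le> ?b k"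
      using \<phi>(2) pos by (intro bessel_singular[OF T J on]) auto
    finally have 1: "(\<Sum>j\<in>J. m * ?w j) \<le> ?b k" .
    have "norm (e k) = 1" using e by (auto simp: orthonormal_basis_def intro: norm_orthonormal)
    hence "m * (\<Sum>j\<in>J. ?w j) \<le> m * 1"
      using bessel[OF J on, of "e k"] m by (intro mult_left_mono) auto
    with 1 show "(\<Sum>j\<in>J. m * ?w j) \<le> min (?b k) m" by (simp add: sum_distrib_left)
  qed
  also have "\<dots> \<le> D * m powr (1 - p / 2) / (1 - p / 2)"
  proof (rule infsum_le_finite_sums[OF sm])
    fix F :: "'k set" assume F: "finite F"
    show "(\<Sum>k\<in>F. min (?b k) m) \<le> D * m powr (1 - p / 2) / (1 - p / 2)"
      using p m fin card by (intro sum_min_square_le_of_distribution[OF F]) simp_all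
  qed
  finally have *: "real (N + 1) * m \<le> D * m powr (1 - p / 2) / (1 - p / 2)" .
  have "real (N + 1) * m powr (p / 2) * m powr (1 - p / 2) \<le> 2 / (2 - p) * D * m powr (1 - p / 2)"
    using * m p by (simp add: mult.assoc flip: powr_add) (simp add: field_simps)
  hence "real (N + 1) * m powr (p / 2) \<le> 2 / (2 - p) * D"
    using m by (simp only: mult_le_cancel_right_pos powr_gt_zero)
  moreover have "m powr (p / 2) = ?\<mu> N powr p"
    using \<mu>N by (simp add: m_def powr_powr flip: powr_numeral)
  ultimately show ?thesis by simp
qed

end

section \<open>Weyl operators on the torus\<close>

definition pairing :: "int ^ 'n \<Rightarrow> real ^ 'n::finite \<Rightarrow> real" where
  "pairing k x = (\<Sum>j\<in>UNIV. of_int (k $ j) * x $ j)"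

lemma pairing_add_left: "pairing (k + l) x = pairing k x + pairing l x"
  by (simp add: pairing_def algebra_simps sum.distrib)

lemma pairing_add_right: "pairing k (x + y) = pairing k x + pairing k y"
  by (simp add: pairing_def algebra_simps sum.distrib)

lemma pairing_minus_left: "pairing (- k) x = - pairing k x"
  by (simp add: pairing_def sum_negf)

lemma pairing_minus_right: "pairing k (- x) = - pairing k x"
  by (simp add: pairing_def sum_negf)

lemma pairing_zero [simp]: "pairing 0 x = 0" "pairing k 0 = 0"
  by (simp_all add: pairing_def)

lemma pairing_axis: "pairing k (axis j t) = of_int (k $ j) * t" "pairing (axis j m) x = of_int m * x $ j"
  by (simp_all add: pairing_def axis_def if_distrib if_distribR cong: if_cong)

lemma cis_pairing_lattice: "cis (pairing k (lattice_vec m)) = 1"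
proof -
  have "pairing k (lattice_vec m) = 2 * pi * of_int (\<Sum>j\<in>UNIV. k $ j * m $ j)"
    by (simp add: pairing_def lattice_vec_def sum_distrib_left mult_ac)
  moreover have "cis (2 * pi * of_int (\<Sum>j\<in>UNIV. k $ j * m $ j)) = 1"
    by (rule cis_multiple_2pi) (rule Ints_of_int)
  ultimately show ?thesis by simp
qed

lemma nn_integral_torus_modulate_shift:
  fixes f :: "real ^ 'n::finite \<Rightarrow> complex"
  assumes f: "torus_sq_integrable f"
  shows "(\<integral>\<^sup>+x. ennreal ((cmod (cis (c x) * f (x + a)))\<^sup>2) \<partial>torus_measure)
    = (\<integral>\<^sup>+x. ennreal ((cmod (f x))\<^sup>2) \<partial>torus_measure)"
proof -
  have [measurable]: "f \<in> borel_measurable borel" and per: "torus_periodic f"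
    using f by (auto simp: torus_sq_integrable_def)
  show ?thesis
    unfolding norm_mult norm_cis mult_1
    by (rule nn_integral_torus_shift) (use torus_periodic_comp[OF per] in auto)
qed

lemma borel_measurable_cis_pairing [measurable]:
  "(\<lambda>x :: real ^ 'n::finite. cis (pairing k x)) \<in> borel_measurable borel"
  unfolding pairing_def by (intro borel_measurable_continuous_onI continuous_intros)

lemma torus_sq_integrable_weyl:
  fixes f :: "real ^ 'n::finite \<Rightarrow> complex"
  assumes f: "torus_sq_integrable f"
  shows "torus_sq_integrable (\<lambda>x. cis (pairing k x) * f (x + a))"
proof -
  have [measurable]: "f \<in> borel_measurable borel" and per: "torus_periodic f"
    and int: "integrable torus_measure (\<lambda>x. (cmod (f x))\<^sup>2)"
    using f by (auto simp: torus_sq_integrable_def)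
  have "integrable torus_measure (\<lambda>x. (cmod (cis (pairing k x) * f (x + a)))\<^sup>2)"
    using int nn_integral_torus_modulate_shift[OF f, of "pairing k" a]
    by (simp add: integrable_iff_bounded)
  moreover have "torus_periodic (\<lambda>x. cis (pairing k x) * f (x + a))"
    using torus_periodic_shift[OF per, of a]
    by (simp add: torus_periodic_def pairing_add_right cis_pairing_lattice flip: cis_mult)
  ultimately show ?thesis
    by (auto simp: torus_sq_integrable_def)
qed

lift_definition weyl :: "int ^ 'n \<Rightarrow> real ^ 'n \<Rightarrow> 'n::finite torus_operator" is
  "\<lambda>k a \<xi> x. cis (pairing k x) * \<xi> (x + a)"
proof -
  fix k :: "int ^ 'n" and a and f g :: "real ^ 'n \<Rightarrow> complex"
  assume fg: "torus_L2_rel f g"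
  have [measurable]: "f \<in> borel_measurable borel" "g \<in> borel_measurable borel"
    using fg by (auto simp: torus_L2_rel_def torus_sq_integrable_def)
  have "AE x in torus_measure. f (x + a) = g (x + a)"
    by (rule AE_torus_shift[where P = "\<lambda>x. f x = g x"])
       (use fg in \<open>auto simp: torus_L2_rel_def torus_sq_integrable_def torus_periodic_def\<close>)
  thus "torus_L2_rel (\<lambda>x. cis (pairing k x) * f (x + a)) (\<lambda>x. cis (pairing k x) * g (x + a))"
    using fg by (auto simp: torus_L2_rel_def torus_sq_integrable_weyl)
qed

lemma weyl_add: "weyl k a (\<xi> + \<eta>) = weyl k a \<xi> + weyl k a \<eta>"
  by transfer
     (auto simp: torus_L2_rel_def ring_distribs intro!: torus_sq_integrable_add torus_sq_integrable_weyl)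

lemma weyl_scaleC: "weyl k a (c *\<^sub>C \<xi>) = c *\<^sub>C weyl k a \<xi>"
  by transfer
     (auto simp: torus_L2_rel_def mult.left_commute intro!: torus_sq_integrable_cmult torus_sq_integrable_weyl)

lemma weyl_compose: "weyl k a (weyl l b \<xi>) = cis (pairing l a) *\<^sub>C weyl (k + l) (a + b) \<xi>"
proof transfer
  fix k l :: "int ^ 'a" and a b :: "real ^ 'a" and f :: "real ^ 'a \<Rightarrow> complex"
  assume "torus_L2_rel f f"
  hence f: "torus_sq_integrable f" by (simp add: torus_L2_rel_def)
  have eq: "(\<lambda>x. cis (pairing k x) * (cis (pairing l (x + a)) * f (x + a + b)))
      = (\<lambda>x. cis (pairing l a) * (cis (pairing (k + l) x) * f (x + (a + b))))"
    by (auto simp: pairing_add_left pairing_add_right mult_ac add_ac simp flip: cis_mult)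
  show "torus_L2_rel (\<lambda>x. cis (pairing k x) * (cis (pairing l (x + a)) * f (x + a + b)))
      (\<lambda>x. cis (pairing l a) * (cis (pairing (k + l) x) * f (x + (a + b))))"
    unfolding eq using torus_sq_integrable_cmult[OF torus_sq_integrable_weyl[OF f]]
    by (simp add: torus_L2_rel_def)
qed

lemma weyl_0 [simp]: "weyl 0 0 \<xi> = \<xi>"
  by transfer (simp add: torus_L2_rel_def)

lemma norm_weyl: "norm (weyl k a \<xi>) = norm \<xi>"
proof -
  obtain f where f: "torus_sq_integrable f" "\<xi> = abs_torus_L2 f" by (rule torus_L2_cases)
  have [measurable]: "f \<in> borel_measurable borel" using f(1) by (simp add: torus_sq_integrable_def)
  have "weyl k a \<xi> = abs_torus_L2 (\<lambda>x. cis (pairing k x) * f (x + a))"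
    using f by (simp add: weyl.abs_eq torus_L2_rel_def)
  hence "(norm (weyl k a \<xi>))\<^sup>2 = (LINT x|torus_measure. (cmod (cis (pairing k x) * f (x + a)))\<^sup>2)"
    using norm_abs_torus_L2[OF torus_sq_integrable_weyl[OF f(1)]] by simp
  also have "\<dots> = (LINT x|torus_measure. (cmod (f x))\<^sup>2)"
    by (subst (1 2) integral_eq_nn_integral)
       (simp_all only: nn_integral_torus_modulate_shift[OF f(1)], simp_all, measurable)
  also have "\<dots> = (norm \<xi>)\<^sup>2"
    using norm_abs_torus_L2[OF f(1)] f(2) by simp
  finally show ?thesis by (simp add: power2_eq_iff_nonneg)
qed

lemma bounded_clinear_weyl: "bounded_clinear (weyl k a)"
proof (rule bounded_clinearI)
  show "bounded_linear (weyl k a)"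
    by (rule bounded_linear_intro[where K = 1]) (simp_all add: weyl_add scaleR_scaleC weyl_scaleC norm_weyl)
qed (rule weyl_scaleC)

text \<open>Polarization.\<close>

lemma isometry_cinner:
  fixes T :: "'a::complex_inner \<Rightarrow> 'b::complex_inner"
  assumes add: "\<And>v w. T (v + w) = T v + T w" and scale: "\<And>c v. T (c *\<^sub>C v) = c *\<^sub>C T v"
    and norm: "\<And>v. norm (T v) = norm v"
  shows "cinner (T v) (T w) = cinner v w"
proof -
  have inner: "inner (T v) (T w) = inner v w" for v w
    by (simp add: dot_norm norm flip: add)
  show ?thesis
    using inner[of v w] inner[of v "\<i> *\<^sub>C w"]
    by (intro complex_eqI) (simp_all add: Im_cinner_eq scale flip: inner_eq_Re_cinner)
qed

lemma cinner_weyl: "cinner (weyl k a \<xi>) (weyl k a \<eta>) = cinner \<xi> \<eta>"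
  by (rule isometry_cinner) (simp_all add: weyl_add weyl_scaleC norm_weyl)

definition torus_char :: "int ^ 'n \<Rightarrow> 'n::finite torus_L2" where
  "torus_char k = weyl k 0 torus_one"

lemma weyl_one: "weyl k a torus_one = torus_char k"
  unfolding torus_char_def
  by transfer (auto simp: torus_L2_rel_def intro!: torus_sq_integrable_weyl[of "\<lambda>_. 1", simplified] torus_sq_integrable_const)

lemma torus_char_0: "torus_char 0 = torus_one"
  by (simp add: torus_char_def)

lemma weyl_torus_char: "weyl k a (torus_char l) = cis (pairing l a) *\<^sub>C torus_char (k + l)"
  by (simp add: torus_char_def weyl_compose) (simp add: weyl_one)

lemma norm_torus_one: "norm (torus_one :: 'n::finite torus_L2) = 1"
proof -
  have tot: "emeasure (torus_measure :: (real ^ 'n) measure) (space torus_measure) = 1"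
    using emeasure_torus_cube[where 'n = 'n] unfolding torus_measure_def
    by (subst emeasure_uniform_measure) (auto simp: less_top[symmetric] intro!: ennreal_divide_self)
  have "torus_one = (abs_torus_L2 (\<lambda>_. 1) :: 'n torus_L2)"
    by (simp add: torus_one_def)
  hence "(norm (torus_one :: 'n torus_L2))\<^sup>2 = 1"
    using norm_abs_torus_L2[OF torus_sq_integrable_const[of 1, where 'n = 'n]] tot
    by (simp add: measure_def)
  hence "(norm (torus_one :: 'n torus_L2))\<^sup>2 = 1\<^sup>2" by simp
  thus ?thesis by (simp only: power2_eq_iff_nonneg norm_ge_zero zero_le_one)
qed

text \<open>For \<open>k j \<noteq> 0\<close>, translation by \<open>\<pi> / k j\<close> in the direction \<open>j\<close> is unitary, fixes the constant
  function \<open>1\<close> and changes the sign of the character \<open>k\<close>, so these two are orthogonal.\<close>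

lemma cinner_torus_char_one:
  assumes "k \<noteq> 0"
  shows "cinner (torus_char k) torus_one = 0"
proof -
  obtain j where j: "k $ j \<noteq> 0" using assms by (auto simp: vec_eq_iff)
  define a where "a = axis j (pi / of_int (k $ j))"
  have "cinner (torus_char k) torus_one = cinner (weyl 0 a (torus_char k)) (weyl 0 a torus_one)"
    by (rule cinner_weyl[symmetric])
  also have "weyl 0 a torus_one = torus_one"
    by (simp add: weyl_one torus_char_0)
  also have "weyl 0 a (torus_char k) = - 1 *\<^sub>C torus_char k"
    using j by (simp add: weyl_torus_char a_def pairing_axis)
  also have "cinner (- 1 *\<^sub>C torus_char k) torus_one = - cinner (torus_char k) torus_one"
    by (simp only: cinner_scaleC_left) simp
  finally show ?thesis by simp
qed

lemma orthonormal_torus_char: "orthonormal_on UNIV torus_char"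
  unfolding orthonormal_on_def
proof (intro ballI)
  fix k l :: "int ^ 'a"
  have "cinner (torus_char k) (torus_char l)
      = cinner (weyl (- l) 0 (torus_char k)) (weyl (- l) 0 (torus_char l))"
    by (rule cinner_weyl[symmetric])
  also have "\<dots> = cinner (torus_char (k - l)) torus_one"
    by (simp add: weyl_torus_char torus_char_0)
  also have "\<dots> = (if k = l then 1 else 0)"
    using cinner_torus_char_one[of "k - l"]
    by (auto simp: cinner_self norm_torus_one torus_char_0)
  finally show "cinner (torus_char k) (torus_char l) = (if k = l then 1 else 0)" .
qed


section \<open>The unitaries generating the noncommutative torus\<close>

text \<open>The Weyl operators form a projective representation of \<open>\<int>\<^sup>n \<times> \<real>\<^sup>n\<close>. Working modulo phases makes
  products and inverses additive in \<open>(k, a)\<close>, so that \<open>U\<^sup>k\<close> can be computed.\<close>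

definition weyl_up_to_phase :: "int ^ 'n \<Rightarrow> real ^ 'n \<Rightarrow> 'n::finite torus_operator \<Rightarrow> bool" where
  "weyl_up_to_phase k a T \<longleftrightarrow> (\<exists>t. T = (\<lambda>\<xi>. cis t *\<^sub>C weyl k a \<xi>))"

lemma weyl_up_to_phase_weyl: "weyl_up_to_phase k a (weyl k a)"
  unfolding weyl_up_to_phase_def by (intro exI[of _ 0]) auto

lemma weyl_up_to_phase_id: "weyl_up_to_phase 0 0 id"
  unfolding weyl_up_to_phase_def by (intro exI[of _ 0]) auto

lemma weyl_up_to_phase_compose:
  assumes "weyl_up_to_phase k a S" "weyl_up_to_phase l b T"
  shows "weyl_up_to_phase (k + l) (a + b) (S \<circ> T)"
proof -
  obtain s t where "S = (\<lambda>\<xi>. cis s *\<^sub>C weyl k a \<xi>)" "T = (\<lambda>\<xi>. cis t *\<^sub>C weyl l b \<xi>)"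
    using assms by (auto simp: weyl_up_to_phase_def)
  hence "S \<circ> T = (\<lambda>\<xi>. cis (s + t + pairing l a) *\<^sub>C weyl (k + l) (a + b) \<xi>)"
    by (intro ext) (simp add: weyl_scaleC weyl_compose scaleC_scaleC cis_mult add.assoc)
  thus ?thesis unfolding weyl_up_to_phase_def by blast
qed

lemma weyl_up_to_phase_inv:
  assumes "weyl_up_to_phase k a T"
  shows "weyl_up_to_phase (- k) (- a) (inv T)" "T (inv T \<xi>) = \<xi>"
proof -
  obtain t where T: "T = (\<lambda>\<xi>. cis t *\<^sub>C weyl k a \<xi>)" using assms by (auto simp: weyl_up_to_phase_def)
  define S where "S = (\<lambda>\<xi>. cis (pairing k a - t) *\<^sub>C weyl (- k) (- a) \<xi>)"
  have TS: "T (S \<xi>) = \<xi>" "S (T \<xi>) = \<xi>" for \<xi>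
    by (simp_all add: T S_def weyl_scaleC weyl_compose scaleC_scaleC cis_mult pairing_minus_left
        pairing_minus_right)
  have inv: "inv T = S"
    by (rule inv_equality) (simp_all add: TS)
  show "weyl_up_to_phase (- k) (- a) (inv T)" "T (inv T \<xi>) = \<xi>"
    unfolding inv TS by (auto simp: weyl_up_to_phase_def S_def)
qed

lemma weyl_up_to_phase_funpow:
  assumes "weyl_up_to_phase k a T"
  shows "weyl_up_to_phase (int n *s k) (real n *\<^sub>R a) (T ^^ n)"
proof (induction n)
  case 0
  have "int 0 *s k = 0" by (simp add: vec_eq_iff)
  thus ?case using weyl_up_to_phase_id by (simp add: id_def)
next
  case (Suc n)
  have eq: "k + int n *s k = int (Suc n) *s k" "a + real n *\<^sub>R a = real (Suc n) *\<^sub>R a"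
    by (simp_all add: vec_eq_iff algebra_simps)
  show ?case
    using weyl_up_to_phase_compose[OF assms Suc] unfolding eq funpow.simps .
qed

lemma bounded_clinear_weyl_up_to_phase: "weyl_up_to_phase k a T \<Longrightarrow> bounded_clinear T"
  using bounded_clinear_scaleC[OF bounded_clinear_weyl] by (auto simp: weyl_up_to_phase_def)

lemma norm_weyl_up_to_phase: "weyl_up_to_phase k a T \<Longrightarrow> norm (T \<xi>) = norm \<xi>"
  by (auto simp: weyl_up_to_phase_def norm_scaleC norm_weyl)

lemma cadjoint_weyl_up_to_phase:
  assumes T: "weyl_up_to_phase k a T"
  shows "cadjoint T = inv T"
proof (rule cadjoint_eqI)
  fix v w
  note T' = bounded_clinearD[OF bounded_clinear_weyl_up_to_phase[OF T]]
  have "cinner (T v) w = cinner (T v) (T (inv T w))" by (simp add: weyl_up_to_phase_inv(2)[OF T])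
  also have "\<dots> = cinner v (inv T w)"
    by (rule isometry_cinner) (simp_all add: T' norm_weyl_up_to_phase[OF T])
  finally show "cinner (T v) w = cinner v (inv T w)" .
qed

definition nc_shift :: "'n square_matrix \<Rightarrow> int ^ 'n \<Rightarrow> real ^ 'n::finite" where
  "nc_shift \<theta> k = (\<Sum>j\<in>UNIV. (pi * of_int (k $ j)) *\<^sub>R column j \<theta>)"

lemma nc_shift_minus: "nc_shift \<theta> (- k) = - nc_shift \<theta> k"
  by (simp add: nc_shift_def sum_negf)

lemma nc_U_eq_weyl: "nc_U \<theta> j = weyl (axis j 1) (pi *\<^sub>R column j \<theta>)"
proof
  fix \<xi> :: "'a torus_L2"
  show "nc_U \<theta> j \<xi> = weyl (axis j 1) (pi *\<^sub>R column j \<theta>) \<xi>"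
    by transfer (auto simp: torus_L2_rel_def pairing_axis intro!: torus_sq_integrable_shift_mult)
qed

lemma weyl_up_to_phase_zpower:
  "weyl_up_to_phase (axis j m) ((pi * of_int m) *\<^sub>R column j \<theta>) (op_zpower (nc_U \<theta> j) m)"
proof -
  have U: "weyl_up_to_phase (axis j 1) (pi *\<^sub>R column j \<theta>) (nc_U \<theta> j)"
    unfolding nc_U_eq_weyl by (rule weyl_up_to_phase_weyl)
  show ?thesis
  proof (cases "0 \<le> m")
    case True
    have "int (nat m) *s axis j 1 = (axis j m :: int ^ 'a)"
      using True by (auto simp: vec_eq_iff axis_def)
    with weyl_up_to_phase_funpow[OF U, of "nat m"] True show ?thesis
      by (simp add: op_zpower_def mult.commute)
  next
    case False
    have "int (nat (- m)) *s - axis j 1 = (axis j m :: int ^ 'a)"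
      using False by (auto simp: vec_eq_iff axis_def)
    with weyl_up_to_phase_funpow[OF weyl_up_to_phase_inv(1)[OF U], of "nat (- m)"] False show ?thesis
      by (simp add: op_zpower_def mult.commute)
  qed
qed

lemma weyl_up_to_phase_Upow: "weyl_up_to_phase k (nc_shift \<theta> k) (nc_Upow \<theta> k)"
proof -
  have "weyl_up_to_phase (\<Sum>j\<in>set js. axis j (k $ j)) (\<Sum>j\<in>set js. (pi * of_int (k $ j)) *\<^sub>R column j \<theta>)
      (foldr (\<lambda>j T. op_zpower (nc_U \<theta> j) (k $ j) \<circ> T) js id)" if "distinct js" for js
    using that
  proof (induction js)
    case (Cons j js)
    with weyl_up_to_phase_compose[OF weyl_up_to_phase_zpower[of j "k $ j" \<theta>] Cons.IH]
    show ?case by (simp add: o_def)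
  qed (use weyl_up_to_phase_id in \<open>simp add: id_def\<close>)
  from this[of "sorted_list_of_set UNIV"]
  have "weyl_up_to_phase (\<Sum>j\<in>UNIV. axis j (k $ j)) (nc_shift \<theta> k) (nc_Upow \<theta> k)"
    by (simp add: nc_Upow_def nc_shift_def)
  moreover have "(\<Sum>j\<in>UNIV. axis j (k $ j)) = k"
    by (simp add: axis_def vec_eq_iff)
  ultimately show ?thesis by simp
qed

text \<open>Reversing the sign of the translation turns the left regular representation of the
  noncommutative torus into the right regular one, so \<open>V\<close> commutes with the \<open>U\<^sub>j\<close>. This is where the
  antisymmetry of \<open>\<theta>\<close> enters.\<close>

definition nc_V :: "'n square_matrix \<Rightarrow> int ^ 'n \<Rightarrow> 'n::finite torus_operator" where
  "nc_V \<theta> k = weyl k (- nc_shift \<theta> k)"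

lemma pairing_nc_shift:
  assumes "transpose \<theta> = - \<theta>"
  shows "pairing k (nc_shift \<theta> l) = - pairing l (nc_shift \<theta> k)"
proof -
  have \<theta>: "\<theta> $ i $ j = - \<theta> $ j $ i" for i j
    using arg_cong[OF assms, of "\<lambda>A. A $ j $ i"] by (simp add: transpose_def)
  have expand: "pairing k (nc_shift \<theta> l)
      = (\<Sum>i\<in>UNIV. \<Sum>j\<in>UNIV. of_int (k $ i) * (pi * of_int (l $ j) * \<theta> $ i $ j))" for k l
    by (simp add: pairing_def nc_shift_def column_def sum_distrib_left)
  have "pairing k (nc_shift \<theta> l)
      = (\<Sum>j\<in>UNIV. \<Sum>i\<in>UNIV. of_int (k $ i) * (pi * of_int (l $ j) * \<theta> $ i $ j))"
    unfolding expand by (rule sum.swap)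
  also have "\<dots> = (\<Sum>j\<in>UNIV. \<Sum>i\<in>UNIV. - (of_int (l $ j) * (pi * of_int (k $ i) * \<theta> $ j $ i)))"
    by (intro sum.cong refl) (subst \<theta>, simp)
  also have "\<dots> = - pairing l (nc_shift \<theta> k)"
    unfolding expand by (simp add: sum_negf)
  finally show ?thesis .
qed

lemma nc_V_commutes_Upow:
  assumes \<theta>: "transpose \<theta> = - \<theta>" and T: "weyl_up_to_phase l (nc_shift \<theta> l) T"
  shows "nc_V \<theta> k (T \<xi>) = T (nc_V \<theta> k \<xi>)"
proof -
  obtain t where "T = (\<lambda>\<xi>. cis t *\<^sub>C weyl l (nc_shift \<theta> l) \<xi>)"
    using T by (auto simp: weyl_up_to_phase_def)
  thus ?thesis
    by (simp add: nc_V_def weyl_scaleC weyl_compose scaleC_scaleC cis_mult pairing_minus_right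
        pairing_nc_shift[OF \<theta>, of l k] add.commute)
qed

section \<open>Von Neumann algebras and orthogonal projections\<close>

lemma commutantD:
  assumes "T \<in> commutant S"
  shows "bounded_clinear T" "\<And>A v. A \<in> S \<Longrightarrow> T (A v) = A (T v)"
  using assms by (auto simp: commutant_def fun_eq_iff)

lemma commutantI:
  assumes "bounded_clinear T" "\<And>A v. A \<in> S \<Longrightarrow> T (A v) = A (T v)"
  shows "T \<in> commutant S"
  using assms by (auto simp: commutant_def fun_eq_iff)

text \<open>Commutants of self-adjoint sets are the source of von Neumann algebras: to see that all
  elements of \<open>nc_Linf \<theta>\<close> commute with an operator, it suffices to check this for the \<open>U\<^sub>j\<close>.\<close>

lemma von_neumann_algebra_commutant:
  fixes S :: "('a::complex_hilbert \<Rightarrow> 'a) set"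
  assumes S: "\<And>A. A \<in> S \<Longrightarrow> bounded_clinear A" "\<And>A. A \<in> S \<Longrightarrow> cadjoint A \<in> S"
  shows "von_neumann_algebra (commutant S)"
  unfolding von_neumann_algebra_def
proof (intro conjI ballI)
  fix T assume T: "T \<in> commutant S"
  note bT = commutantD(1)[OF T]
  show "bounded_clinear T" by fact
  show "cadjoint T \<in> commutant S"
  proof (rule commutantI[OF bounded_clinear_cadjoint[OF bT]])
    fix A v assume A: "A \<in> S"
    note bA = S(1)[OF A]
    show "cadjoint T (A v) = A (cadjoint T v)"
    proof (rule cinner_eqI)
      fix z
      have "cinner z (cadjoint T (A v)) = cinner (T z) (A v)"
        by (rule cinner_cadjoint[OF bT, symmetric])
      also have "\<dots> = cinner (cadjoint A (T z)) v"
        by (rule cinner_cadjoint_left[OF bA, symmetric])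
      also have "\<dots> = cinner (T (cadjoint A z)) v"
        by (simp only: commutantD(2)[OF T S(2)[OF A]])
      also have "\<dots> = cinner (cadjoint A z) (cadjoint T v)" by (rule cinner_cadjoint[OF bT])
      also have "\<dots> = cinner z (A (cadjoint T v))" by (rule cinner_cadjoint_left[OF bA])
      finally show "cinner z (cadjoint T (A v)) = cinner z (A (cadjoint T v))" .
    qed
  qed
next
  show "commutant (commutant (commutant S)) = commutant S"
  proof
    show "commutant (commutant (commutant S)) \<subseteq> commutant S"
    proof
      fix T assume T: "T \<in> commutant (commutant (commutant S))"
      have "A \<in> commutant (commutant S)" if "A \<in> S" for A
        using S(1)[OF that] commutantD(2)[OF _ that] by (intro commutantI) simp_all
      with T show "T \<in> commutant S" by (intro commutantI) (simp_all add: commutantD)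
    qed
    show "commutant S \<subseteq> commutant (commutant (commutant S))"
    proof
      fix T assume T: "T \<in> commutant S"
      show "T \<in> commutant (commutant (commutant S))"
        by (intro commutantI commutantD(1)[OF T]) (simp add: commutantD(2)[OF _ T])
    qed
  qed
qed

lemma closure_complex_subspace:
  fixes V :: "'a::complex_inner set"
  assumes V: "complex_vs.subspace V"
  shows "complex_vs.subspace (closure V)"
proof (rule complex_vs.subspaceI)
  show "0 \<in> closure V"
    using complex_vs.subspace_0[OF V] closure_subset by blast
  fix x y and c :: complex assume x: "x \<in> closure V"
  then obtain X where X: "\<And>n. X n \<in> V" "X \<longlonglongrightarrow> x" unfolding closure_sequential by blast
  show "x + y \<in> closure V" if "y \<in> closure V"
  proof -
    from that obtain Y where Y: "\<And>n. Y n \<in> V" "Y \<longlonglongrightarrow> y" unfolding closure_sequential by blast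
    show ?thesis unfolding closure_sequential
      using complex_vs.subspace_add[OF V X(1) Y(1)] tendsto_add[OF X(2) Y(2)]
      by (intro exI[of _ "\<lambda>n. X n + Y n"]) simp
  qed
  show "c *\<^sub>C x \<in> closure V" unfolding closure_sequential
    using complex_vs.subspace_scale[OF V X(1)] bounded_linear.tendsto[OF bounded_linear_scaleC X(2)]
    by (intro exI[of _ "\<lambda>n. c *\<^sub>C X n"]) simp
qed

lemma image_closure_span_subset:
  assumes T: "bounded_clinear T" and gen: "\<And>x. x \<in> S \<Longrightarrow> T x \<in> closure (complex_vs.span S')"
    and v: "v \<in> closure (complex_vs.span S)"
  shows "T v \<in> closure (complex_vs.span S')"
proof -
  let ?K = "closure (complex_vs.span S')"
  have K: "complex_vs.subspace ?K" by (intro closure_complex_subspace complex_vs.subspace_span)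
  have "complex_vs.span S \<subseteq> T -` ?K"
  proof (rule complex_vs.span_minimal)
    show "complex_vs.subspace (T -` ?K)"
      by (rule complex_vs.subspaceI)
         (simp_all add: bounded_clinearD[OF T] complex_vs.subspace_0[OF K]
           complex_vs.subspace_add[OF K] complex_vs.subspace_scale[OF K])
  qed (use gen in auto)
  moreover have "closed (T -` ?K)"
    using T by (intro closed_vimage linear_continuous_on bounded_clinearD) auto
  ultimately have "closure (complex_vs.span S) \<subseteq> T -` ?K" by (rule closure_minimal)
  with v show ?thesis by auto
qed

definition proj :: "'a::complex_hilbert set \<Rightarrow> 'a \<Rightarrow> 'a" where
  "proj K v = (SOME w. w \<in> K \<and> (\<forall>u\<in>K. cinner (v - w) u = 0))"

context
  fixes K :: "'a::complex_hilbert set"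
  assumes K: "closed K" "complex_vs.subspace K"
begin

lemma proj: "proj K v \<in> K \<and> (\<forall>u\<in>K. cinner (v - proj K v) u = 0)"
proof -
  have sub: "subspace K"
    by (rule real_vector.subspaceI)
       (simp_all add: complex_vs.subspace_0[OF K(2)] complex_vs.subspace_add[OF K(2)]
         complex_vs.subspace_scale[OF K(2)] scaleR_scaleC)
  obtain w where w: "w \<in> K" "\<And>u. u \<in> K \<Longrightarrow> inner v u = inner w u"
    using riesz_on_closed_subspace[OF bounded_linear_inner_right K(1) sub] by metis
  have "cinner (v - w) u = 0" if u: "u \<in> K" for u
    using w(2)[OF u] w(2)[OF complex_vs.subspace_scale[OF K(2) u]]
    by (intro complex_eqI) (simp_all add: Im_cinner_eq inner_diff_left flip: inner_eq_Re_cinner)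
  with w(1) have "\<exists>w. w \<in> K \<and> (\<forall>u\<in>K. cinner (v - w) u = 0)" by blast
  thus ?thesis unfolding proj_def by (rule someI_ex)
qed

lemma proj_eqI:
  assumes w: "w \<in> K" "\<And>u. u \<in> K \<Longrightarrow> cinner (v - w) u = 0"
  shows "proj K v = w"
proof -
  have "w - proj K v \<in> K" using proj w(1) K(2) by (blast intro: complex_vs.subspace_diff)
  hence "cinner (v - proj K v) (w - proj K v) - cinner (v - w) (w - proj K v) = 0"
    using proj w(2) by simp
  hence "cinner (w - proj K v) (w - proj K v) = 0"
    by (simp flip: cinner_diff_left)
  thus ?thesis by simp
qed

lemma proj_id: "v \<in> K \<Longrightarrow> proj K v = v"
  by (rule proj_eqI) auto

lemma bounded_clinear_proj: "bounded_clinear (proj K)"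
proof (rule bounded_clinearI)
  show scale: "proj K (c *\<^sub>C v) = c *\<^sub>C proj K v" for c v
    using proj[of v] K(2)
    by (intro proj_eqI)
       (auto simp: complex_vs.subspace_scale cinner_scaleC_left simp flip: complex_vs.scale_right_diff_distrib)
  show "bounded_linear (proj K)"
  proof (rule bounded_linear_intro[where K = 1])
    show "proj K (v + w) = proj K v + proj K w" for v w
    proof (rule proj_eqI)
      show "proj K v + proj K w \<in> K" using proj K(2) by (blast intro: complex_vs.subspace_add)
      fix u assume "u \<in> K"
      hence "cinner (v - proj K v) u + cinner (w - proj K w) u = 0" using proj by simp
      thus "cinner (v + w - (proj K v + proj K w)) u = 0"
        by (simp add: cinner_add_left cinner_diff_left algebra_simps)
    qed
    show "proj K (r *\<^sub>R v) = r *\<^sub>R proj K v" for r v by (simp add: scaleR_scaleC scale)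
    show "norm (proj K v) \<le> norm v * 1" for v
    proof -
      have "cinner (v - proj K v) (proj K v) = 0" using proj by blast
      hence "cinner v (proj K v) = of_real ((norm (proj K v))\<^sup>2)"
        by (simp add: cinner_diff_left cinner_self)
      hence "norm (proj K v) * norm (proj K v) \<le> norm v * norm (proj K v)"
        using cmod_cinner_le[of v "proj K v"] by (simp add: norm_power power2_eq_square norm_mult)
      thus ?thesis by (cases "proj K v = 0") auto
    qed
  qed
qed

lemma cadjoint_proj: "cadjoint (proj K) = proj K"
proof (rule cadjoint_eqI)
  fix v w
  have "cinner (v - proj K v) (proj K w) = 0" using proj by blast
  hence 1: "cinner v (proj K w) = cinner (proj K v) (proj K w)" by (simp add: cinner_diff_left)
  have "cinner (w - proj K w) (proj K v) = 0" using proj by blast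
  hence "cinner (proj K v) (w - proj K w) = 0" by (subst cinner_commute) simp
  hence "cinner (proj K v) w = cinner (proj K v) (proj K w)" by (simp add: cinner_diff_right)
  with 1 show "cinner (proj K v) w = cinner v (proj K w)" by simp
qed

lemma proj_commutes:
  assumes T: "bounded_clinear T"
    and inv: "\<And>u. u \<in> K \<Longrightarrow> T u \<in> K" "\<And>u. u \<in> K \<Longrightarrow> cadjoint T u \<in> K"
  shows "proj K (T v) = T (proj K v)"
proof (rule proj_eqI)
  show "T (proj K v) \<in> K" using proj inv(1) by blast
  fix u assume u: "u \<in> K"
  have "cinner (T v - T (proj K v)) u = cinner (v - proj K v) (cadjoint T u)"
    by (simp add: cinner_cadjoint[OF T] flip: bounded_clinearD(3)[OF T])
  also have "\<dots> = 0" using proj inv(2)[OF u] by blast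
  finally show "cinner (T v - T (proj K v)) u = 0" .
qed

end


section \<open>The von Neumann algebra of the noncommutative torus\<close>

lemma bounded_clinear_nc_U: "bounded_clinear (nc_U \<theta> j)"
  unfolding nc_U_eq_weyl by (rule bounded_clinear_weyl)

lemma nc_Linf_commutes:
  assumes S: "\<And>A. A \<in> S \<Longrightarrow> bounded_clinear A" "\<And>A. A \<in> S \<Longrightarrow> cadjoint A \<in> S"
    and com: "\<And>A j v. A \<in> S \<Longrightarrow> nc_U \<theta> j (A v) = A (nc_U \<theta> j v)"
    and u: "u \<in> nc_Linf \<theta>" and A: "A \<in> S"
  shows "u (A v) = A (u v)"
proof -
  have "nc_U \<theta> j \<in> commutant S" for j
    by (intro commutantI bounded_clinear_nc_U com)
  hence "range (nc_U \<theta>) \<subseteq> commutant S" by blast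
  with von_neumann_algebra_commutant[OF S] u have "u \<in> commutant S"
    unfolding nc_Linf_def by blast
  thus ?thesis using A by (rule commutantD)
qed

lemma nc_Linf_bounded:
  assumes "u \<in> nc_Linf \<theta>"
  shows "bounded_clinear u"
proof -
  have "von_neumann_algebra (commutant {} :: ('a torus_L2 \<Rightarrow> 'a torus_L2) set)"
    by (rule von_neumann_algebra_commutant) auto
  moreover have "range (nc_U \<theta>) \<subseteq> commutant {}" using bounded_clinear_nc_U by (auto intro: commutantI)
  ultimately have "u \<in> commutant {}" using assms unfolding nc_Linf_def by blast
  thus ?thesis by (rule commutantD)
qed

text \<open>Membership by the bicommutant property, which each of the algebras in the intersection has.\<close>

lemma nc_LinfI:
  assumes T: "bounded_clinear T"
    and com: "\<And>A. bounded_clinear A \<Longrightarrow> (\<And>B v. B \<in> nc_Linf \<theta> \<Longrightarrow> A (B v) = B (A v)) \<Longrightarrow>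
      (\<And>v. T (A v) = A (T v))"
  shows "T \<in> nc_Linf \<theta>"
  unfolding nc_Linf_def
proof (intro InterI)
  fix M assume M: "M \<in> {M. von_neumann_algebra M \<and> range (nc_U \<theta>) \<subseteq> M}"
  hence sub: "nc_Linf \<theta> \<subseteq> M" unfolding nc_Linf_def by blast
  have "T \<in> commutant (commutant M)"
  proof (rule commutantI[OF T])
    fix A v assume A: "A \<in> commutant M"
    show "T (A v) = A (T v)"
      by (rule com) (use A sub in \<open>auto simp: commutantD\<close>)
  qed
  thus "T \<in> M" using M by (simp add: von_neumann_algebra_def)
qed

lemma nc_U_Linf: "nc_U \<theta> j \<in> nc_Linf \<theta>"
  unfolding nc_Linf_def by blast

lemma cadjoint_Linf: "u \<in> nc_Linf \<theta> \<Longrightarrow> cadjoint u \<in> nc_Linf \<theta>"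
  unfolding nc_Linf_def von_neumann_algebra_def by blast

lemma id_Linf: "id \<in> nc_Linf \<theta>"
  by (rule nc_LinfI) (auto intro: bounded_clinear_id)

lemma compose_Linf: "u \<in> nc_Linf \<theta> \<Longrightarrow> v \<in> nc_Linf \<theta> \<Longrightarrow> u \<circ> v \<in> nc_Linf \<theta>"
  by (rule nc_LinfI) (simp_all add: bounded_clinear_compose nc_Linf_bounded)

lemma add_Linf: "u \<in> nc_Linf \<theta> \<Longrightarrow> v \<in> nc_Linf \<theta> \<Longrightarrow> (\<lambda>\<xi>. u \<xi> + v \<xi>) \<in> nc_Linf \<theta>"
  by (rule nc_LinfI) (simp_all add: bounded_clinear_add nc_Linf_bounded bounded_clinearD)

lemma scaleC_Linf: "u \<in> nc_Linf \<theta> \<Longrightarrow> (\<lambda>\<xi>. c *\<^sub>C u \<xi>) \<in> nc_Linf \<theta>"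
  by (rule nc_LinfI) (simp_all add: bounded_clinear_scaleC nc_Linf_bounded bounded_clinearD)

lemma funpow_Linf: "u \<in> nc_Linf \<theta> \<Longrightarrow> u ^^ n \<in> nc_Linf \<theta>"
  by (induction n) (simp_all add: id_Linf[unfolded id_def] compose_Linf id_Linf)

lemma nc_Upow_Linf: "nc_Upow \<theta> k \<in> nc_Linf \<theta>"
proof -
  have "inv (nc_U \<theta> j) \<in> nc_Linf \<theta>" for j
    using cadjoint_Linf[OF nc_U_Linf[of \<theta> j]]
    by (simp add: nc_U_eq_weyl cadjoint_weyl_up_to_phase[OF weyl_up_to_phase_weyl])
  hence zp: "op_zpower (nc_U \<theta> j) m \<in> nc_Linf \<theta>" for j m
    by (simp add: op_zpower_def funpow_Linf nc_U_Linf)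
  have "foldr (\<lambda>j T. op_zpower (nc_U \<theta> j) (k $ j) \<circ> T) js id \<in> nc_Linf \<theta>" for js
  proof (induction js)
    case Nil
    show ?case using id_Linf[of \<theta>] by (simp add: id_def)
  next
    case (Cons j js)
    show ?case using compose_Linf[OF zp Cons.IH] by (simp add: o_def)
  qed
  thus ?thesis by (simp add: nc_Upow_def)
qed

text \<open>Up to phases the characters are the vectors \<open>U\<^sup>k 1\<close>, so this is the cyclic subspace generated by
  \<open>1\<close>. It is invariant under the \<open>U\<^sub>j\<close> and their adjoints.\<close>

definition char_space :: "'n::finite torus_L2 set" where
  "char_space = closure (complex_vs.span (range torus_char))"

lemma closed_char_space: "closed char_space"
  by (simp add: char_space_def)

lemma subspace_char_space: "complex_vs.subspace char_space"
  unfolding char_space_def by (intro closure_complex_subspace complex_vs.subspace_span)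

lemma torus_char_in_char_space: "torus_char k \<in> char_space"
  unfolding char_space_def by (intro subsetD[OF closure_subset] complex_vs.span_base rangeI)

lemma torus_one_in_char_space: "torus_one \<in> char_space"
  using torus_char_in_char_space[of 0] by (simp add: torus_char_0)

lemma weyl_up_to_phase_char:
  assumes "weyl_up_to_phase k a T"
  shows "\<exists>t. T (torus_char l) = cis t *\<^sub>C torus_char (k + l)"
  using assms by (auto simp: weyl_up_to_phase_def weyl_torus_char scaleC_scaleC cis_mult)

lemma weyl_up_to_phase_char_space:
  fixes T :: "'n::finite torus_operator"
  assumes T: "weyl_up_to_phase k a T" and v: "v \<in> char_space"
  shows "T v \<in> char_space"
  unfolding char_space_def
proof (rule image_closure_span_subset[OF bounded_clinear_weyl_up_to_phase[OF T] _ v[unfolded char_space_def]])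
  fix x :: "'n torus_L2" assume "x \<in> range torus_char"
  then obtain l where "x = torus_char l" by blast
  with weyl_up_to_phase_char[OF T, of l] obtain t where "T x = cis t *\<^sub>C torus_char (k + l)" by blast
  thus "T x \<in> closure (complex_vs.span (range torus_char))"
    using complex_vs.subspace_scale[OF subspace_char_space torus_char_in_char_space]
    by (simp add: char_space_def)
qed

text \<open>A vector \<open>u 1\<close> is fixed by the projection onto \<open>char_space\<close>, because \<open>1\<close> is and the
  projection commutes with \<open>u\<close>.\<close>

lemma Linf_one_in_char_space:
  assumes u: "u \<in> nc_Linf \<theta>"
  shows "u torus_one \<in> char_space"
proof -
  let ?P = "proj (char_space :: 'a torus_L2 set)"
  note K = closed_char_space subspace_char_space
  have "u (?P v) = ?P (u v)" for v
  proof (rule nc_Linf_commutes[where S = "{?P}"])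
    show "nc_U \<theta> j (A v) = A (nc_U \<theta> j v)" if "A \<in> {?P}" for A j v
    proof -
      have W: "weyl_up_to_phase (axis j 1) (pi *\<^sub>R column j \<theta>) (nc_U \<theta> j)"
        unfolding nc_U_eq_weyl by (rule weyl_up_to_phase_weyl)
      have "?P (nc_U \<theta> j v) = nc_U \<theta> j (?P v)"
      proof (rule proj_commutes[OF K bounded_clinear_nc_U])
        show "nc_U \<theta> j u \<in> char_space" if "u \<in> char_space" for u
          by (rule weyl_up_to_phase_char_space[OF W that])
        show "cadjoint (nc_U \<theta> j) u \<in> char_space" if "u \<in> char_space" for u
          unfolding cadjoint_weyl_up_to_phase[OF W]
          by (rule weyl_up_to_phase_char_space[OF weyl_up_to_phase_inv(1)[OF W] that])
      qed
      thus ?thesis using that by simp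
    qed
  qed (use u in \<open>auto simp: bounded_clinear_proj[OF K] cadjoint_proj[OF K]\<close>)
  from this[of torus_one] have "u torus_one = ?P (u torus_one)"
    by (simp add: proj_id[OF K torus_one_in_char_space])
  also have "\<dots> \<in> char_space" using proj[OF K] by blast
  finally show ?thesis .
qed

lemma Linf_commutes_nc_V:
  assumes \<theta>: "transpose \<theta> = - \<theta>" and u: "u \<in> nc_Linf \<theta>"
  shows "u (nc_V \<theta> k v) = nc_V \<theta> k (u v)"
proof -
  define S where "S = {T. \<exists>k. weyl_up_to_phase k (- nc_shift \<theta> k) T}"
  have V: "nc_V \<theta> k \<in> S" for k
    unfolding S_def nc_V_def using weyl_up_to_phase_weyl by blast
  show ?thesis
  proof (rule nc_Linf_commutes[OF _ _ _ u V])
    show "bounded_clinear A" if "A \<in> S" for A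
      using that bounded_clinear_weyl_up_to_phase by (auto simp: S_def)
    show "cadjoint A \<in> S" if "A \<in> S" for A
    proof -
      from that obtain k where k: "weyl_up_to_phase k (- nc_shift \<theta> k) A" by (auto simp: S_def)
      from weyl_up_to_phase_inv(1)[OF k] show ?thesis
        unfolding cadjoint_weyl_up_to_phase[OF k] S_def nc_shift_minus[symmetric] by blast
    qed
    fix A :: "'a torus_operator" and j v assume "A \<in> S"
    then obtain k t where A: "A = (\<lambda>\<xi>. cis t *\<^sub>C nc_V \<theta> k \<xi>)"
      by (auto simp: S_def weyl_up_to_phase_def nc_V_def)
    have sh: "nc_shift \<theta> (axis j 1) = pi *\<^sub>R column j \<theta>"
      by (simp add: nc_shift_def axis_def if_distrib if_distribR cong: if_cong)
    have "weyl_up_to_phase (axis j 1) (nc_shift \<theta> (axis j 1)) (nc_U \<theta> j)"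
      unfolding nc_U_eq_weyl sh by (rule weyl_up_to_phase_weyl)
    from nc_V_commutes_Upow[OF \<theta> this] show "nc_U \<theta> j (A v) = A (nc_U \<theta> j v)"
      by (simp add: A bounded_clinearD(4)[OF bounded_clinear_nc_U])
  qed
qed

text \<open>If \<open>d 1 = 0\<close> then also \<open>d V\<^sub>k 1 = V\<^sub>k d 1 = 0\<close>, so \<open>d\<close> vanishes on all characters.\<close>

lemma Linf_zero_on_char_space:
  assumes \<theta>: "transpose \<theta> = - \<theta>" and d: "d \<in> nc_Linf \<theta>" "d torus_one = 0" and v: "v \<in> char_space"
  shows "d v = 0"
proof -
  note bd = nc_Linf_bounded[OF d(1)]
  have "d (torus_char k) = 0" for k
  proof -
    have "torus_char k = nc_V \<theta> k torus_one" by (simp add: nc_V_def weyl_one)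
    thus ?thesis using Linf_commutes_nc_V[OF \<theta> d(1), of k torus_one] d(2)
      by (simp add: nc_V_def bounded_clinearD(5)[OF bounded_clinear_weyl])
  qed
  moreover have "v \<in> closure (complex_vs.span (range torus_char))"
    using v by (simp add: char_space_def)
  moreover have "closure (complex_vs.span {}) = {0 :: 'a torus_L2}" by simp
  ultimately have "d v \<in> closure (complex_vs.span {})"
    by (intro image_closure_span_subset[OF bd, of "range torus_char" "{}" v]) auto
  thus ?thesis by simp
qed

section \<open>The noncommutative \<open>L\<^sub>2\<close>-space\<close>

lemma bounded_clinear_eq_on_dense:
  fixes S T :: "'a::complex_inner \<Rightarrow> 'b::complex_inner"
  assumes S: "bounded_clinear S" and T: "bounded_clinear T"
    and eq: "\<And>v. v \<in> X \<Longrightarrow> S v = T v" and X: "closure X = UNIV"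
  shows "S = T"
proof
  fix v
  have "closed {v. S v = T v}"
    by (intro closed_Collect_eq linear_continuous_on bounded_clinearD S T)
  with eq have "closure X \<subseteq> {v. S v = T v}" by (intro closure_minimal) auto
  thus "S v = T v" using X by auto
qed

lemma isometry_extension:
  fixes F :: "'a::complex_hilbert \<Rightarrow> 'b::complex_hilbert"
  assumes X: "complex_vs.subspace X" "closure X = UNIV"
    and add: "\<And>v w. v \<in> X \<Longrightarrow> w \<in> X \<Longrightarrow> F (v + w) = F v + F w"
    and scale: "\<And>c v. v \<in> X \<Longrightarrow> F (c *\<^sub>C v) = c *\<^sub>C F v"
    and norm: "\<And>v. v \<in> X \<Longrightarrow> norm (F v) = norm v"
  shows "\<exists>R. bounded_clinear R \<and> (\<forall>v\<in>X. R v = F v) \<and> (\<forall>v. norm (R v) = norm v)"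
proof -
  have diff: "F (v - w) = F v - F w" if "v \<in> X" "w \<in> X" for v w
    using add[of "v - w" w] complex_vs.subspace_diff[OF X(1) that] that by simp
  have "uniformly_continuous_on X F"
    unfolding uniformly_continuous_on_def
    using norm[OF complex_vs.subspace_diff[OF X(1)]] by (auto simp: dist_norm simp flip: diff)
  then obtain R where R: "uniformly_continuous_on (closure X) R" "\<And>v. v \<in> X \<Longrightarrow> F v = R v"
    by (rule uniformly_continuous_on_extension_on_closure) (rule that)
  have cont: "continuous_on UNIV R"
    using uniformly_continuous_imp_continuous[OF R(1)] X(2) by simp
  have lim: "(\<lambda>n. R (V n)) \<longlonglongrightarrow> R v" if "V \<longlonglongrightarrow> v" for V v
    using continuous_on_tendsto_compose[OF cont that] by simp
  have seq: "\<exists>V. (\<forall>n. V n \<in> X) \<and> V \<longlonglongrightarrow> v" for v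
    using X(2) closure_sequential[of v X] by simp
  have nR: "norm (R v) = norm v" for v
  proof -
    obtain V where V: "\<And>n. V n \<in> X" "V \<longlonglongrightarrow> v" using seq by blast
    have "(\<lambda>n. norm (R (V n))) \<longlonglongrightarrow> norm (R v)" by (intro tendsto_norm lim V)
    moreover have "(\<lambda>n. norm (R (V n))) \<longlonglongrightarrow> norm v"
      using tendsto_norm[OF V(2)] by (simp add: norm V(1) flip: R(2))
    ultimately show ?thesis by (rule LIMSEQ_unique)
  qed
  have sR: "R (c *\<^sub>C v) = c *\<^sub>C R v" for c v
  proof -
    obtain V where V: "\<And>n. V n \<in> X" "V \<longlonglongrightarrow> v" using seq by blast
    have eq: "R (c *\<^sub>C V n) = c *\<^sub>C R (V n)" for n
      using scale[OF V(1)] by (simp add: R(2) V(1) complex_vs.subspace_scale[OF X(1)])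
    have "(\<lambda>n. R (c *\<^sub>C V n)) \<longlonglongrightarrow> R (c *\<^sub>C v)"
      by (intro lim bounded_linear.tendsto[OF bounded_linear_scaleC] V)
    moreover have "(\<lambda>n. R (c *\<^sub>C V n)) \<longlonglongrightarrow> c *\<^sub>C R v"
      unfolding eq by (intro bounded_linear.tendsto[OF bounded_linear_scaleC] lim V)
    ultimately show ?thesis by (rule LIMSEQ_unique)
  qed
  have aR: "R (v + w) = R v + R w" for v w
  proof -
    obtain V where V: "\<And>n. V n \<in> X" "V \<longlonglongrightarrow> v" using seq by blast
    obtain W where W: "\<And>n. W n \<in> X" "W \<longlonglongrightarrow> w" using seq by blast
    have eq: "R (V n + W n) = R (V n) + R (W n)" for n
      using add[OF V(1) W(1)] by (simp add: R(2) V(1) W(1) complex_vs.subspace_add[OF X(1)])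
    have "(\<lambda>n. R (V n + W n)) \<longlonglongrightarrow> R (v + w)" by (intro lim tendsto_add V W)
    moreover have "(\<lambda>n. R (V n + W n)) \<longlonglongrightarrow> R v + R w"
      unfolding eq by (intro tendsto_add lim V W)
    ultimately show ?thesis by (rule LIMSEQ_unique)
  qed
  have "bounded_clinear R"
    by (intro bounded_clinearI bounded_linear_intro[where K = 1]) (simp_all add: aR sR nR scaleR_scaleC)
  with nR R(2)[symmetric] show ?thesis by (intro exI[of _ R]) simp
qed

lemma operator_series:
  fixes T :: "'k \<Rightarrow> 'a::complex_hilbert \<Rightarrow> 'a"
  assumes T: "\<And>k. bounded_clinear (T k)" "\<And>k v. norm (T k v) = norm v"
    and c: "(\<lambda>k. cmod (c k)) summable_on UNIV"
  shows "(\<lambda>k. c k *\<^sub>C T k v) summable_on UNIV"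
    and "bounded_clinear (\<lambda>v. \<Sum>\<^sub>\<infinity>k. c k *\<^sub>C T k v)"
proof -
  have abs: "(\<lambda>k. norm (c k *\<^sub>C T k v)) summable_on UNIV" for v
    using summable_on_cmult_left[OF c, of "norm v"] by (simp add: norm_scaleC T)
  show sm: "(\<lambda>k. c k *\<^sub>C T k v) summable_on UNIV" for v
    by (rule abs_summable_summable[OF abs])
  show "bounded_clinear (\<lambda>v. \<Sum>\<^sub>\<infinity>k. c k *\<^sub>C T k v)"
  proof (rule bounded_clinearI)
    show scale: "(\<Sum>\<^sub>\<infinity>k. c k *\<^sub>C T k (d *\<^sub>C v)) = d *\<^sub>C (\<Sum>\<^sub>\<infinity>k. c k *\<^sub>C T k v)" for d v
      using infsumI[OF has_sum_bounded_linear[OF bounded_linear_scaleC has_sum_infsum[OF sm]], of d v]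
      by (simp add: bounded_clinearD(4)[OF T(1)] scaleC_scaleC mult.commute)
    show "bounded_linear (\<lambda>v. \<Sum>\<^sub>\<infinity>k. c k *\<^sub>C T k v)"
    proof (rule bounded_linear_intro)
      show "(\<Sum>\<^sub>\<infinity>k. c k *\<^sub>C T k (v + w)) = (\<Sum>\<^sub>\<infinity>k. c k *\<^sub>C T k v) + (\<Sum>\<^sub>\<infinity>k. c k *\<^sub>C T k w)" for v w
        using infsum_add[OF sm sm, of v w] by (simp add: bounded_clinearD(2)[OF T(1)] scaleC_add_right)
      show "(\<Sum>\<^sub>\<infinity>k. c k *\<^sub>C T k (r *\<^sub>R v)) = r *\<^sub>R (\<Sum>\<^sub>\<infinity>k. c k *\<^sub>C T k v)" for r v
        by (simp add: scaleR_scaleC scale)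
      show "norm (\<Sum>\<^sub>\<infinity>k. c k *\<^sub>C T k v) \<le> norm v * (\<Sum>\<^sub>\<infinity>k. cmod (c k))" for v
        using norm_infsum_bound[OF abs, of v]
        by (simp add: norm_scaleC T infsum_cmult_left' mult.commute[of "norm v"])
    qed
  qed
qed

locale nc_L2 =
  fixes \<theta> :: "'n::{finite, linorder} square_matrix"
    and \<iota> :: "'n torus_operator \<Rightarrow> 'h::complex_hilbert"
  assumes antisymmetric: "transpose \<theta> = - \<theta>" and completion: "nc_L2_completion \<theta> \<iota>"
begin

abbreviation Linf :: "'n torus_operator set" where "Linf \<equiv> nc_Linf \<theta>"

abbreviation U :: "(int, 'n) vec \<Rightarrow> 'n torus_operator" where "U \<equiv> nc_Upow \<theta>"

definition fourier_basis :: "(int, 'n) vec \<Rightarrow> 'h" where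
  "fourier_basis k = \<iota> (U k)"

lemma \<iota>_add: "u \<in> Linf \<Longrightarrow> v \<in> Linf \<Longrightarrow> \<iota> (\<lambda>\<xi>. u \<xi> + v \<xi>) = \<iota> u + \<iota> v"
  using completion by (simp add: nc_L2_completion_def)

lemma \<iota>_scaleC: "u \<in> Linf \<Longrightarrow> \<iota> (\<lambda>\<xi>. c *\<^sub>C u \<xi>) = c *\<^sub>C \<iota> u"
  using completion by (simp add: nc_L2_completion_def)

lemma \<iota>_dense: "closure (\<iota> ` Linf) = UNIV"
  using completion by (simp add: nc_L2_completion_def)

lemma diff_Linf:
  assumes "u \<in> Linf" "v \<in> Linf"
  shows "(\<lambda>\<xi>. u \<xi> - v \<xi>) \<in> Linf"
proof -
  have "(\<lambda>\<xi>. u \<xi> + (- 1) *\<^sub>C v \<xi>) \<in> Linf" by (intro add_Linf scaleC_Linf assms)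
  thus ?thesis by simp
qed

lemma \<iota>_diff:
  assumes "u \<in> Linf" "v \<in> Linf"
  shows "\<iota> (\<lambda>\<xi>. u \<xi> - v \<xi>) = \<iota> u - \<iota> v"
  using \<iota>_add[OF diff_Linf[OF assms] assms(2)] by (simp add: algebra_simps)

text \<open>Everything about the abstract space is reduced to the vectors \<open>u\<^sup>* 1\<close> of the concrete space on
  which the algebra acts.\<close>

lemma cinner_\<iota>:
  assumes "u \<in> Linf" "v \<in> Linf"
  shows "cinner (\<iota> u) (\<iota> v) = cinner (cadjoint v torus_one) (cadjoint u torus_one)"
proof -
  have "cinner (\<iota> u) (\<iota> v) = nc_trace (u \<circ> cadjoint v)"
    using completion assms by (simp add: nc_L2_completion_def)
  also have "\<dots> = cinner (u (cadjoint v torus_one)) torus_one" by (simp add: nc_trace_def)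
  also have "\<dots> = cinner (cadjoint v torus_one) (cadjoint u torus_one)"
    by (rule cinner_cadjoint[OF nc_Linf_bounded[OF assms(1)]])
  finally show ?thesis .
qed

lemma norm_\<iota>:
  assumes "u \<in> Linf"
  shows "norm (\<iota> u) = norm (cadjoint u torus_one)"
proof -
  have "complex_of_real ((norm (\<iota> u))\<^sup>2) = of_real ((norm (cadjoint u torus_one))\<^sup>2)"
    unfolding cinner_self[symmetric] by (rule cinner_\<iota>[OF assms assms])
  hence "(norm (\<iota> u))\<^sup>2 = (norm (cadjoint u torus_one))\<^sup>2" by (simp only: of_real_eq_iff)
  thus ?thesis by (simp add: power2_eq_iff_nonneg)
qed

lemma cadjoint_add_apply:
  assumes "u \<in> Linf" "v \<in> Linf"
  shows "cadjoint (\<lambda>\<xi>. u \<xi> + v \<xi>) = (\<lambda>\<xi>. cadjoint u \<xi> + cadjoint v \<xi>)"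
  by (rule cadjoint_eqI)
     (simp add: cinner_add_left cinner_add_right cinner_cadjoint[OF nc_Linf_bounded[OF assms(1)]]
       cinner_cadjoint[OF nc_Linf_bounded[OF assms(2)]])

lemma cadjoint_diff_apply:
  assumes "u \<in> Linf" "v \<in> Linf"
  shows "cadjoint (\<lambda>\<xi>. u \<xi> - v \<xi>) = (\<lambda>\<xi>. cadjoint u \<xi> - cadjoint v \<xi>)"
  by (rule cadjoint_eqI)
     (simp add: cinner_diff_left cinner_diff_right cinner_cadjoint[OF nc_Linf_bounded[OF assms(1)]]
       cinner_cadjoint[OF nc_Linf_bounded[OF assms(2)]])

lemma cadjoint_scaleC_apply:
  assumes "u \<in> Linf"
  shows "cadjoint (\<lambda>\<xi>. c *\<^sub>C u \<xi>) = (\<lambda>\<xi>. cnj c *\<^sub>C cadjoint u \<xi>)"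
  by (rule cadjoint_eqI)
     (simp add: cinner_scaleC_left cinner_scaleC_right cinner_cadjoint[OF nc_Linf_bounded[OF assms]])

lemma cadjoint_U_one: "\<exists>t. cadjoint (U k) torus_one = cis t *\<^sub>C torus_char (- k)"
proof -
  note W = weyl_up_to_phase_Upow[of k \<theta>]
  from weyl_up_to_phase_char[OF weyl_up_to_phase_inv(1)[OF W], of 0]
  show ?thesis unfolding cadjoint_weyl_up_to_phase[OF W] torus_char_0 by simp
qed

lemma orthonormal_fourier_basis: "orthonormal_on UNIV fourier_basis"
  unfolding orthonormal_on_def
proof (intro ballI)
  fix k l :: "(int, 'n) vec"
  obtain s where s: "cadjoint (U k) torus_one = cis s *\<^sub>C torus_char (- k)"
    using cadjoint_U_one by blast
  obtain t where t: "cadjoint (U l) torus_one = cis t *\<^sub>C torus_char (- l)"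
    using cadjoint_U_one by blast
  have *: "cinner (fourier_basis k) (fourier_basis l)
      = cinner (cadjoint (U l) torus_one) (cadjoint (U k) torus_one)"
    unfolding fourier_basis_def by (intro cinner_\<iota> nc_Upow_Linf)
  show "cinner (fourier_basis k) (fourier_basis l) = (if k = l then 1 else 0)"
  proof (cases "k = l")
    case True
    have "norm (torus_char (- k)) = 1" by (rule norm_orthonormal[OF orthonormal_torus_char]) simp
    hence "norm (cadjoint (U k) torus_one) = 1" by (simp add: s norm_scaleC)
    thus ?thesis using True * by (simp add: cinner_self)
  next
    case False
    have "cinner (torus_char (- l)) (torus_char (- k)) = 0"
      using orthonormal_torus_char[where 'a = 'n] False by (simp add: orthonormal_on_def)
    thus ?thesis using False by (simp add: * s t cinner_scaleC_left cinner_scaleC_right)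
  qed
qed

text \<open>Since \<open>u \<mapsto> u\<^sup>* 1\<close> is isometric for the norm of \<open>L\<^sub>2\<close>, approximating \<open>u\<^sup>* 1\<close> by combinations of
  characters approximates \<open>\<iota> u\<close> by combinations of the \<open>U\<^sup>k\<close>.\<close>

lemma orthonormal_basis_fourier_basis: "orthonormal_basis fourier_basis"
proof -
  let ?span = "complex_vs.span (range fourier_basis)"
  define S where "S = {y. \<exists>b\<in>Linf. cadjoint b torus_one = y \<and> \<iota> b \<in> ?span}"
  have "complex_vs.subspace S"
  proof (rule complex_vs.subspaceI)
    have scale: "c *\<^sub>C y \<in> S" if y: "y \<in> S" for c y
    proof -
      from y obtain b where b: "b \<in> Linf" "cadjoint b torus_one = y" "\<iota> b \<in> ?span"
        by (auto simp: S_def)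
      have "\<iota> (\<lambda>\<xi>. cnj c *\<^sub>C b \<xi>) \<in> ?span"
        unfolding \<iota>_scaleC[OF b(1)] by (intro complex_vs.span_scale b)
      moreover have "cadjoint (\<lambda>\<xi>. cnj c *\<^sub>C b \<xi>) torus_one = c *\<^sub>C y"
        by (simp add: cadjoint_scaleC_apply b)
      ultimately show ?thesis unfolding S_def using scaleC_Linf[OF b(1)] by blast
    qed
    show "c *\<^sub>C y \<in> S" if "y \<in> S" for c y using that by (rule scale)
    show "y + z \<in> S" if yz: "y \<in> S" "z \<in> S" for y z
    proof -
      from yz obtain a b where ab: "a \<in> Linf" "cadjoint a torus_one = y" "\<iota> a \<in> ?span"
        "b \<in> Linf" "cadjoint b torus_one = z" "\<iota> b \<in> ?span"
        by (auto simp: S_def)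
      have "\<iota> (\<lambda>\<xi>. a \<xi> + b \<xi>) \<in> ?span"
        unfolding \<iota>_add[OF ab(1,4)] by (intro complex_vs.span_add ab)
      moreover have "cadjoint (\<lambda>\<xi>. a \<xi> + b \<xi>) torus_one = y + z"
        by (simp add: cadjoint_add_apply ab)
      ultimately show ?thesis unfolding S_def using add_Linf[OF ab(1,4)] by blast
    qed
    have "cadjoint (U 0) torus_one \<in> S"
      unfolding S_def using nc_Upow_Linf complex_vs.span_base[of "fourier_basis 0" "range fourier_basis"]
      by (auto simp: fourier_basis_def)
    from scale[OF this, of 0] show "0 \<in> S" by simp
  qed
  note sub = this
  have "torus_char k \<in> S" for k
  proof -
    obtain t where t: "cadjoint (U (- k)) torus_one = cis t *\<^sub>C torus_char k"
      using cadjoint_U_one[of "- k"] by auto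
    have "cis t *\<^sub>C torus_char k \<in> S"
      unfolding S_def using nc_Upow_Linf t
        complex_vs.span_base[of "fourier_basis (- k)" "range fourier_basis"]
      by (auto simp: fourier_basis_def)
    hence "cis (- t) *\<^sub>C (cis t *\<^sub>C torus_char k) \<in> S" by (rule complex_vs.subspace_scale[OF sub])
    thus ?thesis by (simp add: scaleC_scaleC cis_mult)
  qed
  hence span_S: "complex_vs.span (range torus_char) \<subseteq> S"
    using sub by (intro complex_vs.span_minimal) auto
  have "\<iota> u \<in> closure ?span" if u: "u \<in> Linf" for u
    unfolding closure_approachable
  proof (intro allI impI)
    fix d :: real assume d: "0 < d"
    have "cadjoint u torus_one \<in> closure (complex_vs.span (range torus_char))"
      using Linf_one_in_char_space[OF cadjoint_Linf[OF u]] by (simp add: char_space_def)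
    then obtain y where y: "y \<in> complex_vs.span (range torus_char)" "dist y (cadjoint u torus_one) < d"
      unfolding closure_approachable using d by blast
    from y(1) span_S obtain b where b: "b \<in> Linf" "cadjoint b torus_one = y" "\<iota> b \<in> ?span"
      by (auto simp: S_def)
    have "dist (\<iota> b) (\<iota> u) = dist y (cadjoint u torus_one)"
      using norm_\<iota>[OF diff_Linf[OF b(1) u]]
      by (simp add: \<iota>_diff[OF b(1) u] cadjoint_diff_apply[OF b(1) u] b(2) dist_norm)
    with b y show "\<exists>z\<in>?span. dist z (\<iota> u) < d" by (intro bexI[of _ "\<iota> b"]) simp_all
  qed
  hence "closure (\<iota> ` Linf) \<subseteq> closure ?span"
    by (intro closure_minimal) auto
  hence "closure ?span = UNIV" using \<iota>_dense by auto
  with orthonormal_fourier_basis show ?thesis by (simp add: orthonormal_basis_def)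
qed

text \<open>Right multiplication by \<open>u\<close> can therefore be computed from any representative of \<open>\<iota> u\<close>, in
  particular from the one chosen in \<open>nc_lmult\<close>. The reason is that for \<open>d = u - v\<close> the equation
  \<open>\<iota> d = 0\<close> means \<open>d\<^sup>* 1 = 0\<close>, hence \<open>d\<^sup>*\<close> vanishes on the cyclic subspace, which contains \<open>a\<^sup>* 1\<close>.\<close>

lemma \<iota>_compose_cong:
  assumes u: "u \<in> Linf" and v: "v \<in> Linf" and eq: "\<iota> u = \<iota> v" and a: "a \<in> Linf"
  shows "\<iota> (a \<circ> u) = \<iota> (a \<circ> v)"
proof -
  define d where "d = (\<lambda>\<xi>. u \<xi> - v \<xi>)"
  have d: "d \<in> Linf" unfolding d_def by (rule diff_Linf[OF u v])
  have "norm (\<iota> d) = 0" unfolding d_def by (simp add: \<iota>_diff u v eq)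
  hence d0: "cadjoint d torus_one = 0" by (simp add: norm_\<iota>[OF d])
  have "cadjoint d (cadjoint a torus_one) = 0"
    by (rule Linf_zero_on_char_space[OF antisymmetric cadjoint_Linf[OF d] d0
          Linf_one_in_char_space[OF cadjoint_Linf[OF a]]])
  moreover have "cadjoint (a \<circ> d) = cadjoint d \<circ> cadjoint a"
    by (intro cadjoint_compose nc_Linf_bounded[of _ \<theta>] a d)
  ultimately have "norm (\<iota> (a \<circ> d)) = 0"
    by (simp add: norm_\<iota> compose_Linf a d)
  moreover have "a \<circ> d = (\<lambda>\<xi>. (a \<circ> u) \<xi> - (a \<circ> v) \<xi>)"
    by (simp add: d_def o_def bounded_clinearD(3)[OF nc_Linf_bounded[OF a]])
  hence "\<iota> (a \<circ> d) = \<iota> (a \<circ> u) - \<iota> (a \<circ> v)"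
    by (simp only: \<iota>_diff[OF compose_Linf[OF a u] compose_Linf[OF a v]])
  ultimately show ?thesis by simp
qed

text \<open>Right multiplication by \<open>U\<^sup>k\<close>, extended from \<open>L\<^sub>\<infinity>\<close> to \<open>L\<^sub>2\<close> by continuity. It is isometric because
  \<open>\<parallel>\<iota> (a U\<^sup>k)\<parallel> = \<parallel>(U\<^sup>k)\<^sup>* a\<^sup>* 1\<parallel> = \<parallel>a\<^sup>* 1\<parallel>\<close>.\<close>

definition right_mult :: "(int, 'n) vec \<Rightarrow> 'h \<Rightarrow> 'h" where
  "right_mult k = (SOME R. bounded_clinear R \<and> (\<forall>a\<in>Linf. R (\<iota> a) = \<iota> (a \<circ> U k)) \<and>
     (\<forall>x. norm (R x) = norm x))"

lemma right_mult:
  "bounded_clinear (right_mult k)" "a \<in> Linf \<Longrightarrow> right_mult k (\<iota> a) = \<iota> (a \<circ> U k)"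
  "norm (right_mult k x) = norm x"
proof -
  note UL = nc_Upow_Linf[of \<theta> k]
  note W = weyl_up_to_phase_Upow[of k \<theta>]
  define F where "F v = \<iota> (inv_into Linf \<iota> v \<circ> U k)" for v
  have F: "F (\<iota> a) = \<iota> (a \<circ> U k)" if a: "a \<in> Linf" for a
  proof -
    define b where "b = inv_into Linf \<iota> (\<iota> a)"
    have b: "b \<in> Linf" "\<iota> b = \<iota> a"
      unfolding b_def by (rule inv_into_into[OF imageI[OF a]], rule f_inv_into_f[OF imageI[OF a]])
    define d where "d = (\<lambda>\<xi>. b \<xi> - a \<xi>)"
    have d: "d \<in> Linf" unfolding d_def by (rule diff_Linf[OF b(1) a])
    have "norm (\<iota> d) = 0" unfolding d_def by (simp add: \<iota>_diff a b)
    hence "cadjoint d torus_one = 0" by (simp add: norm_\<iota>[OF d])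
    hence "norm (\<iota> (d \<circ> U k)) = 0"
      using cadjoint_compose[OF nc_Linf_bounded[OF d] nc_Linf_bounded[OF UL]]
      by (simp add: norm_\<iota> compose_Linf d UL
          bounded_clinearD(5)[OF bounded_clinear_cadjoint[OF nc_Linf_bounded[OF UL]]])
    moreover have "d \<circ> U k = (\<lambda>\<xi>. (b \<circ> U k) \<xi> - (a \<circ> U k) \<xi>)" by (simp add: d_def o_def)
    hence "\<iota> (d \<circ> U k) = \<iota> (b \<circ> U k) - \<iota> (a \<circ> U k)"
      by (simp only: \<iota>_diff[OF compose_Linf[OF b(1) UL] compose_Linf[OF a UL]])
    ultimately show ?thesis by (simp add: F_def flip: b_def)
  qed
  have "\<exists>R. bounded_clinear R \<and> (\<forall>v\<in>\<iota> ` Linf. R v = F v) \<and> (\<forall>v. norm (R v) = norm v)"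
  proof (rule isometry_extension[OF _ \<iota>_dense])
    show "complex_vs.subspace (\<iota> ` Linf)"
    proof (rule complex_vs.subspaceI)
      show sc: "c *\<^sub>C x \<in> \<iota> ` Linf" if "x \<in> \<iota> ` Linf" for c x
      proof -
        from that obtain a where a: "a \<in> Linf" "x = \<iota> a" by blast
        show ?thesis unfolding a(2) \<iota>_scaleC[OF a(1), symmetric] by (intro imageI scaleC_Linf a)
      qed
      show "x + y \<in> \<iota> ` Linf" if "x \<in> \<iota> ` Linf" "y \<in> \<iota> ` Linf" for x y
      proof -
        from that obtain a b where ab: "a \<in> Linf" "b \<in> Linf" "x = \<iota> a" "y = \<iota> b" by blast
        show ?thesis unfolding ab(3,4) \<iota>_add[OF ab(1,2), symmetric] by (intro imageI add_Linf ab)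
      qed
      from sc[of "\<iota> id" 0] show "0 \<in> \<iota> ` Linf" using id_Linf by auto
    qed
    show "F (v + w) = F v + F w" if vw: "v \<in> \<iota> ` Linf" "w \<in> \<iota> ` Linf" for v w
    proof -
      from vw obtain a b where ab: "a \<in> Linf" "b \<in> Linf" "v = \<iota> a" "w = \<iota> b" by blast
      have "F (v + w) = \<iota> ((\<lambda>\<xi>. a \<xi> + b \<xi>) \<circ> U k)"
        unfolding ab(3,4) by (simp add: F add_Linf ab flip: \<iota>_add)
      also have "\<dots> = F v + F w"
        using \<iota>_add[OF compose_Linf[OF ab(1) UL] compose_Linf[OF ab(2) UL]]
        by (simp add: ab F o_def)
      finally show ?thesis .
    qed
    show "F (c *\<^sub>C v) = c *\<^sub>C F v" if v: "v \<in> \<iota> ` Linf" for c v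
    proof -
      from v obtain a where a: "a \<in> Linf" "v = \<iota> a" by blast
      have "F (c *\<^sub>C v) = \<iota> ((\<lambda>\<xi>. c *\<^sub>C a \<xi>) \<circ> U k)"
        unfolding a(2) by (simp add: F scaleC_Linf a flip: \<iota>_scaleC)
      also have "\<dots> = c *\<^sub>C F v"
        using \<iota>_scaleC[OF compose_Linf[OF a(1) UL]] by (simp add: a F o_def)
      finally show ?thesis .
    qed
    show "norm (F v) = norm v" if v: "v \<in> \<iota> ` Linf" for v
    proof -
      from v obtain a where a: "a \<in> Linf" "v = \<iota> a" by blast
      show ?thesis
        using cadjoint_compose[OF nc_Linf_bounded[OF a(1)] nc_Linf_bounded[OF UL]]
        by (simp add: a F norm_\<iota> compose_Linf UL cadjoint_weyl_up_to_phase[OF W]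
            norm_weyl_up_to_phase[OF weyl_up_to_phase_inv(1)[OF W]])
    qed
  qed
  then obtain R where "bounded_clinear R \<and> (\<forall>a\<in>Linf. R (\<iota> a) = \<iota> (a \<circ> U k)) \<and> (\<forall>x. norm (R x) = norm x)"
    using F by auto
  from someI[of "\<lambda>R. bounded_clinear R \<and> (\<forall>a\<in>Linf. R (\<iota> a) = \<iota> (a \<circ> U k)) \<and> (\<forall>x. norm (R x) = norm x)",
      OF this]
  show "bounded_clinear (right_mult k)" "a \<in> Linf \<Longrightarrow> right_mult k (\<iota> a) = \<iota> (a \<circ> U k)"
    "norm (right_mult k x) = norm x"
    unfolding right_mult_def by blast+
qed

lemma nc_prod_eq:
  assumes R: "bounded_clinear R" "\<And>a. a \<in> Linf \<Longrightarrow> R (\<iota> a) = \<iota> (a \<circ> u)"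
  shows "nc_prod \<theta> \<iota> x u = R x"
proof -
  have "(THE R. bounded_clinear R \<and> (\<forall>a\<in>Linf. R (\<iota> a) = \<iota> (a \<circ> u))) = R"
  proof (rule the_equality)
    fix R' assume R': "bounded_clinear R' \<and> (\<forall>a\<in>Linf. R' (\<iota> a) = \<iota> (a \<circ> u))"
    show "R' = R"
      by (rule bounded_clinear_eq_on_dense[OF _ R(1) _ \<iota>_dense]) (use R R' in auto)
  qed (use R in auto)
  thus ?thesis by (simp add: nc_prod_def)
qed

lemma nc_lmult_eq:
  assumes u: "u \<in> Linf" and R: "bounded_clinear R" "\<And>a. a \<in> Linf \<Longrightarrow> R (\<iota> a) = \<iota> (a \<circ> u)"
  shows "nc_lmult \<theta> \<iota> x (\<iota> u) = Some (R x)"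
proof -
  define v where "v = inv_into Linf \<iota> (\<iota> u)"
  have v: "v \<in> Linf" "\<iota> u = \<iota> v"
    unfolding v_def by (rule inv_into_into[OF imageI[OF u]], rule f_inv_into_f[OF imageI[OF u], symmetric])
  have "nc_prod \<theta> \<iota> x v = R x"
    using R \<iota>_compose_cong[OF u v] by (intro nc_prod_eq) auto
  thus ?thesis using u by (simp add: nc_lmult_def flip: v_def)
qed

text \<open>The series inherits commutation relations from its terms, hence lies in the bicommutant. The second
  identity is tested against the dense set of the \<open>\<iota> b\<close>: there it reduces to the convergence of the
  series at the vector \<open>b\<^sup>* 1\<close>, and the adjoint of the series does not occur.\<close>

lemma fourier_series:
  assumes c: "(\<lambda>k. cmod (c k)) summable_on UNIV"
  defines "u \<equiv> \<lambda>\<xi>. \<Sum>\<^sub>\<infinity>k. c k *\<^sub>C U k \<xi>"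
  shows "u \<in> Linf"
    and "a \<in> Linf \<Longrightarrow> \<iota> (a \<circ> u) = (\<Sum>\<^sub>\<infinity>k. c k *\<^sub>C \<iota> (a \<circ> U k))"
proof -
  note bU = bounded_clinear_weyl_up_to_phase[OF weyl_up_to_phase_Upow]
  note nU = norm_weyl_up_to_phase[OF weyl_up_to_phase_Upow]
  note series = operator_series[of U, OF bU nU c]
  have map: "A (u \<xi>) = (\<Sum>\<^sub>\<infinity>k. c k *\<^sub>C A (U k \<xi>))" if A: "bounded_clinear A" for A :: "'n torus_operator" and \<xi>
    using infsumI[OF has_sum_bounded_linear[OF bounded_clinearD(1)[OF A] has_sum_infsum[OF series(1)]], of \<xi>]
    by (simp add: u_def bounded_clinearD(4)[OF A])
  show u: "u \<in> Linf"
  proof (rule nc_LinfI)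
    show "bounded_clinear u" unfolding u_def by (rule series(2))
    fix A :: "'n torus_operator" and v
    assume A: "bounded_clinear A" "\<And>B v. B \<in> Linf \<Longrightarrow> A (B v) = B (A v)"
    show "u (A v) = A (u v)"
      unfolding map[OF A(1)] A(2)[OF nc_Upow_Linf] by (simp add: u_def)
  qed
  assume a: "a \<in> Linf"
  note R = right_mult(1,3)
  have sm: "(\<lambda>k. c k *\<^sub>C \<iota> (a \<circ> U k)) summable_on UNIV"
    using operator_series(1)[of right_mult, OF R c, of "\<iota> a"] by (simp add: right_mult a)
  define w where "w = (\<Sum>\<^sub>\<infinity>k. c k *\<^sub>C \<iota> (a \<circ> U k))"
  have au: "a \<circ> u \<in> Linf" by (intro compose_Linf a u)
  have eq: "cinner (\<iota> (a \<circ> u)) (\<iota> b) = cinner w (\<iota> b)" if b: "b \<in> Linf" for b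
  proof -
    let ?b1 = "cadjoint b torus_one" and ?a1 = "cadjoint a torus_one"
    have ip: "cinner (\<iota> (a \<circ> v)) (\<iota> b) = cinner (v ?b1) ?a1" if v: "v \<in> Linf" for v
      using cinner_\<iota>[OF compose_Linf[OF a v] b]
        cadjoint_compose[OF nc_Linf_bounded[OF a] nc_Linf_bounded[OF v]]
      by (simp add: cinner_cadjoint[OF nc_Linf_bounded[OF v]])
    have "cinner (\<iota> (a \<circ> u)) (\<iota> b) = cinner (\<Sum>\<^sub>\<infinity>k. c k *\<^sub>C U k ?b1) ?a1"
      by (simp only: ip[OF u]) (simp add: u_def)
    also have "\<dots> = (\<Sum>\<^sub>\<infinity>k. cinner (c k *\<^sub>C U k ?b1) ?a1)"
      by (rule infsumI[OF has_sum_bounded_linear[OF bounded_linear_cinner_left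
            has_sum_infsum[OF series(1)]], symmetric])
    also have "\<dots> = (\<Sum>\<^sub>\<infinity>k. cinner (c k *\<^sub>C \<iota> (a \<circ> U k)) (\<iota> b))"
      by (simp add: cinner_scaleC_left ip nc_Upow_Linf)
    also have "\<dots> = cinner w (\<iota> b)"
      unfolding w_def
      by (rule infsumI[OF has_sum_bounded_linear[OF bounded_linear_cinner_left has_sum_infsum[OF sm]]])
    finally show ?thesis .
  qed
  have "closed {z. cinner (\<iota> (a \<circ> u) - w) z = 0}"
    by (intro closed_Collect_eq linear_continuous_on bounded_linear_cinner_right continuous_on_const)
  moreover have "\<iota> ` Linf \<subseteq> {z. cinner (\<iota> (a \<circ> u) - w) z = 0}"
    using eq by (auto simp: cinner_diff_left)
  ultimately have "closure (\<iota> ` Linf) \<subseteq> {z. cinner (\<iota> (a \<circ> u) - w) z = 0}"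
    by (rule closure_minimal[rotated])
  hence "\<iota> (a \<circ> u) - w \<in> {z. cinner (\<iota> (a \<circ> u) - w) z = 0}"
    unfolding \<iota>_dense by (rule subsetD[OF _ UNIV_I])
  thus "\<iota> (a \<circ> u) = (\<Sum>\<^sub>\<infinity>k. c k *\<^sub>C \<iota> (a \<circ> U k))" by (simp add: w_def)
qed

context
  fixes g :: "(int, 'n) vec \<Rightarrow> complex"
  assumes g: "(\<lambda>k. (cmod (g k))\<^sup>2) summable_on UNIV"
begin

lemma nc_fourier_mult_eq:
  "nc_fourier_mult \<theta> \<iota> g = synthesis fourier_basis (\<lambda>k. g k *\<^sub>C fourier_basis k)"
proof -
  have "norm (fourier_basis k) = 1" for k by (rule norm_orthonormal[OF orthonormal_fourier_basis]) simp
  hence sq: "(\<lambda>k. (norm (g k *\<^sub>C fourier_basis k))\<^sup>2) summable_on UNIV"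
    using g by (simp add: norm_scaleC)
  note G = bounded_clinear_synthesis[OF orthonormal_fourier_basis sq]
    synthesis_basis[OF orthonormal_fourier_basis]
  show ?thesis
    unfolding nc_fourier_mult_def fourier_basis_def[symmetric]
  proof (rule the_equality)
    fix G assume "bounded_clinear G \<and> (\<forall>k. G (fourier_basis k) = g k *\<^sub>C fourier_basis k)"
    thus "G = synthesis fourier_basis (\<lambda>k. g k *\<^sub>C fourier_basis k)"
      by (intro bounded_clinear_eq_on_basis[OF orthonormal_basis_fourier_basis _ G(1)]) (simp_all add: G(2))
  qed (simp add: G)
qed

text \<open>The coefficients of \<open>g(-i\<nabla>)v\<close> are products of two square-summable families, hence absolutely
  summable. So \<open>g(-i\<nabla>)v\<close> comes from a Fourier series in \<open>L\<^sub>\<infinity>\<close>, and \<open>\<lambda>(x)g(-i\<nabla>)v\<close> is the corresponding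
  series of the vectors \<open>x U\<^sup>k\<close>.\<close>

lemma nc_lmult_fourier_mult:
  "nc_lmult \<theta> \<iota> x (nc_fourier_mult \<theta> \<iota> g v)
    = Some (synthesis fourier_basis (\<lambda>k. g k *\<^sub>C right_mult k x) v)"
proof -
  define c where "c k = cinner v (fourier_basis k) * g k" for k
  have n1: "norm (fourier_basis k) = 1" for k by (rule norm_orthonormal[OF orthonormal_fourier_basis]) simp
  hence sq: "(\<lambda>k. (norm (g k *\<^sub>C fourier_basis k))\<^sup>2) summable_on UNIV"
    using g by (simp add: norm_scaleC)
  have c: "(\<lambda>k. cmod (c k)) summable_on UNIV"
    using synthesis_tail(1)[OF orthonormal_fourier_basis sq, of v]
    by (simp add: norm_scaleC n1 c_def norm_mult)
  define u where "u = (\<lambda>\<xi>. \<Sum>\<^sub>\<infinity>k. c k *\<^sub>C U k \<xi>)"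
  note u = fourier_series[OF c, folded u_def]
  have "\<iota> u = (\<Sum>\<^sub>\<infinity>k. c k *\<^sub>C fourier_basis k)"
    using u(2)[OF id_Linf] by (simp add: fourier_basis_def)
  also have "\<dots> = nc_fourier_mult \<theta> \<iota> g v"
    by (simp add: nc_fourier_mult_eq synthesis_def scaleC_scaleC c_def)
  finally have Gv: "nc_fourier_mult \<theta> \<iota> g v = \<iota> u" by simp
  have "nc_lmult \<theta> \<iota> x (\<iota> u) = Some (\<Sum>\<^sub>\<infinity>k. c k *\<^sub>C right_mult k x)"
    by (rule nc_lmult_eq[OF u(1) operator_series(2)[of right_mult, OF right_mult(1,3) c]])
       (simp add: u(2) right_mult(2))
  thus ?thesis by (simp add: Gv synthesis_def c_def scaleC_scaleC)
qed

lemma nc_cwikel_total: "nc_cwikel_total \<theta> \<iota> x g"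
  unfolding nc_cwikel_total_def using nc_lmult_fourier_mult by auto

lemma nc_cwikel_eq:
  "nc_cwikel \<theta> \<iota> x g = synthesis fourier_basis (\<lambda>k. g k *\<^sub>C right_mult k x)"
  by (simp add: fun_eq_iff nc_cwikel_def nc_lmult_fourier_mult)

lemma nc_cwikel_summable: "(\<lambda>k. (norm (g k *\<^sub>C right_mult k x))\<^sup>2) summable_on UNIV"
  using summable_on_cmult_left[OF g, of "(norm x)\<^sup>2"]
  by (simp add: norm_scaleC right_mult(3) power_mult_distrib)

lemma norm_nc_cwikel_basis: "norm (nc_cwikel \<theta> \<iota> x g (fourier_basis k)) = cmod (g k) * norm x"
  by (simp add: nc_cwikel_eq synthesis_basis[OF orthonormal_fourier_basis] norm_scaleC right_mult(3))

lemma compact_nc_cwikel: "compact_operator (nc_cwikel \<theta> \<iota> x g)"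
  unfolding nc_cwikel_eq
  by (rule compact_operator_synthesis[OF orthonormal_fourier_basis nc_cwikel_summable])

lemma hilbert_schmidt_nc_cwikel: "hilbert_schmidt (nc_cwikel \<theta> \<iota> x g) fourier_basis"
proof
  show "bounded_clinear (nc_cwikel \<theta> \<iota> x g)"
    using compact_nc_cwikel by (simp add: compact_operator_def)
  show "(\<lambda>k. (norm (nc_cwikel \<theta> \<iota> x g (fourier_basis k)))\<^sup>2) summable_on UNIV"
    using nc_cwikel_summable
    by (simp add: nc_cwikel_eq synthesis_basis[OF orthonormal_fourier_basis])
qed (rule orthonormal_basis_fourier_basis)

end

end

section \<open>Sequence spaces\<close>

lemma ell_square_summable:
  assumes p: "0 < p" "p < 2" and g: "g \<in> ell p"
  shows "(\<lambda>k. (cmod (g k))\<^sup>2) summable_on UNIV"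
proof -
  have sm: "(\<lambda>k. cmod (g k) powr p) summable_on UNIV" using g by (simp add: ell_def)
  define C where "C = infsum (\<lambda>k. cmod (g k) powr p) UNIV powr (1 / p)"
  have C: "cmod (g k) \<le> C" for k
  proof -
    have "cmod (g k) powr p \<le> infsum (\<lambda>k. cmod (g k) powr p) UNIV"
      using finite_sum_le_infsum[OF sm, of "{k}"] by simp
    hence "(cmod (g k) powr p) powr (1 / p) \<le> C"
      unfolding C_def using p by (intro powr_mono2) auto
    thus ?thesis using p by (simp add: powr_powr)
  qed
  show ?thesis
  proof (rule summable_on_comparison_test)
    show "(\<lambda>k. C powr (2 - p) * cmod (g k) powr p) summable_on UNIV"
      by (rule summable_on_cmult_right[OF sm])
    fix k
    have "(cmod (g k))\<^sup>2 = cmod (g k) powr (2 - p) * cmod (g k) powr p"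
      by (cases "g k = 0") (simp_all flip: powr_add powr_numeral)
    also have "\<dots> \<le> C powr (2 - p) * cmod (g k) powr p"
      using p C by (intro mult_right_mono powr_mono2) auto
    finally show "(cmod (g k))\<^sup>2 \<le> C powr (2 - p) * cmod (g k) powr p" .
  qed simp
qed

lemma rearrangement_nonneg:
  assumes "bounded (range a)"
  shows "0 \<le> rearrangement a j"
proof -
  from assms obtain B where B: "\<And>k. cmod (a k) \<le> B" by (auto simp: bounded_iff)
  have "{k. B < cmod (a k)} = {}" using B by (auto simp: not_less)
  moreover have "0 \<le> B" using B[of undefined] norm_ge_zero order_trans by blast
  ultimately have "B \<in> {t. 0 \<le> t \<and> finite {k. t < cmod (a k)} \<and> card {k. t < cmod (a k)} \<le> j}" by simp
  thus ?thesis unfolding rearrangement_def by (intro cInf_greatest) auto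
qed

text \<open>If \<open>|a|\<close> exceeds \<open>s\<close> at \<open>n + 1\<close> places, then the entry number \<open>n\<close> of the rearrangement is at
  least \<open>s\<close>; so the weak norm controls the distribution function.\<close>

lemma weak_ell_distribution:
  fixes a :: "'k \<Rightarrow> complex"
  assumes p: "0 < p" and a: "a \<in> weak_ell p" and s: "0 < s"
  shows "finite {k. s < cmod (a k)}"
    and "real (card {k. s < cmod (a k)}) \<le> weak_ell_norm p a powr p * s powr (- p)"
proof -
  let ?A = "weak_ell_norm p a" and ?S = "{k. s < cmod (a k)}"
  from a have bdd: "bdd_above (range (\<lambda>j. real (j + 1) powr (1 / p) * rearrangement a j))"
    and ba: "bounded (range a)" by (auto simp: weak_ell_def)
  obtain B where B: "\<And>k. cmod (a k) \<le> B" using ba by (auto simp: bounded_iff)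
  have le: "real (card F) \<le> ?A powr p * s powr (- p)" if F: "F \<subseteq> ?S" "finite F" for F
  proof (cases "F = {}")
    case False
    define n where "n = card F - 1"
    have n: "card F = n + 1" using False F(2) by (simp add: n_def card_gt_0_iff Suc_leI)
    have "s \<le> rearrangement a n"
      unfolding rearrangement_def
    proof (rule cInf_greatest)
      have e: "{k. max B 0 < cmod (a k)} = {}" using B by (force simp: not_less)
      have "max B 0 \<in> {t. 0 \<le> t \<and> finite {k. t < cmod (a k)} \<and> card {k. t < cmod (a k)} \<le> n}"
        unfolding mem_Collect_eq e by simp
      thus "{t. 0 \<le> t \<and> finite {k. t < cmod (a k)} \<and> card {k. t < cmod (a k)} \<le> n} \<noteq> {}" by blast
      fix t assume t: "t \<in> {t. 0 \<le> t \<and> finite {k. t < cmod (a k)} \<and> card {k. t < cmod (a k)} \<le> n}"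
      show "s \<le> t"
      proof (rule ccontr)
        assume "\<not> s \<le> t"
        hence "F \<subseteq> {k. t < cmod (a k)}" using F(1) by auto
        with t have "card F \<le> card {k. t < cmod (a k)}" by (intro card_mono) simp_all
        thus False using n t by simp
      qed
    qed
    hence "real (card F) powr (1 / p) * s \<le> real (n + 1) powr (1 / p) * rearrangement a n"
      unfolding n by (intro mult_left_mono) auto
    also have "\<dots> \<le> ?A" unfolding weak_ell_norm_def by (intro cSUP_upper bdd) auto
    finally have *: "real (card F) powr (1 / p) * s \<le> ?A" .
    have "(real (card F) powr (1 / p) * s) powr p \<le> ?A powr p"
      using * p s by (intro powr_mono2) auto
    hence "real (card F) * s powr p \<le> ?A powr p"
      using p s by (simp add: powr_mult powr_powr)
    thus ?thesis using s by (simp add: powr_minus field_simps)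
  qed simp
  have "card F \<le> nat \<lfloor>?A powr p * s powr (- p)\<rfloor>" if "F \<subseteq> ?S" "finite F" for F
    using le[OF that] by (simp add: le_nat_floor)
  thus fin: "finite ?S" by (intro finite_if_finite_subsets_card_bdd[THEN conjunct1])
  show "real (card ?S) \<le> ?A powr p * s powr (- p)" by (rule le[OF subset_refl fin])
qed

lemma weak_ell_square_summable:
  assumes p: "0 < p" "p < 2" and g: "g \<in> weak_ell p"
  shows "(\<lambda>k. (cmod (g k))\<^sup>2) summable_on UNIV"
proof -
  obtain B where B: "\<And>k. cmod (g k) \<le> B" using g by (auto simp: weak_ell_def bounded_iff)
  have "sum (\<lambda>k. (cmod (g k))\<^sup>2) F
      \<le> weak_ell_norm p g powr p * (B\<^sup>2) powr (1 - p / 2) / (1 - p / 2)" if F: "finite F" for F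
  proof -
    have "(\<Sum>k\<in>F. (cmod (g k))\<^sup>2) = (\<Sum>k\<in>F. min ((cmod (g k))\<^sup>2) (B\<^sup>2))"
      using B by (intro sum.cong) (auto simp: min_def power_mono)
    also have "\<dots> \<le> weak_ell_norm p g powr p * (B\<^sup>2) powr (1 - p / 2) / (1 - p / 2)"
      using p weak_ell_distribution[OF p(1) g]
      by (intro sum_min_square_le_of_distribution[OF F]) simp_all
    finally show ?thesis .
  qed
  thus ?thesis by (intro nonneg_bdd_above_summable_on bdd_aboveI) auto
qed

lemma weak_ell_norm_nonneg:
  assumes "a \<in> weak_ell p"
  shows "0 \<le> weak_ell_norm p a"
proof -
  have "0 \<le> real (0 + 1) powr (1 / p) * rearrangement a 0"
    using assms by (intro mult_nonneg_nonneg rearrangement_nonneg) (auto simp: weak_ell_def)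
  also have "\<dots> \<le> weak_ell_norm p a"
    unfolding weak_ell_norm_def using assms by (intro cSUP_upper) (auto simp: weak_ell_def)
  finally show ?thesis .
qed

lemma delta_in_weak_ell: "(\<lambda>k. if k = l then 1 else 0) \<in> weak_ell p"
proof -
  let ?d = "\<lambda>k. if k = l then 1 else 0 :: complex"
  have r: "rearrangement ?d j = 0" if "0 < j" for j
    unfolding rearrangement_def
  proof (rule cInf_eq_minimum)
    have "{k. 0 < cmod (?d k)} = {l}" by auto
    thus "0 \<in> {t. 0 \<le> t \<and> finite {k. t < cmod (?d k)} \<and> card {k. t < cmod (?d k)} \<le> j}"
      using that by simp
  qed auto
  have "range (\<lambda>j. real (j + 1) powr (1 / p) * rearrangement ?d j) \<subseteq> {rearrangement ?d 0, 0}"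
  proof (rule image_subsetI)
    fix j
    show "real (j + 1) powr (1 / p) * rearrangement ?d j \<in> {rearrangement ?d 0, 0}"
      using r[of j] by (cases "j = 0") simp_all
  qed
  hence "bdd_above (range (\<lambda>j. real (j + 1) powr (1 / p) * rearrangement ?d j))"
    by (rule bdd_above_mono[rotated]) simp
  moreover have "bounded (range ?d)" by (auto simp: bounded_iff intro!: exI[of _ 1])
  ultimately show ?thesis by (simp add: weak_ell_def)
qed


section \<open>Cwikel estimates on the noncommutative torus\<close>

context nc_L2
begin

lemma schatten_nc_cwikel:
  assumes p: "0 < p" "p < 2" and g: "g \<in> ell p"
  shows "nc_cwikel \<theta> \<iota> x g \<in> schatten p"
    and "schatten_norm p (nc_cwikel \<theta> \<iota> x g) \<le> norm x * ell_norm p g"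
proof -
  note sq = ell_square_summable[OF p g]
  interpret hilbert_schmidt "nc_cwikel \<theta> \<iota> x g" fourier_basis
    by (rule hilbert_schmidt_nc_cwikel[OF sq])
  have pw: "norm (nc_cwikel \<theta> \<iota> x g (fourier_basis k)) powr p = cmod (g k) powr p * norm x powr p" for k
    by (simp add: norm_nc_cwikel_basis[OF sq] powr_mult)
  have gs: "(\<lambda>k. cmod (g k) powr p) summable_on UNIV" using g by (simp add: ell_def)
  have sm: "(\<lambda>k. norm (nc_cwikel \<theta> \<iota> x g (fourier_basis k)) powr p) summable_on UNIV"
    unfolding pw by (rule summable_on_cmult_left[OF gs])
  note le = schatten_norm_le[OF p(1) less_imp_le[OF p(2)] sm]
  show "nc_cwikel \<theta> \<iota> x g \<in> schatten p"
    using le(1) compact_nc_cwikel[OF sq] by (simp add: schatten_def)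
  have "schatten_norm p (nc_cwikel \<theta> \<iota> x g)
      \<le> (infsum (\<lambda>k. cmod (g k) powr p) UNIV * norm x powr p) powr (1 / p)"
    using le(2) unfolding pw by (simp only: infsum_cmult_left')
  also have "\<dots> = norm x * ell_norm p g"
    using p by (simp add: powr_mult infsum_nonneg powr_powr ell_norm_def mult.commute)
  finally show "schatten_norm p (nc_cwikel \<theta> \<iota> x g) \<le> norm x * ell_norm p g" .
qed

lemma weak_schatten_nc_cwikel:
  assumes p: "0 < p" "p < 2" and g: "g \<in> weak_ell p"
  shows "nc_cwikel \<theta> \<iota> x g \<in> weak_schatten p"
    and "weak_schatten_norm p (nc_cwikel \<theta> \<iota> x g)
      \<le> 2 powr (1 / p) * (2 - p) powr (- (1 / p)) * norm x * weak_ell_norm p g"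
proof -
  let ?A = "weak_ell_norm p g" and ?T = "nc_cwikel \<theta> \<iota> x g"
  note sq = weak_ell_square_summable[OF p g]
  have A: "0 \<le> ?A" by (rule weak_ell_norm_nonneg[OF g])
  interpret hilbert_schmidt ?T fourier_basis
    by (rule hilbert_schmidt_nc_cwikel[OF sq])
  have dist: "finite {k. s < norm (?T (fourier_basis k))} \<and>
      real (card {k. s < norm (?T (fourier_basis k))}) \<le> (?A * norm x) powr p * s powr (- p)"
    if s: "0 < s" for s
  proof (cases "x = 0")
    case True
    thus ?thesis using s by (simp add: norm_nc_cwikel_basis[OF sq])
  next
    case False
    hence x: "0 < norm x" by simp
    have "{k. s < norm (?T (fourier_basis k))} = {k. s / norm x < cmod (g k)}"
      using x by (simp add: norm_nc_cwikel_basis[OF sq] field_simps)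
    moreover have "?A powr p * (s / norm x) powr (- p) = (?A * norm x) powr p * s powr (- p)"
      using x s A by (simp add: powr_mult powr_divide powr_minus field_simps)
    ultimately show ?thesis
      using weak_ell_distribution[OF p(1) g, of "s / norm x"] x s by simp
  qed
  define C where "C = 2 powr (1 / p) * (2 - p) powr (- (1 / p)) * norm x * ?A"
  have le: "real (j + 1) powr (1 / p) * singular_value ?T j \<le> C" for j
  proof -
    have \<mu>: "0 \<le> singular_value ?T j" by (rule enumerates_nonneg[OF enumerates_singular_value])
    have "real (j + 1) * singular_value ?T j powr p \<le> 2 / (2 - p) * (?A * norm x) powr p"
      using dist by (intro singular_value_le_of_distribution p) auto
    hence "(real (j + 1) * singular_value ?T j powr p) powr (1 / p)
        \<le> (2 / (2 - p) * (?A * norm x) powr p) powr (1 / p)"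
      using p by (intro powr_mono2) auto
    also have "\<dots> = C"
      using p A by (simp add: C_def powr_mult powr_divide powr_powr powr_minus field_simps)
    also have "(real (j + 1) * singular_value ?T j powr p) powr (1 / p)
        = real (j + 1) powr (1 / p) * singular_value ?T j"
      using p \<mu> by (simp add: powr_mult powr_powr)
    finally show ?thesis .
  qed
  show "?T \<in> weak_schatten p"
    unfolding weak_schatten_def using compact_nc_cwikel[OF sq] le by (auto intro!: bdd_aboveI)
  show "weak_schatten_norm p ?T \<le> 2 powr (1 / p) * (2 - p) powr (- (1 / p)) * norm x * ?A"
    unfolding weak_schatten_norm_def C_def[symmetric] by (rule cSUP_least) (use le in auto)
qed

text \<open>For \<open>x = 1\<close> and \<open>g\<close> the indicator of \<open>0\<close>, the operator is the orthogonal projection onto the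
  constants, with singular value \<open>1\<close>. This makes the best constant positive.\<close>

lemma weak_schatten_norm_pos:
  assumes p: "0 < p" "p < 2"
  defines "g \<equiv> \<lambda>k. if k = 0 then 1 else 0 :: complex"
  shows "0 < weak_schatten_norm p (nc_cwikel \<theta> \<iota> (fourier_basis 0) g)"
proof -
  let ?T = "nc_cwikel \<theta> \<iota> (fourier_basis 0) g"
  have g: "g \<in> weak_ell p" unfolding g_def by (rule delta_in_weak_ell)
  note sq = weak_ell_square_summable[OF p g]
  interpret hilbert_schmidt ?T fourier_basis
    by (rule hilbert_schmidt_nc_cwikel[OF sq])
  define f where "f = right_mult 0 (fourier_basis 0)"
  have n1: "norm (fourier_basis 0) = 1" by (rule norm_orthonormal[OF orthonormal_fourier_basis]) simp
  have e0: "cinner (fourier_basis 0) (fourier_basis 0) = 1" by (simp add: cinner_self n1)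
  have f: "cinner f f = 1" by (simp add: f_def cinner_self right_mult(3) n1)
  have T_eq: "?T z = cinner z (fourier_basis 0) *\<^sub>C f" for z
  proof -
    have "?T z = (\<Sum>\<^sub>\<infinity>k\<in>{0}. cinner z (fourier_basis k) *\<^sub>C (g k *\<^sub>C right_mult k (fourier_basis 0)))"
      unfolding nc_cwikel_eq[OF sq] synthesis_def
      by (intro infsum_cong_neutral) (auto simp: g_def)
    thus ?thesis by (simp add: g_def f_def)
  qed
  have "cadjoint ?T (?T (fourier_basis 0)) = fourier_basis 0"
  proof (rule cinner_eqI)
    fix z
    have "cinner z (cadjoint ?T (?T (fourier_basis 0))) = cinner (?T z) (?T (fourier_basis 0))"
      by (rule cinner_cadjoint[OF T, symmetric])
    also have "\<dots> = cinner z (fourier_basis 0)"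
      by (simp add: T_eq cinner_scaleC_left cinner_scaleC_right e0 f)
    finally show "cinner z (cadjoint ?T (?T (fourier_basis 0))) = cinner z (fourier_basis 0)" .
  qed
  hence E: "fourier_basis 0 \<in> singular_eigenspace ?T 1"
    by (simp add: singular_eigenspace_def)
  have "singular_mult ?T 1 \<noteq> 0"
  proof
    assume "singular_mult ?T 1 = 0"
    then obtain B where "finite B" "card B = 0" "singular_eigenspace ?T 1 \<subseteq> complex_vs.span B"
      using eigenspace_orthonormal_basis[of 1] by auto
    with E have "fourier_basis 0 = 0" by auto
    with n1 show False by simp
  qed
  hence "card {j. singular_value ?T j = 1} \<noteq> 0"
    using enumerates_singular_value by (simp add: enumerates_def)
  hence "{j. singular_value ?T j = 1} \<noteq> {}" by (metis card.empty)
  then obtain j where j: "singular_value ?T j = 1" by blast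
  have "0 < real (j + 1) powr (1 / p) * singular_value ?T j" by (simp add: j)
  also have "\<dots> \<le> weak_schatten_norm p ?T"
    unfolding weak_schatten_norm_def
    using weak_schatten_nc_cwikel(1)[OF p g, of "fourier_basis 0"]
    by (intro cSUP_upper) (auto simp: weak_schatten_def)
  finally show ?thesis .
qed

end

text \<open>The admissible constants form a closed half-line, because each admissibility condition
  \<open>w \<le> c * t\<close> has \<open>t \<ge> 0\<close>; one condition with \<open>w > 0\<close> keeps it away from \<open>0\<close>.\<close>

lemma best_constant_exists:
  fixes w t :: "'i \<Rightarrow> real"
  assumes C: "\<And>i. i \<in> I \<Longrightarrow> w i \<le> C * t i" and t: "\<And>i. i \<in> I \<Longrightarrow> 0 \<le> t i"
    and i0: "i0 \<in> I" "0 < w i0"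
  shows "\<exists>c>0. (\<forall>i\<in>I. w i \<le> c * t i) \<and> (\<forall>c'. (\<forall>i\<in>I. w i \<le> c' * t i) \<longrightarrow> c \<le> c') \<and> c \<le> C"
proof -
  define S where "S = {c. \<forall>i\<in>I. w i \<le> c * t i}"
  have t0: "0 < t i0" using C[OF i0(1)] t[OF i0(1)] i0(2) by (cases "t i0 = 0") auto
  have lower: "w i0 / t i0 \<le> c" if "c \<in> S" for c
    using that i0(1) t0 by (auto simp: S_def field_simps)
  hence bdd: "bdd_below S" by (rule bdd_belowI)
  have CS: "C \<in> S" using C by (auto simp: S_def)
  have "w i0 / t i0 \<le> Inf S" using lower CS by (intro cInf_greatest) auto
  moreover have "0 < w i0 / t i0" using t0 i0(2) by simp
  ultimately have "0 < Inf S" by linarith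
  moreover have "w i \<le> Inf S * t i" if i: "i \<in> I" for i
  proof (cases "t i = 0")
    case True
    thus ?thesis using C[OF i] by simp
  next
    case False
    hence ti: "0 < t i" using t[OF i] by simp
    have "w i / t i \<le> Inf S"
      using CS i ti by (intro cInf_greatest) (auto simp: S_def field_simps)
    thus ?thesis using ti by (simp add: field_simps)
  qed
  moreover have "Inf S \<le> c" if "c \<in> S" for c using that bdd by (rule cInf_lower)
  ultimately show ?thesis using CS unfolding S_def by (intro exI[of _ "Inf S"]) (simp add: S_def)
qed

theorem theorem4p8:
  fixes \<theta> :: "'n::{finite, linorder} square_matrix"
    and \<iota> :: "'n torus_operator \<Rightarrow> 'h::complex_hilbert"
    and p :: real
  assumes "CARD('n) \<ge> 2"
    and "transpose \<theta> = - \<theta>"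
    and "nc_L2_completion \<theta> \<iota>"
    and "0 < p" and "p < 2"
  shows "(\<forall>x. \<forall>g\<in>ell p.
            nc_cwikel_total \<theta> \<iota> x g \<and>
            nc_cwikel \<theta> \<iota> x g \<in> schatten p \<and>
            schatten_norm p (nc_cwikel \<theta> \<iota> x g) \<le> norm x * ell_norm p g) \<and>
         (\<exists>c>0.
            (\<forall>x. \<forall>g\<in>weak_ell p.
               nc_cwikel_total \<theta> \<iota> x g \<and>
               nc_cwikel \<theta> \<iota> x g \<in> weak_schatten p \<and>
               weak_schatten_norm p (nc_cwikel \<theta> \<iota> x g) \<le> c * norm x * weak_ell_norm p g) \<and>
            (\<forall>c'. (\<forall>x. \<forall>g\<in>weak_ell p.
               weak_schatten_norm p (nc_cwikel \<theta> \<iota> x g) \<le> c' * norm x * weak_ell_norm p g)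
               \<longrightarrow> c \<le> c') \<and>
            c \<le> 2 powr (1 / p) * (2 - p) powr (- (1 / p)))"
proof
  interpret nc_L2 \<theta> \<iota> using assms by unfold_locales
  note p = \<open>0 < p\<close> \<open>p < 2\<close>
  show "\<forall>x. \<forall>g\<in>ell p.
      nc_cwikel_total \<theta> \<iota> x g \<and>
      nc_cwikel \<theta> \<iota> x g \<in> schatten p \<and>
      schatten_norm p (nc_cwikel \<theta> \<iota> x g) \<le> norm x * ell_norm p g"
    using schatten_nc_cwikel[OF p] nc_cwikel_total[OF ell_square_summable[OF p]] by blast
  let ?w = "\<lambda>(x, g). weak_schatten_norm p (nc_cwikel \<theta> \<iota> x g)"
  let ?t = "\<lambda>(x :: 'h, g :: (int, 'n) vec \<Rightarrow> complex). norm x * weak_ell_norm p g"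
  let ?C = "2 powr (1 / p) * (2 - p) powr (- (1 / p))"
  have "\<exists>c>0. (\<forall>i\<in>UNIV \<times> weak_ell p. ?w i \<le> c * ?t i) \<and>
      (\<forall>c'. (\<forall>i\<in>UNIV \<times> weak_ell p. ?w i \<le> c' * ?t i) \<longrightarrow> c \<le> c') \<and> c \<le> ?C"
  proof (rule best_constant_exists)
    show "?w i \<le> ?C * ?t i" if "i \<in> UNIV \<times> weak_ell p" for i
      using that weak_schatten_nc_cwikel(2)[OF p] by (auto simp: mult.assoc)
    show "0 \<le> ?t i" if "i \<in> UNIV \<times> weak_ell p" for i
      using that by (auto simp: weak_ell_norm_nonneg)
    show "(fourier_basis 0, \<lambda>k. if k = 0 then 1 else 0) \<in> UNIV \<times> weak_ell p"
      by (simp add: delta_in_weak_ell)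
    show "0 < ?w (fourier_basis 0, \<lambda>k. if k = 0 then 1 else 0)"
      using weak_schatten_norm_pos[OF p] by simp
  qed
  then obtain c where c: "0 < c" "\<forall>i\<in>UNIV \<times> weak_ell p. ?w i \<le> c * ?t i"
    "\<forall>c'. (\<forall>i\<in>UNIV \<times> weak_ell p. ?w i \<le> c' * ?t i) \<longrightarrow> c \<le> c'" "c \<le> ?C" by (elim exE conjE)
  show "\<exists>c>0.
      (\<forall>x. \<forall>g\<in>weak_ell p.
         nc_cwikel_total \<theta> \<iota> x g \<and>
         nc_cwikel \<theta> \<iota> x g \<in> weak_schatten p \<and>
         weak_schatten_norm p (nc_cwikel \<theta> \<iota> x g) \<le> c * norm x * weak_ell_norm p g) \<and>
      (\<forall>c'. (\<forall>x. \<forall>g\<in>weak_ell p.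
         weak_schatten_norm p (nc_cwikel \<theta> \<iota> x g) \<le> c' * norm x * weak_ell_norm p g)
         \<longrightarrow> c \<le> c') \<and>
      c \<le> 2 powr (1 / p) * (2 - p) powr (- (1 / p))"
  proof (intro exI[of _ c] conjI allI ballI impI)
    fix x :: 'h and g :: "(int, 'n) vec \<Rightarrow> complex" assume g: "g \<in> weak_ell p"
    show "nc_cwikel_total \<theta> \<iota> x g" by (rule nc_cwikel_total[OF weak_ell_square_summable[OF p g]])
    show "nc_cwikel \<theta> \<iota> x g \<in> weak_schatten p" by (rule weak_schatten_nc_cwikel[OF p g])
    show "weak_schatten_norm p (nc_cwikel \<theta> \<iota> x g) \<le> c * norm x * weak_ell_norm p g"
      using c(2) g by (auto simp: mult.assoc)
  next
    fix c' assume "\<forall>x. \<forall>g\<in>weak_ell p.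
      weak_schatten_norm p (nc_cwikel \<theta> \<iota> x g) \<le> c' * norm x * weak_ell_norm p g"
    thus "c \<le> c'" by (intro c(3)[rule_format]) (auto simp: mult.assoc)
  qed (use c in auto)
qed

end
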